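(* Every continuous function $u\in\mathrm{Dom}(\mathbb{E})$ with $\Gamma(u,u)\le1$ $\mathbb{Q}_0^\beta$-a.e. on $\mathcal{G}_0$ is 1-Lipschitz on $\mathcal{G}_0$, i.e. $|u(g)-u(h)|\le\|g-h\|_{L^2}$ for all $g,h\in\mathcal{G}_0$.
   Context: $\mathcal{G}_0$ is the set of right continuous nondecreasing maps $g:[0,1[\,\to[0,1]$ extended by $g(1):=1$, with the $L^2([0,1])$ distance (continuity refers to this topology). Fix $\beta>0$; $\mathbb{Q}_0^\beta$ is the probability measure on $\mathcal{G}_0$ such that for every $N$ and $0=t_0<\dots<t_{N+1}=1$ the law of $(g(t_1),\dots,g(t_N))$ is $\frac{\Gamma(\beta)}{\prod_{i=0}^{N}\Gamma(\beta(t_{i+1}-t_i))}\prod_{i=0}^{N}(x_{i+1}-x_i)^{\beta(t_{i+1}-t_i)-1}dx$ on $\{0<x_1<\dots<x_N<1\}$, $x_0:=0,x_{N+1}:=1$. For $u(g)=U(\int_0^1\vec\alpha(g_s)ds)$ with $U\in\mathcal{C}^1(\mathbb{R}^m)$, $\vec\alpha\in\mathcal{C}^1([0,1],\mathbb{R}^m)$ (class $\mathfrak{Z}^1(\mathcal{G}_0)$), $\mathbb{D}u(g)=\sum_i\partial_iU(\int\vec\alpha(g_s)ds)\alpha_i'(g(\cdot))$. $(\mathbb{E},\mathrm{Dom}(\mathbb{E}))$ is the closure in $L^2(\mathcal{G}_0,\mathbb{Q}_0^\beta)$ of $\mathbb{E}(u,v)=\int\langle\mathbb{D}u,\mathbb{D}v\rangle_{L^2}d\mathbb{Q}_0^\beta$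 on $\mathfrak{Z}^1(\mathcal{G}_0)$, $\overline{\mathbb{D}}$ the closure of $\mathbb{D}$, and $\Gamma(u,u):=\|\overline{\mathbb{D}}u\|^2_{L^2([0,1])}$. *)

theory Defs
  imports "HOL-Probability.Probability"
begin

text \<open>Elements of G_0 are represented as total functions real => real. On [0,1[ they are
right continuous, nondecreasing, with values in [0,1]; g(1) = 1. Outside [0,1] we fix the
normalisation g t = 0 for t < 0 and g t = 1 for t >= 1 (so that each element of G_0 has a
unique representative).\<close>

definition G0 :: "(real \<Rightarrow> real) set" where
  "G0 = {g. mono_on {0..<1} g
            \<and> (\<forall>t\<in>{0..<1}. g t \<in> {0..1})
            \<and> (\<forall>t\<in>{0..<1}. continuous (at_right t) g)
            \<and> (\<forall>t. t < 0 \<longrightarrow> g t = 0)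
            \<and> (\<forall>t. 1 \<le> t \<longrightarrow> g t = 1)}"

definition L2dist :: "(real \<Rightarrow> real) \<Rightarrow> (real \<Rightarrow> real) \<Rightarrow> real" where
  "L2dist g h = sqrt (integral {0..1} (\<lambda>s. (g s - h s)\<^sup>2))"

definition continuous_G0 :: "((real \<Rightarrow> real) \<Rightarrow> real) \<Rightarrow> bool" where
  "continuous_G0 u \<longleftrightarrow> (\<forall>g\<in>G0. \<forall>e>0. \<exists>d>0. \<forall>h\<in>G0. L2dist g h < d \<longrightarrow> \<bar>u h - u g\<bar> < e)"

definition ext_pts :: "nat \<Rightarrow> (nat \<Rightarrow> real) \<Rightarrow> nat \<Rightarrow> real" where
  "ext_pts N x i = (if i = 0 then 0 else if i = Suc N then 1 else x i)"

definition dirichlet_density :: "real \<Rightarrow> nat \<Rightarrow> (nat \<Rightarrow> real) \<Rightarrow> (nat \<Rightarrow> real) \<Rightarrow> real" where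
  "dirichlet_density \<beta> N t x =
     (let y = ext_pts N x in
      if (\<forall>i\<le>N. y i < y (Suc i)) then
        Gamma \<beta> / (\<Prod>i\<le>N. Gamma (\<beta> * (t (Suc i) - t i)))
        * (\<Prod>i\<le>N. (y (Suc i) - y i) powr (\<beta> * (t (Suc i) - t i) - 1))
      else 0)"

definition G0_sets :: "(real \<Rightarrow> real) set set" where
  "G0_sets = sigma_sets G0 {{g\<in>G0. g t \<in> A} | t A. t \<in> {0..1} \<and> A \<in> sets borel}"

definition is_Q_beta :: "real \<Rightarrow> (real \<Rightarrow> real) measure \<Rightarrow> bool" where
  "is_Q_beta \<beta> Q \<longleftrightarrow>
     prob_space Q \<and> space Q = G0 \<and> sets Q = G0_sets \<and>
     (\<forall>N (t::nat \<Rightarrow> real). t 0 = 0 \<and> t (Suc N) = 1 \<and> (\<forall>i\<le>N. t i < t (Suc i)) \<longrightarrow>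
        distr Q (PiM {1..N} (\<lambda>_. lborel)) (\<lambda>g. \<lambda>i\<in>{1..N}. g (t i))
        = density (PiM {1..N} (\<lambda>_. lborel)) (\<lambda>x. ennreal (dirichlet_density \<beta> N t x)))"

definition Rm :: "nat \<Rightarrow> (nat \<Rightarrow> real) set" where
  "Rm m = {x. \<forall>i\<ge>m. x i = 0}"

definition C1_Rm :: "nat \<Rightarrow> ((nat \<Rightarrow> real) \<Rightarrow> real) \<Rightarrow> ((nat \<Rightarrow> real) \<Rightarrow> nat \<Rightarrow> real) \<Rightarrow> bool" where
  "C1_Rm m U DU \<longleftrightarrow>
     (\<forall>x\<in>Rm m. \<forall>e>0. \<exists>d>0. \<forall>h\<in>Rm m. sqrt (\<Sum>i<m. (h i)\<^sup>2) < d \<longrightarrow>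
          \<bar>U (\<lambda>i. x i + h i) - U x - (\<Sum>i<m. DU x i * h i)\<bar> \<le> e * sqrt (\<Sum>i<m. (h i)\<^sup>2))
   \<and> (\<forall>x\<in>Rm m. \<forall>e>0. \<exists>d>0. \<forall>y\<in>Rm m. sqrt (\<Sum>i<m. (y i - x i)\<^sup>2) < d \<longrightarrow>
          (\<forall>i<m. \<bar>DU y i - DU x i\<bar> < e))"

definition C1_01 :: "nat \<Rightarrow> (nat \<Rightarrow> real \<Rightarrow> real) \<Rightarrow> (nat \<Rightarrow> real \<Rightarrow> real) \<Rightarrow> bool" where
  "C1_01 m \<alpha> \<alpha>' \<longleftrightarrow>
     (\<forall>i<m. (\<forall>t\<in>{0..1}. (\<alpha> i has_real_derivative \<alpha>' i t) (at t within {0..1}))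
            \<and> continuous_on {0..1} (\<alpha>' i))"

definition Z1_vec :: "nat \<Rightarrow> (nat \<Rightarrow> real \<Rightarrow> real) \<Rightarrow> (real \<Rightarrow> real) \<Rightarrow> nat \<Rightarrow> real" where
  "Z1_vec m \<alpha> g = (\<lambda>i. if i < m then integral {0..1} (\<lambda>s. \<alpha> i (g s)) else 0)"

definition Z1_fun :: "nat \<Rightarrow> ((nat \<Rightarrow> real) \<Rightarrow> real) \<Rightarrow> (nat \<Rightarrow> real \<Rightarrow> real) \<Rightarrow> (real \<Rightarrow> real) \<Rightarrow> real" where
  "Z1_fun m U \<alpha> g = U (Z1_vec m \<alpha> g)"

definition Z1_grad :: "nat \<Rightarrow> ((nat \<Rightarrow> real) \<Rightarrow> nat \<Rightarrow> real) \<Rightarrow> (nat \<Rightarrow> real \<Rightarrow> real)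
                       \<Rightarrow> (nat \<Rightarrow> real \<Rightarrow> real) \<Rightarrow> (real \<Rightarrow> real) \<Rightarrow> real \<Rightarrow> real" where
  "Z1_grad m DU \<alpha> \<alpha>' g s = (\<Sum>i<m. DU (Z1_vec m \<alpha> g) i * \<alpha>' i (g s))"

definition Z1_graph :: "(((real \<Rightarrow> real) \<Rightarrow> real) \<times> ((real \<Rightarrow> real) \<Rightarrow> real \<Rightarrow> real)) set" where
  "Z1_graph = {(Z1_fun m U \<alpha>, Z1_grad m DU \<alpha> \<alpha>') | m U DU \<alpha> \<alpha>'. C1_Rm m U DU \<and> C1_01 m \<alpha> \<alpha>'}"

text \<open>u belongs to Dom(E) with closed gradient F (= closure of D applied to u) iff there is a sequence
(u_n, D u_n) in the graph of D on Z^1 with u_n -> u in L^2(Q) and D u_n -> F in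
L^2(Q; L^2([0,1])).\<close>
definition dom_E_grad :: "(real \<Rightarrow> real) measure \<Rightarrow> ((real \<Rightarrow> real) \<Rightarrow> real)
                          \<Rightarrow> ((real \<Rightarrow> real) \<Rightarrow> real \<Rightarrow> real) \<Rightarrow> bool" where
  "dom_E_grad Q u F \<longleftrightarrow>
     u \<in> borel_measurable Q \<and> (\<integral>\<^sup>+ g. ennreal ((u g)\<^sup>2) \<partial>Q) < \<infinity> \<and>
     (\<lambda>(g, s). F g s) \<in> borel_measurable (Q \<Otimes>\<^sub>M lborel) \<and>
     (\<exists>seq :: nat \<Rightarrow> ((real \<Rightarrow> real) \<Rightarrow> real) \<times> ((real \<Rightarrow> real) \<Rightarrow> real \<Rightarrow> real).
        (\<forall>n. seq n \<in> Z1_graph) \<and>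
        ((\<lambda>n. \<integral>\<^sup>+ g. ennreal ((fst (seq n) g - u g)\<^sup>2) \<partial>Q) \<longlonglongrightarrow> 0) \<and>
        ((\<lambda>n. \<integral>\<^sup>+ g. (\<integral>\<^sup>+ s\<in>{0..1}. ennreal ((snd (seq n) g s - F g s)\<^sup>2) \<partial>lborel) \<partial>Q) \<longlonglongrightarrow> 0))"

definition Gamma_uu :: "((real \<Rightarrow> real) \<Rightarrow> real \<Rightarrow> real) \<Rightarrow> (real \<Rightarrow> real) \<Rightarrow> ennreal" where
  "Gamma_uu F g = (\<integral>\<^sup>+ s\<in>{0..1}. ennreal ((F g s)\<^sup>2) \<partial>lborel)"

end

theory Submission
  imports Defs
begin

text \<open>Fix a grid i/K and move the values of g at the grid points linearly, keeping the relative position of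
g(s) between the two neighbouring grid values fixed. The resulting path is a straight segment in
L2, and after multiplication by a weight depending on the grid values only, the law Q
is invariant under these motions (on each finer grid this is an explicit change of variables in
the Dirichlet density). Hence the convergence of the approximating cylinder functions and of
their gradients survives along almost every such segment, which gives the Lipschitz bound between its
end points. Given two arbitrary maps g and h, a fine grid and a set of positive measure provide
segments whose end points are close to g and h, and continuity of u concludes.\<close>

section \<open>Right-continuous nondecreasing maps and the Dirichlet process\<close>

text \<open>Membership in the domain is an L2 limit and the gradient bound holds only almost
  everywhere, so neither says anything about one given segment, which is a Q-null set. A family of
  segments of positive measure must be moved at once, without pushing mass onto sets that Q nearly
  ignores, uniformly in the time along the segment. The motion is designed for this. Under Q the
  values on the grid i/K have density proportional to the product of the (x_(i+1) - x_i)^(\<beta>/K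
  - 1), and given these values the relative positions inside the cells have a law that does not
  depend on them. Dividing by this density leaves Lebesgue measure for the grid values, which
  translations preserve, and the motion changes nothing else. The cancellation holds for every
  number L of points per cell, which is what lifts it from finite grids to the law of the whole map.
  Grid values are confined to a small box so that all increments stay bounded below: the moved maps
  remain nondecreasing and the weight remains bounded. Straight segments give the sharp constant,
  because their velocity has L2 norm equal to the distance of their end points.\<close>

lemma G0_range:
  assumes "g \<in> G0"
  shows "0 \<le> g t" "g t \<le> 1"
proof -
  consider "t < 0" | "t \<in> {0..<1}" | "1 \<le> t" by fastforce
  then have "g t \<in> {0..1}"
    using assms unfolding G0_def by cases auto
  then show "0 \<le> g t" "g t \<le> 1" by auto
qed

lemma G0_mono:
  assumes "g \<in> G0"
  shows "mono g"
proof
  fix s t :: real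
  assume "s \<le> t"
  consider "s < 0" | "1 \<le> t" | "s \<in> {0..<1}" "t \<in> {0..<1}" using \<open>s \<le> t\<close> by fastforce
  then show "g s \<le> g t"
  proof cases
    case 1
    then have "g s = 0" using assms by (auto simp: G0_def)
    then show ?thesis using G0_range[OF assms] by simp
  next
    case 2
    then have "g t = 1" using assms by (auto simp: G0_def)
    then show ?thesis using G0_range[OF assms] by simp
  next
    case 3
    then show ?thesis using assms \<open>s \<le> t\<close> by (auto simp: G0_def intro: mono_onD)
  qed
qed

lemma G0_right_continuous:
  assumes "g \<in> G0"
  shows "(g \<longlongrightarrow> g t) (at_right t)"
proof -
  consider "t < 0" | "t \<in> {0..<1}" | "1 \<le> t" by fastforce
  then show ?thesis
  proof cases
    case 1
    have "\<forall>\<^sub>F s in at_right t. g t = g s"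
      using eventually_at_right_real[OF 1] by eventually_elim (use assms 1 in \<open>auto simp: G0_def\<close>)
    then show ?thesis by (rule Lim_transform_eventually[OF tendsto_const])
  next
    case 2
    then show ?thesis using assms by (auto simp: G0_def continuous_within)
  next
    case 3
    have "\<forall>\<^sub>F s in at_right t. g t = g s"
      using eventually_at_right_less[of t] by eventually_elim (use assms 3 in \<open>auto simp: G0_def\<close>)
    then show ?thesis by (rule Lim_transform_eventually[OF tendsto_const])
  qed
qed

lemma G0I:
  assumes "\<And>s t. 0 \<le> s \<Longrightarrow> s \<le> t \<Longrightarrow> t < 1 \<Longrightarrow> g s \<le> g t"
    and "\<And>t. 0 \<le> t \<Longrightarrow> t < 1 \<Longrightarrow> (g \<longlongrightarrow> g t) (at_right t)"
    and "\<And>t. 0 \<le> t \<Longrightarrow> t < 1 \<Longrightarrow> 0 \<le> g t \<and> g t \<le> 1"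
    and "\<And>t. t < 0 \<Longrightarrow> g t = 0" "\<And>t. 1 \<le> t \<Longrightarrow> g t = 1"
  shows "g \<in> G0"
  using assms by (auto simp: G0_def continuous_within intro!: mono_onI)

lemma G0_borel: "g \<in> G0 \<Longrightarrow> g \<in> borel_measurable borel"
  by (rule borel_measurable_mono[OF G0_mono])

section \<open>Approximation from the right by grid points\<close>

definition grid_above :: "nat \<Rightarrow> real \<Rightarrow> real"
  where "grid_above n s = (of_int \<lfloor>real n * s\<rfloor> + 1) / real n"

lemma grid_above_bounds:
  assumes "0 < n"
  shows "s < grid_above n s" "grid_above n s \<le> s + 1 / n"
proof -
  have "real n * s < of_int \<lfloor>real n * s\<rfloor> + 1" "of_int \<lfloor>real n * s\<rfloor> \<le> real n * s"
    by linarith+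
  then show "s < grid_above n s" "grid_above n s \<le> s + 1 / n"
    using assms by (auto simp: grid_above_def field_simps)
qed

text \<open>The \<open>+ 1\<close> in \<open>grid_above\<close> puts the grid point strictly to the
  right of \<open>s\<close>, so right continuity alone controls the limit. Multiples
  \<open>K * Suc n\<close> are taken so that these points belong to refinements of the grid with
  \<open>K\<close> cells.\<close>

lemma filterlim_grid_above:
  assumes "0 < K"
  shows "filterlim (\<lambda>n. grid_above (K * Suc n) s) (at_right s) sequentially"
proof -
  have "(\<lambda>n. grid_above (K * Suc n) s) \<longlonglongrightarrow> s"
  proof (rule tendsto_sandwich)
    show "\<forall>\<^sub>F n in sequentially. s \<le> grid_above (K * Suc n) s"
      using grid_above_bounds(1)[of "K * Suc _" s] assms by (auto intro!: always_eventually less_imp_le)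
    show "\<forall>\<^sub>F n in sequentially. grid_above (K * Suc n) s \<le> s + inverse (real (Suc n))"
    proof (intro always_eventually allI)
      fix n
      have "grid_above (K * Suc n) s \<le> s + 1 / real (K * Suc n)"
        using grid_above_bounds(2)[of "K * Suc n" s] assms by simp
      also have "1 / real (K * Suc n) \<le> 1 / real (Suc n)"
      proof (rule frac_le)
        have "Suc n \<le> K * Suc n" using assms by (cases K) auto
        then show "real (Suc n) \<le> real (K * Suc n)" by (rule of_nat_mono)
      qed (use assms in auto)
      finally show "grid_above (K * Suc n) s \<le> s + inverse (real (Suc n))"
        by (simp add: inverse_eq_divide)
    qed
    show "(\<lambda>n. s + inverse (real (Suc n))) \<longlonglongrightarrow> s"
      using tendsto_add[OF tendsto_const LIMSEQ_inverse_real_of_nat, of s] by simp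
  qed simp
  then show ?thesis
    unfolding filterlim_at using grid_above_bounds(1)[of "K * Suc _" s] assms
    by (auto intro!: always_eventually less_imp_le simp: less_imp_neq) (metis less_irrefl mult_is_0 nat.distinct(1) neq0_conv)
qed

lemma G0_grid_above_tendsto:
  assumes "g \<in> G0" "0 < K"
  shows "(\<lambda>n. g (grid_above (K * Suc n) s)) \<longlonglongrightarrow> g s"
  by (rule filterlim_compose[OF G0_right_continuous[OF assms(1)] filterlim_grid_above[OF assms(2)]])

section \<open>The Dirichlet process and the measurability of its evaluations\<close>

locale dirichlet_process =
  fixes \<beta> :: real and Q :: "(real \<Rightarrow> real) measure"
  assumes \<beta>_pos: "\<beta> > 0" and Q: "is_Q_beta \<beta> Q"
begin

sublocale prob_space Q using Q by (simp add: is_Q_beta_def)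

lemma space_Q [simp]: "space Q = G0" using Q by (simp add: is_Q_beta_def)

lemma sets_Q: "sets Q = G0_sets" using Q by (simp add: is_Q_beta_def)

lemma eval_measurable [measurable]: "(\<lambda>g. g t) \<in> borel_measurable Q"
proof -
  consider "t < 0" | "t \<in> {0..1}" | "1 < t" by fastforce
  then show ?thesis
  proof cases
    case 1
    then have "(\<lambda>g. g t) \<in> borel_measurable Q \<longleftrightarrow> (\<lambda>g. 0::real) \<in> borel_measurable Q"
      by (intro measurable_cong) (auto simp: G0_def)
    then show ?thesis by simp
  next
    case 2
    show ?thesis
    proof (rule measurableI)
      fix A :: "real set" assume "A \<in> sets borel"
      then have "{g\<in>G0. g t \<in> A} \<in> sigma_sets G0 {{g\<in>G0. g t \<in> A} | t A. t \<in> {0..1} \<and> A \<in> sets borel}"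
        using 2 by (intro sigma_sets.Basic) auto
      moreover have "(\<lambda>g. g t) -` A \<inter> space Q = {g\<in>G0. g t \<in> A}" by auto
      ultimately show "(\<lambda>g. g t) -` A \<inter> space Q \<in> sets Q" by (simp add: sets_Q G0_sets_def)
    qed simp
  next
    case 3
    then have "(\<lambda>g. g t) \<in> borel_measurable Q \<longleftrightarrow> (\<lambda>g. 1::real) \<in> borel_measurable Q"
      by (intro measurable_cong) (auto simp: G0_def)
    then show ?thesis by simp
  qed
qed

lemma measurable_into_Q:
  assumes "\<And>w. w \<in> space M \<Longrightarrow> f w \<in> G0"
    and "\<And>t. (\<lambda>w. f w t) \<in> borel_measurable M"
  shows "f \<in> measurable M Q"
proof (rule measurable_sigma_sets)
  show "sets Q = sigma_sets G0 {{g\<in>G0. g t \<in> A} | t A. t \<in> {0..1} \<and> A \<in> sets borel}"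
    by (simp add: sets_Q G0_sets_def)
  fix Y assume "Y \<in> {{g\<in>G0. g t \<in> A} | t A. t \<in> {0..1::real} \<and> A \<in> sets (borel :: real measure)}"
  then obtain t :: real and A where Y: "Y = {g\<in>G0. g t \<in> A}" and A: "A \<in> sets borel" by auto
  have "f -` Y \<inter> space M = (\<lambda>w. f w t) -` A \<inter> space M" using assms(1) by (auto simp: Y)
  then show "f -` Y \<inter> space M \<in> sets M" using measurable_sets[OF assms(2) A] by simp
qed (use assms(1) in auto)

text \<open>The approximation \<open>g (grid_above n s)\<close> depends on \<open>s\<close> only
  through an integer. For each value of that integer it is a single evaluation map, so it is glued
  from countably many measurable pieces; right continuity gives the limit.\<close>

lemma joint_eval_measurable [measurable]:
  "(\<lambda>(g, s). g s) \<in> borel_measurable (Q \<Otimes>\<^sub>M lborel)"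
proof (rule borel_measurable_LIMSEQ_real)
  fix p :: "(real \<Rightarrow> real) \<times> real" assume "p \<in> space (Q \<Otimes>\<^sub>M lborel)"
  then show "(\<lambda>n. (\<lambda>(g, s). g (grid_above (1 * Suc n) s)) p) \<longlonglongrightarrow> (\<lambda>(g, s). g s) p"
    using G0_grid_above_tendsto[of "fst p" 1 "snd p"] by (auto simp: space_pair_measure split: prod.splits)
next
  fix n
  have "(\<lambda>p. (\<lambda>k p. fst p ((of_int k + 1) / real (1 * Suc n))) \<lfloor>real (1 * Suc n) * snd p\<rfloor> p)
      \<in> borel_measurable (Q \<Otimes>\<^sub>M lborel)"
    by (rule measurable_compose_countable) measurable
  then show "(\<lambda>(g, s). g (grid_above (1 * Suc n) s)) \<in> borel_measurable (Q \<Otimes>\<^sub>M lborel)"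
    by (simp add: grid_above_def case_prod_beta')
qed

end

section \<open>Substitution in the Dirichlet density\<close>

text \<open>One coordinate at a time: the added coordinate is integrated innermost by the
  one-dimensional affine substitution. The result serves twice, with all factors 1 to translate the
  coarse grid values, and with one factor per cell to rescale the points between them.\<close>

lemma nn_integral_PiM_affine:
  fixes p q :: "'i \<Rightarrow> real"
  assumes "finite J" "\<And>j. j \<in> J \<Longrightarrow> 0 < q j"
    and "H \<in> borel_measurable (PiM J (\<lambda>_. lborel))"
  shows "(\<integral>\<^sup>+ z. H z \<partial>PiM J (\<lambda>_. lborel))
    = ennreal (\<Prod>j\<in>J. q j) * (\<integral>\<^sup>+ z. H (\<lambda>j\<in>J. p j + q j * z j) \<partial>PiM J (\<lambda>_. lborel))"
  using assms
proof (induction J arbitrary: H rule: finite_induct)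
  case empty
  interpret product_sigma_finite "\<lambda>_ :: 'i. lborel :: real measure" by standard
  show ?case by (simp add: PiM_empty restrict_def nn_integral_count_space_finite)
next
  case (insert i J)
  interpret product_sigma_finite "\<lambda>_ :: 'i. lborel :: real measure" by standard
  note [measurable] = insert.prems(2)
  let ?M = "\<lambda>_ :: 'i. lborel :: real measure"
  have upd [measurable]: "(\<lambda>(x, y). x(i := y)) \<in> measurable (PiM J ?M \<Otimes>\<^sub>M lborel) (PiM (insert i J) ?M)"
    by (rule measurable_add_dim)
  define G where "G x = (\<integral>\<^sup>+ y. H (x(i := y)) \<partial>lborel)" for x
  have "(\<lambda>(x, y). H (x(i := y))) \<in> borel_measurable (PiM J ?M \<Otimes>\<^sub>M lborel)"
    using measurable_comp[OF upd insert.prems(2)] by (simp add: comp_def case_prod_beta')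
  then have G [measurable]: "G \<in> borel_measurable (PiM J ?M)"
    unfolding G_def by (rule lborel.borel_measurable_nn_integral)
  have Hsec: "(\<lambda>y. H (x(i := y))) \<in> borel_measurable borel" if "x \<in> space (PiM J ?M)" for x
  proof -
    have "(\<lambda>y. x(i := y)) \<in> measurable lborel (PiM (insert i J) ?M)"
      using measurable_compose[OF measurable_Pair1'[OF that] upd] by simp
    from measurable_compose[OF this insert.prems(2)] show ?thesis by (simp add: fun_upd_def)
  qed
  let ?T = "\<lambda>J z. \<lambda>j\<in>J. p j + q j * z j"
  have T: "?T J \<in> measurable (PiM J ?M) (PiM J ?M)" by measurable
  have T': "?T (insert i J) \<in> measurable (PiM (insert i J) ?M) (PiM (insert i J) ?M)" by measurable
  have "(\<integral>\<^sup>+ z. H z \<partial>PiM (insert i J) ?M) = (\<integral>\<^sup>+ x. G x \<partial>PiM J ?M)"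
    unfolding G_def using insert by (intro product_nn_integral_insert) auto
  also have "\<dots> = ennreal (\<Prod>j\<in>J. q j) * (\<integral>\<^sup>+ x. G (?T J x) \<partial>PiM J ?M)"
    using insert by (intro insert.IH) auto
  also have "(\<integral>\<^sup>+ x. G (?T J x) \<partial>PiM J ?M)
      = (\<integral>\<^sup>+ x. ennreal (q i) * (\<integral>\<^sup>+ y. H (?T (insert i J) (x(i := y))) \<partial>lborel) \<partial>PiM J ?M)"
  proof (rule nn_integral_cong)
    fix x assume x: "x \<in> space (PiM J ?M)"
    have "G (?T J x) = ennreal \<bar>q i\<bar> * (\<integral>\<^sup>+ y. H ((?T J x)(i := p i + q i * y)) \<partial>lborel)"
      unfolding G_def using insert.prems(1)[of i] measurable_space[OF T x]
      by (intro nn_integral_real_affine Hsec) auto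
    moreover have "(?T J x)(i := p i + q i * y) = ?T (insert i J) (x(i := y))" for y
      using insert.hyps(2) by (auto simp: restrict_def fun_eq_iff)
    ultimately show "G (?T J x) = ennreal (q i) * (\<integral>\<^sup>+ y. H (?T (insert i J) (x(i := y))) \<partial>lborel)"
      using insert.prems(1)[of i] by simp
  qed
  also have "\<dots> = ennreal (q i) * (\<integral>\<^sup>+ x. (\<integral>\<^sup>+ y. H (?T (insert i J) (x(i := y))) \<partial>lborel) \<partial>PiM J ?M)"
  proof (rule nn_integral_cmult)
    have "(\<lambda>(x, y). H (?T (insert i J) (x(i := y)))) \<in> borel_measurable (PiM J ?M \<Otimes>\<^sub>M lborel)"
      using measurable_comp[OF measurable_comp[OF upd T'] insert.prems(2)]
      by (simp add: comp_def case_prod_beta')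
    then show "(\<lambda>x. \<integral>\<^sup>+ y. H (?T (insert i J) (x(i := y))) \<partial>lborel) \<in> borel_measurable (PiM J ?M)"
      by (rule lborel.borel_measurable_nn_integral)
  qed
  also have "(\<integral>\<^sup>+ x. (\<integral>\<^sup>+ y. H (?T (insert i J) (x(i := y))) \<partial>lborel) \<partial>PiM J ?M)
      = (\<integral>\<^sup>+ z. H (?T (insert i J) z) \<partial>PiM (insert i J) ?M)"
    using insert measurable_comp[OF T' insert.prems(2)]
    by (intro product_nn_integral_insert[symmetric]) (auto simp: comp_def)
  finally have "(\<integral>\<^sup>+ z. H z \<partial>PiM (insert i J) ?M) = ennreal (\<Prod>j\<in>J. q j) *
      (ennreal (q i) * (\<integral>\<^sup>+ z. H (?T (insert i J) z) \<partial>PiM (insert i J) ?M))" .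
  moreover have "ennreal (\<Prod>j\<in>insert i J. q j) = ennreal (\<Prod>j\<in>J. q j) * ennreal (q i)"
    using insert.hyps insert.prems(1) by (simp add: ennreal_mult[symmetric] prod_nonneg less_imp_le mult.commute)
  ultimately show ?case by (simp only: mult.assoc)
qed

lemma prod_div_group:
  fixes f :: "nat \<Rightarrow> nat \<Rightarrow> 'a :: comm_monoid_mult"
  assumes "0 < L"
  shows "(\<Prod>j<K * L. f (j div L) (j mod L)) = (\<Prod>i<K. \<Prod>k<L. f i k)"
proof -
  have "(\<Prod>j<K * L. f (j div L) (j mod L)) = (\<Prod>i<K. prod (\<lambda>j. f (j div L) (j mod L)) {i * L..<i * L + L})"
    by (rule prod.nat_group[symmetric])
  also have "\<dots> = (\<Prod>i<K. \<Prod>k<L. f i k)"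
  proof (rule prod.cong[OF refl])
    fix i
    have "prod (\<lambda>j. f (j div L) (j mod L)) {i * L..<i * L + L}
        = prod (\<lambda>k. f ((k + i * L) div L) ((k + i * L) mod L)) {0..<L}"
      using prod.shift_bounds_nat_ivl[of "\<lambda>j. f (j div L) (j mod L)" 0 "i * L" L] by (simp add: add.commute)
    also have "\<dots> = (\<Prod>k<L. f i k)"
      unfolding atLeast0LessThan using assms by (intro prod.cong) auto
    finally show "prod (\<lambda>j. f (j div L) (j mod L)) {i * L..<i * L + L} = (\<Prod>k<L. f i k)" .
  qed
  finally show ?thesis .
qed

text \<open>The reciprocal, up to a constant, of the joint density of the grid values on the simplex.\<close>

definition fill_weight :: "real \<Rightarrow> nat \<Rightarrow> (nat \<Rightarrow> real) \<Rightarrow> real"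
  where "fill_weight \<beta> K x = (\<Prod>i<K. (x (Suc i) - x i) powr (1 - \<beta> / real K))"

text \<open>All increments inside cell \<open>i\<close> are multiplied by the same factor
  \<open>q i\<close>, and its exponents add up to zero: \<open>L - 1\<close> from the Jacobian (the
  inner points of the cell), 1 - \<beta>/K from the weight, and L (\<beta>/(K L) - 1) from the
  \<open>L\<close> increments in the density.\<close>

lemma dirichlet_density_scaling:
  fixes x x' :: "nat \<Rightarrow> real"
  assumes KL: "0 < K" "0 < L" and N: "Suc N = K * L"
    and x: "\<And>i. i < K \<Longrightarrow> x i < x (Suc i)" and x': "\<And>i. i < K \<Longrightarrow> x' i < x' (Suc i)"
    and q: "\<And>i. i < K \<Longrightarrow> q i = (x' (Suc i) - x' i) / (x (Suc i) - x i)"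
    and step: "\<And>j. j < K * L \<Longrightarrow> ext_pts N z' (Suc j) - ext_pts N z' j
        = q (j div L) * (ext_pts N z (Suc j) - ext_pts N z j)"
  shows "(\<Prod>j\<in>{j\<in>{1..N}. \<not> L dvd j}. q (j div L)) * (fill_weight \<beta> K x'
      * dirichlet_density \<beta> N (\<lambda>j. real j / real (K * L)) z')
    = fill_weight \<beta> K x * dirichlet_density \<beta> N (\<lambda>j. real j / real (K * L)) z"
proof -
  define e where "e = \<beta> / real (K * L) - 1"
  have qpos: "0 < q i" if "i < K" for i using q x x' that by auto
  have cell: "j div L < K" if "j < K * L" for j using that KL by (simp add: less_mult_imp_div_less)
  have le_N: "j \<le> N \<longleftrightarrow> j < K * L" for j using N by linarith
  have set_N: "{..N} = {..<K * L}" using le_N by auto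
  \<comment> \<open>Positive factors keep the sign of every increment, so both points lie in the
    open simplex or both densities take the default value 0.\<close>
  have incr: "(\<forall>j\<le>N. ext_pts N z' j < ext_pts N z' (Suc j)) \<longleftrightarrow> (\<forall>j\<le>N. ext_pts N z j < ext_pts N z (Suc j))"
  proof -
    have "ext_pts N z' j < ext_pts N z' (Suc j) \<longleftrightarrow> ext_pts N z j < ext_pts N z (Suc j)" if "j \<le> N" for j
      using step[of j] qpos[OF cell[of j]] that le_N[of j]
      by (metis diff_gt_0_iff_gt zero_less_mult_pos zero_less_mult_iff)
    then show ?thesis by auto
  qed
  have ex: "\<beta> * (real (Suc j) / real (K * L) - real j / real (K * L)) = \<beta> / real (K * L)" for j
    by (simp add: diff_divide_distrib[symmetric])
  have dens: "dirichlet_density \<beta> N (\<lambda>j. real j / real (K * L)) y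
      = (if \<forall>j\<le>N. ext_pts N y j < ext_pts N y (Suc j)
         then Gamma \<beta> / (\<Prod>j<K * L. Gamma (\<beta> / real (K * L)))
            * (\<Prod>j<K * L. (ext_pts N y (Suc j) - ext_pts N y j) powr e) else 0)" for y
    unfolding dirichlet_density_def Let_def ex set_N e_def ..
  show ?thesis
  proof (cases "\<forall>j\<le>N. ext_pts N z j < ext_pts N z (Suc j)")
    case False
    then have "dirichlet_density \<beta> N (\<lambda>j. real j / real (K * L)) z = 0"
      "dirichlet_density \<beta> N (\<lambda>j. real j / real (K * L)) z' = 0"
      using incr unfolding dens by auto
    then show ?thesis by (simp only: mult_zero_right)
  next
    case True
    have "(\<Prod>j<K * L. (ext_pts N z' (Suc j) - ext_pts N z' j) powr e)
        = (\<Prod>j<K * L. q (j div L) powr e * (ext_pts N z (Suc j) - ext_pts N z j) powr e)"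
    proof (rule prod.cong[OF refl])
      fix j assume "j \<in> {..<K * L}"
      then show "(ext_pts N z' (Suc j) - ext_pts N z' j) powr e
          = q (j div L) powr e * (ext_pts N z (Suc j) - ext_pts N z j) powr e"
        using step[of j] qpos[OF cell[of j]] True le_N[of j] by (simp add: powr_mult less_imp_le)
    qed
    also have "\<dots> = (\<Prod>i<K. (q i powr e) ^ L) * (\<Prod>j<K * L. (ext_pts N z (Suc j) - ext_pts N z j) powr e)"
      using prod_div_group[OF KL(2), of "\<lambda>i _. q i powr e" K] by (simp add: prod.distrib)
    finally have d: "(\<Prod>j<K * L. (ext_pts N z' (Suc j) - ext_pts N z' j) powr e)
      = (\<Prod>i<K. (q i powr e) ^ L) * (\<Prod>j<K * L. (ext_pts N z (Suc j) - ext_pts N z j) powr e)" .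
    have "fill_weight \<beta> K x' = (\<Prod>i<K. q i powr (1 - \<beta> / real K) * (x (Suc i) - x i) powr (1 - \<beta> / real K))"
      unfolding fill_weight_def
    proof (rule prod.cong[OF refl])
      fix i assume "i \<in> {..<K}"
      then have "x' (Suc i) - x' i = q i * (x (Suc i) - x i)" "0 < q i" "0 < x (Suc i) - x i"
        using q[of i] x[of i] qpos[of i] by auto
      then show "(x' (Suc i) - x' i) powr (1 - \<beta> / real K)
          = q i powr (1 - \<beta> / real K) * (x (Suc i) - x i) powr (1 - \<beta> / real K)"
        by (simp add: powr_mult)
    qed
    then have w: "fill_weight \<beta> K x' = (\<Prod>i<K. q i powr (1 - \<beta> / real K)) * fill_weight \<beta> K x"
      by (simp add: prod.distrib fill_weight_def)
    \<comment> \<open>The range is enlarged to all indices below \<open>K * L\<close> so that it can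
      be regrouped by cells; the added indices, 0 among them, are multiples of \<open>L\<close> and
      contribute the factor 1.\<close>
    have "(\<Prod>j\<in>{j\<in>{1..N}. \<not> L dvd j}. q (j div L)) = (\<Prod>j<K * L. if j mod L = 0 then 1 else q (j div L))"
    proof (rule prod.mono_neutral_cong_left)
      show "{j \<in> {1..N}. \<not> L dvd j} \<subseteq> {..<K * L}"
        unfolding set_N[symmetric] by auto
      show "\<forall>i\<in>{..<K * L} - {j \<in> {1..N}. \<not> L dvd j}. (if i mod L = 0 then 1 else q (i div L)) = 1"
      proof
        fix i assume i: "i \<in> {..<K * L} - {j \<in> {1..N}. \<not> L dvd j}"
        then have "i \<le> N" unfolding set_N[symmetric] by simp
        then have "i = 0 \<or> L dvd i" using i by (cases i) auto
        then show "(if i mod L = 0 then 1 else q (i div L)) = 1" by (auto simp: mod_eq_0_iff_dvd)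
      qed
      fix i assume "i \<in> {j \<in> {1..N}. \<not> L dvd j}"
      then show "q (i div L) = (if i mod L = 0 then 1 else q (i div L))" by (simp add: mod_eq_0_iff_dvd)
    qed simp
    also have "\<dots> = (\<Prod>i<K. \<Prod>k<L. if k = 0 then 1 else q i)"
      by (rule prod_div_group[OF KL(2)])
    also have "\<dots> = (\<Prod>i<K. q i ^ (L - 1))"
    proof (rule prod.cong[OF refl])
      fix i
      obtain L' where L': "L = Suc L'" using KL(2) by (cases L) auto
      show "(\<Prod>k<L. if k = 0 then 1 else q i) = q i ^ (L - 1)"
        unfolding L' prod.lessThan_Suc_shift by simp
    qed
    finally have J: "(\<Prod>j\<in>{j\<in>{1..N}. \<not> L dvd j}. q (j div L)) = (\<Prod>i<K. q i ^ (L - 1))" .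
    have "(\<Prod>i<K. q i ^ (L - 1)) * (\<Prod>i<K. q i powr (1 - \<beta> / real K)) * (\<Prod>i<K. (q i powr e) ^ L)
        = (\<Prod>i<K. q i ^ (L - 1) * q i powr (1 - \<beta> / real K) * (q i powr e) ^ L)"
      by (simp add: prod.distrib)
    also have "\<dots> = (\<Prod>i<K. 1)"
    proof (rule prod.cong[OF refl])
      fix i assume "i \<in> {..<K}"
      then have qi: "0 < q i" using qpos by simp
      have "real (L - 1) + (1 - \<beta> / real K) + e * real L = 0"
        using KL by (simp add: e_def field_simps of_nat_diff)
      moreover have "q i ^ (L - 1) * q i powr (1 - \<beta> / real K) * (q i powr e) ^ L
          = q i powr (real (L - 1) + (1 - \<beta> / real K) + e * real L)"
        using qi by (simp add: powr_add powr_realpow[symmetric] powr_powr)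
      ultimately show "q i ^ (L - 1) * q i powr (1 - \<beta> / real K) * (q i powr e) ^ L = 1"
        using qi by simp
    qed
    finally have one: "(\<Prod>i<K. q i ^ (L - 1)) * (\<Prod>i<K. q i powr (1 - \<beta> / real K)) * (\<Prod>i<K. (q i powr e) ^ L) = 1"
      by simp
    define A B C D E where abbr: "A = (\<Prod>i<K. q i ^ (L - 1))" "B = (\<Prod>i<K. q i powr (1 - \<beta> / real K))"
      "C = (\<Prod>i<K. (q i powr e) ^ L)" "D = (\<Prod>j<K * L. (ext_pts N z (Suc j) - ext_pts N z j) powr e)"
      "E = Gamma \<beta> / (\<Prod>j<K * L. Gamma (\<beta> / real (K * L)))"
    have "A * (B * fill_weight \<beta> K x * (E * (C * D))) = (A * B * C) * (fill_weight \<beta> K x * (E * D))"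
      by (simp only: mult_ac)
    also have "\<dots> = fill_weight \<beta> K x * (E * D)" using one by (simp add: abbr)
    finally show ?thesis
      using True incr unfolding dens J w d abbr by simp
  qed
qed

lemma measurable_ext_pts [measurable]:
  assumes "j \<le> Suc N"
  shows "(\<lambda>z. ext_pts N z j) \<in> borel_measurable (PiM {1..N} (\<lambda>_. lborel))"
proof (cases "j = 0 \<or> j = Suc N")
  case True
  then show ?thesis by (auto simp: ext_pts_def)
next
  case False
  then have "j \<in> {1..N}" using assms by auto
  then have "(\<lambda>z. z j) \<in> measurable (PiM {1..N} (\<lambda>_. lborel)) lborel"
    by (rule measurable_component_singleton)
  then show ?thesis using False by (simp add: ext_pts_def)
qed

lemma measurable_dirichlet_density [measurable]:
  "dirichlet_density \<beta> N t \<in> borel_measurable (PiM {1..N} (\<lambda>_. lborel))"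
proof -
  let ?M = "PiM {1..N} (\<lambda>_. lborel :: real measure)"
  have [measurable]: "Measurable.pred ?M (\<lambda>z. \<forall>i\<in>{..N}. ext_pts N z i < ext_pts N z (Suc i))"
  proof (rule pred_intros_finite)
    fix i assume "i \<in> {..N}"
    then have [measurable]: "(\<lambda>z. ext_pts N z i) \<in> borel_measurable ?M"
      "(\<lambda>z. ext_pts N z (Suc i)) \<in> borel_measurable ?M"
      by (auto intro!: measurable_ext_pts simp del: One_nat_def)
    show "Measurable.pred ?M (\<lambda>z. ext_pts N z i < ext_pts N z (Suc i))" by measurable
  qed simp
  have [measurable]: "(\<lambda>z. \<Prod>i\<le>N. (ext_pts N z (Suc i) - ext_pts N z i) powr (\<beta> * (t (Suc i) - t i) - 1))
      \<in> borel_measurable ?M"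
  proof (rule borel_measurable_prod)
    fix i assume "i \<in> {..N}"
    then have [measurable]: "(\<lambda>z. ext_pts N z i) \<in> borel_measurable ?M"
      "(\<lambda>z. ext_pts N z (Suc i)) \<in> borel_measurable ?M"
      by (auto intro!: measurable_ext_pts simp del: One_nat_def)
    show "(\<lambda>z. (ext_pts N z (Suc i) - ext_pts N z i) powr (\<beta> * (t (Suc i) - t i) - 1)) \<in> borel_measurable ?M"
      by measurable
  qed
  have "dirichlet_density \<beta> N t = (\<lambda>z. if \<forall>i\<in>{..N}. ext_pts N z i < ext_pts N z (Suc i)
      then Gamma \<beta> / (\<Prod>i\<le>N. Gamma (\<beta> * (t (Suc i) - t i)))
        * (\<Prod>i\<le>N. (ext_pts N z (Suc i) - ext_pts N z i) powr (\<beta> * (t (Suc i) - t i) - 1)) else 0)"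
    by (auto simp: fun_eq_iff dirichlet_density_def Let_def)
  also have "\<dots> \<in> borel_measurable ?M" by measurable
  finally show ?thesis .
qed

text \<open>The affine function of the value \<open>y\<close> that equals \<open>v i\<close> at
  \<open>x i\<close> and \<open>v (Suc i)\<close> at \<open>x (Suc i)\<close>. The displacement is
  interpolated in the values of a map, not in its argument; this is what keeps relative positions
  inside a cell fixed.\<close>

definition interp :: "(nat \<Rightarrow> real) \<Rightarrow> (nat \<Rightarrow> real) \<Rightarrow> nat \<Rightarrow> real \<Rightarrow> real"
  where "interp v x i y = v i + (v (Suc i) - v i) * ((y - x i) / (x (Suc i) - x i))"

lemma measurable_fill_weight [measurable (raw)]:
  assumes "\<And>i. i \<le> K \<Longrightarrow> (\<lambda>w. x w i) \<in> borel_measurable M"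
  shows "(\<lambda>w. fill_weight \<beta> K (x w)) \<in> borel_measurable M"
  unfolding fill_weight_def
proof (rule borel_measurable_prod)
  fix i assume "i \<in> {..<K}"
  then have [measurable]: "(\<lambda>w. x w i) \<in> borel_measurable M" "(\<lambda>w. x w (Suc i)) \<in> borel_measurable M"
    using assms by auto
  show "(\<lambda>w. (x w (Suc i) - x w i) powr (1 - \<beta> / real K)) \<in> borel_measurable M" by measurable
qed

lemma measurable_interp [measurable (raw)]:
  assumes [measurable]: "(\<lambda>w. x w i) \<in> borel_measurable M" "(\<lambda>w. x w (Suc i)) \<in> borel_measurable M"
    "y \<in> borel_measurable M"
  shows "(\<lambda>w. interp v (x w) i (y w)) \<in> borel_measurable M"
  unfolding interp_def by measurable

text \<open>\<open>a\<close> and \<delta> are the centre and half-width of a box of interior grid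
  values, \<open>v\<close> is their common displacement, and \<open>c\<close> bounds all increments
  from below. The bound is asked for at the two ends of the motion; convexity supplies it in
  between. \<open>v\<close> vanishes at 0 and \<open>K\<close> because the end values 0 and 1 do not
  move.\<close>

locale grid_shift =
  fixes K :: nat and v a :: "nat \<Rightarrow> real" and \<delta> c :: real
  assumes K: "0 < K" and v: "v 0 = 0" "v K = 0" and c: "0 < c"
    and gap: "\<And>x i. x 0 = 0 \<Longrightarrow> x K = 1 \<Longrightarrow> \<forall>i\<in>{1..<K}. \<bar>x i - a i\<bar> < \<delta> \<Longrightarrow> i < K \<Longrightarrow>
      c \<le> x (Suc i) - x i \<and> c \<le> (x (Suc i) + v (Suc i)) - (x i + v i)"
begin

definition inbox :: "(nat \<Rightarrow> real) \<Rightarrow> bool"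
  where "inbox x \<longleftrightarrow> (\<forall>i\<in>{1..<K}. \<bar>x i - a i\<bar> < \<delta>)"

lemma gap_shift:
  assumes "x 0 = 0" "x K = 1" "inbox x" "i < K" "0 \<le> s" "s \<le> 1"
  shows "c \<le> (x (Suc i) + s * v (Suc i)) - (x i + s * v i)"
proof -
  have g: "c \<le> x (Suc i) - x i" "c \<le> (x (Suc i) + v (Suc i)) - (x i + v i)"
    using gap[of x i] assms by (auto simp: inbox_def)
  have "c = (1 - s) * c + s * c" by (simp add: algebra_simps)
  also have "\<dots> \<le> (1 - s) * (x (Suc i) - x i) + s * ((x (Suc i) + v (Suc i)) - (x i + v i))"
    using assms g by (intro add_mono mult_left_mono) auto
  also have "\<dots> = (x (Suc i) + s * v (Suc i)) - (x i + s * v i)" by (simp add: algebra_simps)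
  finally show ?thesis .
qed

lemma measurable_inbox [measurable (raw)]:
  assumes "\<And>i. i \<le> K \<Longrightarrow> (\<lambda>w. x w i) \<in> borel_measurable M"
  shows "Measurable.pred M (\<lambda>w. inbox (x w))"
  unfolding inbox_def
proof (rule pred_intros_finite)
  fix i assume "i \<in> {1..<K}"
  then have [measurable]: "(\<lambda>w. x w i) \<in> borel_measurable M" using assms by auto
  show "Measurable.pred M (\<lambda>w. \<bar>x w i - a i\<bar> < \<delta>)" by measurable
qed simp

text \<open>The coordinates split into coarse ones (index a multiple of \<open>L\<close>) and the
  rest. The coarse ones are translated by \<open>s * v\<close> with Jacobian 1; once they are
  frozen, the others move affinely in each cell and the scaling identity absorbs the Jacobian. On
  the right the weight is taken at the end point, while the box still constrains the starting point,
  hence the subtraction of \<open>s * v\<close>.\<close>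

lemma grid_substitution:
  fixes F :: "(nat \<Rightarrow> real) \<Rightarrow> ennreal" and \<beta> :: real
  assumes s: "0 \<le> s" "s \<le> 1" and L: "0 < L" and N: "Suc N = K * L"
    and F [measurable]: "F \<in> borel_measurable (PiM {1..N} (\<lambda>_. lborel))"
  defines "cz \<equiv> \<lambda>z i. ext_pts N z (i * L)"
  defines "\<rho> \<equiv> dirichlet_density \<beta> N (\<lambda>j. real j / real (K * L))"
  defines "T \<equiv> \<lambda>z. \<lambda>j\<in>{1..N}. z j + s * interp v (cz z) (j div L) (z j)"
  shows "(\<integral>\<^sup>+ z. (if inbox (cz z) then ennreal (fill_weight \<beta> K (cz z) * \<rho> z) * F (T z) else 0)
        \<partial>PiM {1..N} (\<lambda>_. lborel))
    = (\<integral>\<^sup>+ z. (if inbox (\<lambda>i. cz z i - s * v i) then ennreal (fill_weight \<beta> K (cz z) * \<rho> z) * F z else 0)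
        \<partial>PiM {1..N} (\<lambda>_. lborel))"
proof -
  interpret product_sigma_finite "\<lambda>_ :: nat. lborel :: real measure" by standard
  let ?M = "\<lambda>_ :: nat. lborel :: real measure"
  define I where "I = {j\<in>{1..N}. L dvd j}"
  define J where "J = {j\<in>{1..N}. \<not> L dvd j}"
  have IJ: "I \<union> J = {1..N}" "I \<inter> J = {}" "finite I" "finite J" by (auto simp: I_def J_def)
  define H where "H z = (if inbox (\<lambda>i. cz z i - s * v i) then ennreal (fill_weight \<beta> K (cz z) * \<rho> z) * F z else 0)" for z
  define H' where "H' z = (if inbox (cz z) then ennreal (fill_weight \<beta> K (cz z) * \<rho> z) * F (T z) else 0)" for z
  have cell: "j div L < K" if "j \<le> N" for j
    using that N L by (intro less_mult_imp_div_less) auto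
  have cz_meas: "(\<lambda>z. cz z i) \<in> borel_measurable (PiM {1..N} ?M)" if "i \<le> K" for i
    unfolding cz_def using that N by (intro measurable_ext_pts) simp
  have \<rho> [measurable]: "\<rho> \<in> borel_measurable (PiM {1..N} ?M)" unfolding \<rho>_def by measurable
  have w [measurable]: "(\<lambda>z. fill_weight \<beta> K (cz z)) \<in> borel_measurable (PiM {1..N} ?M)"
    by (intro measurable_fill_weight cz_meas)
  have [measurable]: "Measurable.pred (PiM {1..N} ?M) (\<lambda>z. inbox (cz z))"
    by (intro measurable_inbox cz_meas)
  have [measurable]: "Measurable.pred (PiM {1..N} ?M) (\<lambda>z. inbox (\<lambda>i. cz z i - s * v i))"
    by (intro measurable_inbox borel_measurable_diff cz_meas) auto
  have T [measurable]: "T \<in> measurable (PiM {1..N} ?M) (PiM {1..N} ?M)"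
    unfolding T_def
  proof (rule measurable_restrict)
    fix j assume j: "j \<in> {1..N}"
    have [measurable]: "(\<lambda>z. z j) \<in> borel_measurable (PiM {1..N} ?M)"
      using measurable_component_singleton[OF j, of ?M] by simp
    have [measurable]: "(\<lambda>z. interp v (cz z) (j div L) (z j)) \<in> borel_measurable (PiM {1..N} ?M)"
      using cell[of j] j by (intro measurable_interp cz_meas) (auto simp del: One_nat_def)
    show "(\<lambda>z. z j + s * interp v (cz z) (j div L) (z j)) \<in> measurable (PiM {1..N} ?M) lborel"
      by measurable
  qed
  have H [measurable]: "H \<in> borel_measurable (PiM {1..N} ?M)" unfolding H_def by measurable
  have H' [measurable]: "H' \<in> borel_measurable (PiM {1..N} ?M)" unfolding H'_def by measurable
  have mrg [measurable]: "merge I J \<in> measurable (PiM I ?M \<Otimes>\<^sub>M PiM J ?M) (PiM {1..N} ?M)"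
    using measurable_merge[of I J ?M] by (simp add: IJ)
  interpret PJ: sigma_finite_measure "PiM J ?M" by (rule sigma_finite[OF IJ(4)])
  have Hm: "(\<lambda>p. H (merge I J p)) \<in> borel_measurable (PiM I ?M \<Otimes>\<^sub>M PiM J ?M)" by measurable
  have coarse_idx: "i * L \<in> I" if "i \<in> {1..<K}" for i
    using that N L by (auto simp: I_def Suc_le_eq) (metis Suc_leI lessI less_Suc_eq_le mult_less_cancel2)
  \<comment> \<open>The factor 1 puts the translation into the form required by
    \<open>nn_integral_PiM_affine\<close>.\<close>
  define sh where "sh x = (\<lambda>j\<in>I. s * v (j div L) + 1 * x j)" for x :: "nat \<Rightarrow> real"
  have inner: "(\<integral>\<^sup>+ y. H (merge I J (sh x, y)) \<partial>PiM J ?M) = (\<integral>\<^sup>+ y. H' (merge I J (x, y)) \<partial>PiM J ?M)"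
    if x: "x \<in> space (PiM I ?M)" for x
  proof -
    define X where "X i = (if i = 0 then 0 else if i = K then 1 else x (i * L))" for i
    define X' where "X' i = X i + s * v i" for i
    have czX: "cz (merge I J (x, y)) i = X i" if "i \<le> K" for i y
      using that coarse_idx[of i] N L K unfolding cz_def X_def ext_pts_def merge_def
      by (auto simp: Suc_le_eq)
    have czX': "cz (merge I J (sh x, y)) i = X' i" if "i \<le> K" for i y
      using that coarse_idx[of i] N L K v unfolding cz_def X'_def X_def ext_pts_def merge_def sh_def
      by (auto simp: Suc_le_eq)
    have inb: "inbox (cz (merge I J (x, y))) \<longleftrightarrow> inbox X" for y
      unfolding inbox_def by (intro ball_cong refl) (auto simp: czX)
    have inb': "inbox (\<lambda>i. cz (merge I J (sh x, y)) i - s * v i) \<longleftrightarrow> inbox X" for y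
      unfolding inbox_def by (intro ball_cong refl) (auto simp: czX' X'_def)
    show ?thesis
    proof (cases "inbox X")
      case False
      then show ?thesis unfolding H_def H'_def inb inb' by simp
    next
      case True
      have X0: "X 0 = 0" "X K = 1" using K by (auto simp: X_def)
      have gX: "X i < X (Suc i)" if "i < K" for i
        using gap_shift[OF X0 True that, of 0] c by auto
      have gX': "X' i < X' (Suc i)" if "i < K" for i
        using gap_shift[OF X0 True that s] c by (auto simp: X'_def)
      \<comment> \<open>With the coarse values frozen at \<open>X\<close>, the motion on cell
        \<open>i\<close> is the increasing affine map with slope \<open>q i\<close> and intercept
        \<open>p i\<close> that carries the old cell of values onto the new one.\<close>
      define q where "q i = (X' (Suc i) - X' i) / (X (Suc i) - X i)" for i
      define p where "p i = X' i - q i * X i" for i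
      have qpos: "0 < q i" if "i < K" for i using gX gX' that by (simp add: q_def)
      have aff: "y + s * interp v X i y = p i + q i * y" if "i < K" for i y
      proof -
        define k where "k = (v (Suc i) - v i) / (X (Suc i) - X i)"
        have 1: "interp v X i y = v i + k * (y - X i)" by (simp add: interp_def k_def)
        have 2: "q i = 1 + s * k" using gX[OF that] by (simp add: q_def k_def X'_def field_simps)
        show ?thesis unfolding p_def X'_def 1 2 by (simp add: algebra_simps)
      qed
      have ends: "p i + q i * X i = X' i" "p i + q i * X (Suc i) = X' (Suc i)" if "i < K" for i
      proof -
        have "q i * (X (Suc i) - X i) = X' (Suc i) - X' i" using gX[OF that] by (simp add: q_def)
        then show "p i + q i * X i = X' i" "p i + q i * X (Suc i) = X' (Suc i)"
          by (auto simp: p_def algebra_simps)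
      qed
      let ?S = "\<lambda>y. \<lambda>j\<in>J. p (j div L) + q (j div L) * y j"
      have sec: "(\<lambda>y. H (merge I J (sh x, y))) \<in> borel_measurable (PiM J ?M)"
      proof -
        have "sh x \<in> space (PiM I ?M)" by (auto simp: space_PiM sh_def)
        from measurable_compose[OF measurable_Pair1'[OF this] Hm] show ?thesis .
      qed
      have "(\<integral>\<^sup>+ y. H (merge I J (sh x, y)) \<partial>PiM J ?M)
          = ennreal (\<Prod>j\<in>J. q (j div L)) * (\<integral>\<^sup>+ y. H (merge I J (sh x, ?S y)) \<partial>PiM J ?M)"
        using IJ(4) sec by (intro nn_integral_PiM_affine) (auto simp: J_def intro!: qpos cell)
      also have "\<dots> = (\<integral>\<^sup>+ y. ennreal (\<Prod>j\<in>J. q (j div L)) * H (merge I J (sh x, ?S y)) \<partial>PiM J ?M)"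
      proof (rule nn_integral_cmult[symmetric])
        have "?S \<in> measurable (PiM J ?M) (PiM J ?M)" by measurable
        from measurable_compose[OF this sec]
        show "(\<lambda>y. H (merge I J (sh x, ?S y))) \<in> borel_measurable (PiM J ?M)" .
      qed
      also have "\<dots> = (\<integral>\<^sup>+ y. H' (merge I J (x, y)) \<partial>PiM J ?M)"
      proof (rule nn_integral_cong)
        fix y assume y: "y \<in> space (PiM J ?M)"
        let ?z = "merge I J (x, y)" and ?z' = "merge I J (sh x, ?S y)"
        have z': "?z' j = p (j div L) + q (j div L) * ?z j" if "j \<in> {1..N}" for j
        proof (cases "L dvd j")
          case False
          then show ?thesis using that by (auto simp: merge_def I_def J_def)
        next
          case True
          then obtain i where i: "j = i * L" by (metis dvdE mult.commute)
          have "i < K" using cell[of j] that L by (simp add: i)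
          moreover have "0 < i" using that by (cases i) (auto simp: i)
          ultimately have "X i = x j" "X' i = x j + s * v i"
            by (auto simp: X'_def X_def i)
          then show ?thesis
            using True that ends(1)[OF \<open>i < K\<close>] L by (simp add: merge_def sh_def I_def i)
        qed
        have Tz: "T ?z = ?z'"
        proof
          fix j
          show "T ?z j = ?z' j"
          proof (cases "j \<in> {1..N}")
            case True
            then have k: "j div L < K" using cell by auto
            have "interp v (cz ?z) (j div L) (?z j) = interp v X (j div L) (?z j)"
              using k by (simp add: interp_def czX)
            then show ?thesis using z'[OF True] True aff[OF k, of "?z j"] by (simp add: T_def)
          next
            case False
            then show ?thesis by (auto simp: T_def merge_def I_def J_def)
          qed
        qed
        \<comment> \<open>Stated for the closed cell: neighbouring affine maps agree at their common
          coarse point, also at the added values 0 and 1. Hence both ends of a fine increment obey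
          the same map, and only the slope survives in the difference.\<close>
        have ext': "ext_pts N ?z' j = p i + q i * ext_pts N ?z j"
          if j: "j \<le> Suc N" "i < K" "i * L \<le> j" "j \<le> Suc i * L" for i j
        proof -
          consider "j = i * L" | "j = Suc i * L" | "i * L < j" "j < Suc i * L"
            using j(3,4) by linarith
          then show ?thesis
          proof cases
            case 1
            then show ?thesis using czX[of i y] czX'[of i "?S y"] ends(1)[of i] that by (simp add: cz_def)
          next
            case 2
            then show ?thesis using czX[of "Suc i" y] czX'[of "Suc i" "?S y"] ends(2)[of i] that by (simp add: cz_def)
          next
            case 3
            have "j div L = i" using 3 L by (intro div_nat_eqI) (auto simp: mult.commute)
            moreover have "j < K * L" using 3 that by (metis Suc_leI dual_order.strict_trans1 mult_le_mono1)
            then have "j \<in> {1..N}" using 3 N by auto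
            ultimately show ?thesis using z'[of j] by (simp add: ext_pts_def)
          qed
        qed
        have "(\<Prod>j\<in>{j\<in>{1..N}. \<not> L dvd j}. q (j div L)) * (fill_weight \<beta> K X' * \<rho> ?z')
            = fill_weight \<beta> K X * \<rho> ?z"
          unfolding \<rho>_def
        proof (rule dirichlet_density_scaling[where x = X and x' = X', OF K L N gX gX'])
          fix j assume j: "j < K * L"
          have k: "j div L < K" using cell j N by auto
          have lo: "j div L * L \<le> j" by simp
          have hi: "j < Suc (j div L) * L" using L by (metis dividend_less_div_times mult_Suc add.commute)
          have e: "ext_pts N ?z' j = p (j div L) + q (j div L) * ext_pts N ?z j"
            by (rule ext'[OF _ k]) (use lo hi j N in linarith)+
          have e': "ext_pts N ?z' (Suc j) = p (j div L) + q (j div L) * ext_pts N ?z (Suc j)"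
            by (rule ext'[OF _ k]) (use lo hi j N in linarith)+
          show "ext_pts N ?z' (Suc j) - ext_pts N ?z' j = q (j div L) * (ext_pts N ?z (Suc j) - ext_pts N ?z j)"
            unfolding e e' by (simp add: right_diff_distrib)
        qed (auto simp: q_def)
        then have "(\<Prod>j\<in>J. q (j div L)) * (fill_weight \<beta> K X' * \<rho> ?z') = fill_weight \<beta> K X * \<rho> ?z"
          by (simp only: J_def)
        moreover have "fill_weight \<beta> K (cz ?z) = fill_weight \<beta> K X" "fill_weight \<beta> K (cz ?z') = fill_weight \<beta> K X'"
          unfolding fill_weight_def by (auto intro!: prod.cong simp: czX czX')
        moreover have "0 \<le> (\<Prod>j\<in>J. q (j div L))"
          by (intro prod_nonneg) (auto simp: J_def intro!: less_imp_le[OF qpos] cell)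
        ultimately show "ennreal (\<Prod>j\<in>J. q (j div L)) * H ?z' = H' ?z"
          unfolding H_def H'_def inb inb' Tz using True
          by (simp add: mult.assoc[symmetric] ennreal_mult'[symmetric])
      qed
      finally show ?thesis .
    qed
  qed
  have "(\<integral>\<^sup>+ z. H z \<partial>PiM {1..N} ?M) = (\<integral>\<^sup>+ x. (\<integral>\<^sup>+ y. H (merge I J (x, y)) \<partial>PiM J ?M) \<partial>PiM I ?M)"
    using product_nn_integral_fold[OF IJ(2-4), of H] H by (simp only: IJ)
  also have "\<dots> = ennreal (\<Prod>j\<in>I. 1) * (\<integral>\<^sup>+ x. (\<integral>\<^sup>+ y. H (merge I J (sh x, y)) \<partial>PiM J ?M) \<partial>PiM I ?M)"
    unfolding sh_def
  proof (rule nn_integral_PiM_affine[OF IJ(3)])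
    show "(\<lambda>x. \<integral>\<^sup>+ y. H (merge I J (x, y)) \<partial>PiM J ?M) \<in> borel_measurable (PiM I ?M)"
      using Hm by (intro PJ.borel_measurable_nn_integral) (simp add: case_prod_beta')
  qed simp
  also have "\<dots> = (\<integral>\<^sup>+ x. (\<integral>\<^sup>+ y. H (merge I J (sh x, y)) \<partial>PiM J ?M) \<partial>PiM I ?M)" by simp
  also have "\<dots> = (\<integral>\<^sup>+ x. (\<integral>\<^sup>+ y. H' (merge I J (x, y)) \<partial>PiM J ?M) \<partial>PiM I ?M)"
    by (intro nn_integral_cong inner)
  also have "\<dots> = (\<integral>\<^sup>+ z. H' z \<partial>PiM {1..N} ?M)"
    using product_nn_integral_fold[OF IJ(2-4), of H'] H' by (simp only: IJ)
  finally show ?thesis by (simp add: H_def H'_def)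
qed

end

section \<open>Moving the grid values\<close>

text \<open>Index 0 carries the value 0 even when \<open>g 0\<close> is positive, as in
  \<open>ext_pts\<close>; a jump of \<open>g\<close> at 0 thus counts as part of the first
  increment.\<close>

definition grid_vals :: "nat \<Rightarrow> (real \<Rightarrow> real) \<Rightarrow> nat \<Rightarrow> real"
  where "grid_vals K g i = (if i = 0 then 0 else g (real i / real K))"

lemma grid_vals_ends:
  assumes "g \<in> G0" "0 < K"
  shows "grid_vals K g 0 = 0" "grid_vals K g K = 1"
  using assms by (auto simp: grid_vals_def G0_def)

lemma grid_cell:
  assumes "0 < K" "0 \<le> r" "r < 1"
  shows "nat \<lfloor>real K * r\<rfloor> < K" "real (nat \<lfloor>real K * r\<rfloor>) / real K \<le> r" "r < real (Suc (nat \<lfloor>real K * r\<rfloor>)) / real K"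
proof -
  have "real K * r < real K" using assms by simp
  then have "\<lfloor>real K * r\<rfloor> < int K" by linarith
  then show "nat \<lfloor>real K * r\<rfloor> < K" using assms by linarith
  have n: "real (nat \<lfloor>real K * r\<rfloor>) = of_int \<lfloor>real K * r\<rfloor>" using assms by simp
  have "of_int \<lfloor>real K * r\<rfloor> \<le> real K * r" "real K * r < of_int \<lfloor>real K * r\<rfloor> + 1" by linarith+
  then show "real (nat \<lfloor>real K * r\<rfloor>) / real K \<le> r" "r < real (Suc (nat \<lfloor>real K * r\<rfloor>)) / real K"
    using assms(1) n by (auto simp: field_simps)
qed

lemma grid_cell_eq:
  assumes "0 < K" "real i / real K \<le> r" "r < real (Suc i) / real K"
  shows "nat \<lfloor>real K * r\<rfloor> = i"
proof -
  have "\<lfloor>real K * r\<rfloor> = int i"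
    using assms by (intro floor_unique) (auto simp: field_simps)
  then show ?thesis by simp
qed

lemma grid_vals_cell:
  assumes "g \<in> G0" "0 < K" "real i / real K \<le> r" "r < real (Suc i) / real K"
  shows "grid_vals K g i \<le> g r" "g r \<le> grid_vals K g (Suc i)"
  using monoD[OF G0_mono[OF assms(1)], of "real i / real K" r]
    monoD[OF G0_mono[OF assms(1)], of r "real (Suc i) / real K"] G0_range[OF assms(1), of r] assms
  by (auto simp: grid_vals_def)

context grid_shift
begin

definition field :: "(real \<Rightarrow> real) \<Rightarrow> real \<Rightarrow> real"
  where "field g r = (if 0 \<le> r \<and> r < 1
    then interp v (grid_vals K g) (nat \<lfloor>real K * r\<rfloor>) (g r) else 0)"

text \<open>Maps outside the box and times outside the unit interval are left alone; this default
  keeps \<open>shift s\<close> a total, measurable map of \<open>G0\<close> into itself.\<close>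

definition shift :: "real \<Rightarrow> (real \<Rightarrow> real) \<Rightarrow> real \<Rightarrow> real"
  where "shift s g = (if inbox (grid_vals K g) \<and> 0 \<le> s \<and> s \<le> 1 then (\<lambda>r. g r + s * field g r) else g)"

text \<open>Inside a cell the moved map is an increasing affine function of \<open>g\<close> and
  inherits monotonicity and right continuity. Across cells, monotonicity holds because its values
  lie between consecutive moved grid values, and these remain ordered.\<close>

lemma shift_in_G0:
  assumes g: "g \<in> G0"
  shows "shift s g \<in> G0"
proof (cases "inbox (grid_vals K g) \<and> 0 \<le> s \<and> s \<le> 1")
  case False
  then show ?thesis using g by (auto simp: shift_def)
next
  case True
  then have B: "inbox (grid_vals K g)" and s: "0 \<le> s" "s \<le> 1" by auto
  have sh: "shift s g = (\<lambda>r. g r + s * field g r)" using True by (simp add: shift_def)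
  define X where "X = grid_vals K g"
  define X' where "X' i = X i + s * v i" for i
  have X0: "X 0 = 0" "X K = 1" using grid_vals_ends[OF g K] by (auto simp: X_def)
  have inb: "inbox X" using B by (simp add: X_def)
  have gX: "X i < X (Suc i)" if "i < K" for i
    using gap_shift[OF X0 inb that, of 0] c by auto
  have gX': "X' i < X' (Suc i)" if "i < K" for i
    using gap_shift[OF X0 inb that s] c by (auto simp: X'_def)
  define q where "q i = (X' (Suc i) - X' i) / (X (Suc i) - X i)" for i
  have qpos: "0 < q i" if "i < K" for i using gX gX' that by (simp add: q_def)
  have q1: "q i * (X (Suc i) - X i) = X' (Suc i) - X' i" if "i < K" for i
    using gX[OF that] by (simp add: q_def)
  have val: "shift s g r = X' i + q i * (g r - X i)"
    if "i < K" "real i / real K \<le> r" "r < real (Suc i) / real K" for i r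
  proof -
    have "0 \<le> r" using that(2) by (smt (verit) divide_nonneg_nonneg of_nat_0_le_iff)
    moreover have "real (Suc i) / real K \<le> 1" using that(1) by (simp add: field_simps)
    then have "r < 1" using that(3) by linarith
    moreover define k where "k = (v (Suc i) - v i) / (X (Suc i) - X i)"
    have 1: "interp v X i (g r) = v i + k * (g r - X i)" by (simp add: interp_def k_def)
    have 2: "q i = 1 + s * k" using gX[OF that(1)] by (simp add: q_def k_def X'_def field_simps)
    ultimately show ?thesis
      unfolding sh field_def grid_cell_eq[OF K that(2,3)] X_def[symmetric] 1 2 X'_def
      by (simp add: algebra_simps)
  qed
  have bounds: "X' i \<le> shift s g r" "shift s g r \<le> X' (Suc i)"
    if "i < K" "real i / real K \<le> r" "r < real (Suc i) / real K" for i r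
  proof -
    have m: "X i \<le> g r" "g r \<le> X (Suc i)" unfolding X_def using grid_vals_cell[OF g K that(2,3)] by auto
    show "X' i \<le> shift s g r" unfolding val[OF that] using m(1) qpos[OF that(1)] by simp
    have "q i * (g r - X i) \<le> q i * (X (Suc i) - X i)"
      using m(2) qpos[OF that(1)] by (intro mult_left_mono) auto
    then show "shift s g r \<le> X' (Suc i)" unfolding val[OF that] using q1[OF that(1)] by simp
  qed
  have X'mono: "X' i \<le> X' j" if "i \<le> j" "j \<le> K" for i j
    using that
  proof (induction rule: dec_induct)
    case (step n)
    then show ?case using gX'[of n] by simp
  qed simp
  have X'ends: "X' 0 = 0" "X' K = 1" using X0 v by (auto simp: X'_def)
  show ?thesis
  proof (rule G0I)
    fix r t :: real assume rt: "0 \<le> r" "r \<le> t" "t < 1"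
    define i where "i = nat \<lfloor>real K * r\<rfloor>"
    define j where "j = nat \<lfloor>real K * t\<rfloor>"
    have i: "i < K" "real i / real K \<le> r" "r < real (Suc i) / real K"
      using grid_cell[OF K, of r] rt by (auto simp: i_def)
    have j: "j < K" "real j / real K \<le> t" "t < real (Suc j) / real K"
      using grid_cell[OF K, of t] rt by (auto simp: j_def)
    have "i \<le> j" unfolding i_def j_def using rt by (intro nat_mono floor_mono mult_left_mono) auto
    show "shift s g r \<le> shift s g t"
    proof (cases "i = j")
      case True
      show ?thesis
        unfolding val[OF i] val[OF j, folded True]
        using monoD[OF G0_mono[OF g] rt(2)] qpos[OF i(1)] by simp
    next
      case False
      have "shift s g r \<le> X' (Suc i)" by (rule bounds(2)[OF i])
      also have "\<dots> \<le> X' j" using False \<open>i \<le> j\<close> j by (intro X'mono) auto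
      also have "\<dots> \<le> shift s g t" by (rule bounds(1)[OF j])
      finally show ?thesis .
    qed
  next
    fix r :: real assume r: "0 \<le> r" "r < 1"
    define i where "i = nat \<lfloor>real K * r\<rfloor>"
    have i: "i < K" "real i / real K \<le> r" "r < real (Suc i) / real K"
      using grid_cell[OF K, of r] r by (auto simp: i_def)
    show "0 \<le> shift s g r \<and> shift s g r \<le> 1"
      using bounds[OF i] X'mono[of 0 i] X'mono[of "Suc i" K] i X'ends by auto
    \<comment> \<open>Cells are closed on the left, so the formula for the cell of \<open>r\<close>
      holds on a whole right neighbourhood, even if \<open>r\<close> is a grid point.\<close>
    have "\<forall>\<^sub>F t in at_right r. X' i + q i * (g t - X i) = shift s g t"
      using eventually_at_right_real[OF i(3)] by eventually_elim (use i val in auto)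
    moreover have "((\<lambda>t. X' i + q i * (g t - X i)) \<longlongrightarrow> shift s g r) (at_right r)"
      unfolding val[OF i] by (intro tendsto_intros G0_right_continuous[OF g])
    ultimately show "(shift s g \<longlongrightarrow> shift s g r) (at_right r)"
      by (rule Lim_transform_eventually[rotated])
  next
    fix t :: real assume "t < 0" then show "shift s g t = 0" using g by (auto simp: sh field_def G0_def)
  next
    fix t :: real assume "1 \<le> t" then show "shift s g t = 1" using g by (auto simp: sh field_def G0_def)
  qed
qed

text \<open>The exponent 1 - \<beta>/K may have either sign. The increments lie between
  \<open>c\<close> and 1, so each factor is at most 1 in one case and at most its value at
  \<open>c\<close> in the other.\<close>

lemma fill_weight_bound:
  assumes "\<beta> > 0" "\<And>i. i < K \<Longrightarrow> c \<le> x (Suc i) - x i" "\<And>i. i < K \<Longrightarrow> x (Suc i) - x i \<le> 1"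
  shows "fill_weight \<beta> K x \<le> (max 1 (c powr (1 - \<beta> / real K))) ^ K"
proof -
  have "fill_weight \<beta> K x \<le> (\<Prod>i<K. max 1 (c powr (1 - \<beta> / real K)))"
    unfolding fill_weight_def
  proof (intro prod_mono conjI)
    fix i assume "i \<in> {..<K}"
    then have d: "c \<le> x (Suc i) - x i" "x (Suc i) - x i \<le> 1" using assms by auto
    show "(x (Suc i) - x i) powr (1 - \<beta> / real K) \<le> max 1 (c powr (1 - \<beta> / real K))"
    proof (cases "0 \<le> 1 - \<beta> / real K")
      case True
      then have "(x (Suc i) - x i) powr (1 - \<beta> / real K) \<le> 1" using d c by (intro powr_le1) auto
      then show ?thesis by simp
    next
      case False
      then have "(x (Suc i) - x i) powr (1 - \<beta> / real K) \<le> c powr (1 - \<beta> / real K)"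
        using d c by (intro powr_mono2') auto
      then show ?thesis by simp
    qed
  qed auto
  then show ?thesis by simp
qed

end

lemma fill_weight_nonneg: "0 \<le> fill_weight \<beta> K x"
  by (simp add: fill_weight_def prod_nonneg)

section \<open>Events determined by refinements of the coarse grid\<close>

definition fine_vec :: "nat \<Rightarrow> (real \<Rightarrow> real) \<Rightarrow> nat \<Rightarrow> real"
  where "fine_vec M g = (\<lambda>j\<in>{1..M - 1}. g (real j / real M))"

context dirichlet_process
begin

lemma grid_vals_measurable [measurable]: "(\<lambda>g. grid_vals K g i) \<in> borel_measurable Q"
  by (cases "i = 0") (auto simp: grid_vals_def)

lemma fine_vec_measurable [measurable]:
  "fine_vec M \<in> measurable Q (PiM {1..M - 1} (\<lambda>_. lborel))"
  unfolding fine_vec_def[abs_def] by (rule measurable_restrict) simp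

lemma nn_integral_fine_vec:
  assumes "0 < M" and [measurable]: "\<phi> \<in> borel_measurable (PiM {1..M - 1} (\<lambda>_. lborel))"
  shows "(\<integral>\<^sup>+ g. \<phi> (fine_vec M g) \<partial>Q) = (\<integral>\<^sup>+ z. ennreal (dirichlet_density \<beta> (M - 1) (\<lambda>j. real j / real M) z) * \<phi> z
    \<partial>PiM {1..M - 1} (\<lambda>_. lborel))"
proof -
  have "distr Q (PiM {1..M - 1} (\<lambda>_. lborel)) (\<lambda>g. \<lambda>i\<in>{1..M - 1}. g (real i / real M))
      = density (PiM {1..M - 1} (\<lambda>_. lborel)) (\<lambda>x. ennreal (dirichlet_density \<beta> (M - 1) (\<lambda>j. real j / real M) x))"
  proof -
    have t: "real 0 / real M = 0 \<and> real (Suc (M - 1)) / real M = 1 \<and> (\<forall>i\<le>M - 1. real i / real M < real (Suc i) / real M)"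
      using assms(1) by (auto simp: field_simps)
    have "\<forall>N t. t 0 = 0 \<and> t (Suc N) = 1 \<and> (\<forall>i\<le>N. t i < t (Suc i)) \<longrightarrow>
        distr Q (PiM {1..N} (\<lambda>_. lborel)) (\<lambda>g. \<lambda>i\<in>{1..N}. g (t i))
        = density (PiM {1..N} (\<lambda>_. lborel)) (\<lambda>x. ennreal (dirichlet_density \<beta> N t x))"
      using Q unfolding is_Q_beta_def by blast
    from this[THEN spec[of _ "M - 1"], THEN spec[of _ "\<lambda>j. real j / real M"], THEN mp, OF t]
    show ?thesis .
  qed
  then have d: "distr Q (PiM {1..M - 1} (\<lambda>_. lborel)) (fine_vec M)
      = density (PiM {1..M - 1} (\<lambda>_. lborel)) (\<lambda>x. ennreal (dirichlet_density \<beta> (M - 1) (\<lambda>j. real j / real M) x))"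
    by (simp add: fine_vec_def[abs_def])
  have "(\<integral>\<^sup>+ g. \<phi> (fine_vec M g) \<partial>Q) = (\<integral>\<^sup>+ z. \<phi> z \<partial>distr Q (PiM {1..M - 1} (\<lambda>_. lborel)) (fine_vec M))"
    by (rule nn_integral_distr[symmetric, OF fine_vec_measurable]) (simp only: measurable_distr_eq1 assms(2))
  also have "\<dots> = (\<integral>\<^sup>+ z. ennreal (dirichlet_density \<beta> (M - 1) (\<lambda>j. real j / real M) z) * \<phi> z
    \<partial>PiM {1..M - 1} (\<lambda>_. lborel))"
    unfolding d by (rule nn_integral_density) measurable
  finally show ?thesis .
qed

definition fine_events :: "nat \<Rightarrow> (real \<Rightarrow> real) set set"
  where "fine_events K = {fine_vec (K * L) -` A \<inter> G0 | L A. 0 < L \<and> A \<in> sets (PiM {1..K * L - 1} (\<lambda>_. lborel))}"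

lemma fine_events_subset: "fine_events K \<subseteq> sets Q"
  using measurable_sets[OF fine_vec_measurable] by (auto simp: fine_events_def)

text \<open>The grids with \<open>K * L\<close> and \<open>K * L'\<close> cells have the common
  refinement \<open>K * (L * L')\<close>, from whose values those of both can be read off.\<close>

lemma Int_stable_fine_events:
  assumes "0 < K"
  shows "Int_stable (fine_events K)"
proof (rule Int_stableI)
  fix a b assume "a \<in> fine_events K" "b \<in> fine_events K"
  then obtain L A L' A' where a: "a = fine_vec (K * L) -` A \<inter> G0" "0 < L" "A \<in> sets (PiM {1..K * L - 1} (\<lambda>_. lborel))"
    and b: "b = fine_vec (K * L') -` A' \<inter> G0" "0 < L'" "A' \<in> sets (PiM {1..K * L' - 1} (\<lambda>_. lborel))"
    by (auto simp: fine_events_def)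
  let ?M = "PiM {1..K * (L * L') - 1} (\<lambda>_. lborel :: real measure)"
  have refine: "\<exists>pr\<in>measurable ?M (PiM {1..K * l - 1} (\<lambda>_. lborel)). \<forall>g. fine_vec (K * l) g = pr (fine_vec (K * (L * L')) g)"
    if l: "L * L' = l * k" "0 < l" "0 < k" for l k
  proof
    have idx: "j * k \<in> {1..K * (L * L') - 1}" if "j \<in> {1..K * l - 1}" for j
    proof -
      have "j < K * l" using that assms l by auto
      then have "j * k < K * (L * L')" unfolding l(1) using l by (simp add: mult.assoc[symmetric])
      moreover have "0 < j * k" using that l by simp
      ultimately show ?thesis by (simp only: atLeastAtMost_iff) linarith
    qed
    show "(\<lambda>z. \<lambda>j\<in>{1..K * l - 1}. z (j * k)) \<in> measurable ?M (PiM {1..K * l - 1} (\<lambda>_. lborel))"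
      using idx by (intro measurable_restrict measurable_component_singleton)
    show "\<forall>g. fine_vec (K * l) g = (\<lambda>z. \<lambda>j\<in>{1..K * l - 1}. z (j * k)) (fine_vec (K * (L * L')) g)"
    proof (intro allI ext)
      fix g j
      have "real (j * k) / real (K * (L * L')) = real j / real (K * l)" using l by simp
      then show "fine_vec (K * l) g j = (\<lambda>j\<in>{1..K * l - 1}. fine_vec (K * (L * L')) g (j * k)) j"
        using idx[of j] by (simp add: fine_vec_def)
    qed
  qed
  obtain p where p: "p \<in> measurable ?M (PiM {1..K * L - 1} (\<lambda>_. lborel))"
    "\<And>g. fine_vec (K * L) g = p (fine_vec (K * (L * L')) g)"
    using refine[OF refl a(2) b(2)] by blast
  obtain p' where p': "p' \<in> measurable ?M (PiM {1..K * L' - 1} (\<lambda>_. lborel))"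
    "\<And>g. fine_vec (K * L') g = p' (fine_vec (K * (L * L')) g)"
    using refine[OF mult.commute b(2) a(2)] by blast
  define D where "D = (p -` A \<inter> space ?M) \<inter> (p' -` A' \<inter> space ?M)"
  have fv: "fine_vec (K * (L * L')) g \<in> space ?M" if "g \<in> G0" for g
    using measurable_space[OF fine_vec_measurable, of g] that by simp
  have "a \<inter> b = fine_vec (K * (L * L')) -` D \<inter> G0"
  proof (intro set_eqI)
    fix g
    show "g \<in> a \<inter> b \<longleftrightarrow> g \<in> fine_vec (K * (L * L')) -` D \<inter> G0"
      unfolding a b D_def Int_iff vimage_eq p(2)[of g] p'(2)[of g] using fv by blast
  qed
  moreover have "D \<in> sets ?M"
    unfolding D_def by (intro sets.Int measurable_sets[OF p(1) a(3)] measurable_sets[OF p'(1) b(3)])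
  moreover have "0 < L * L'" using a(2) b(2) by simp
  ultimately show "a \<inter> b \<in> fine_events K"
    unfolding fine_events_def by blast
qed

text \<open>Every evaluation is a limit of evaluations at grid points decreasing to its argument, so
  right continuity lets the refining grids generate everything.\<close>

lemma sets_Q_fine_events:
  assumes "0 < K"
  shows "sets Q = sigma_sets G0 (fine_events K)"
proof
  show "sigma_sets G0 (fine_events K) \<subseteq> sets Q"
    using sets.sigma_sets_subset[OF fine_events_subset] by simp
  define S where "S = sigma G0 (fine_events K)"
  have sub: "fine_events K \<subseteq> Pow G0" by (auto simp: fine_events_def)
  have S: "space S = G0" "sets S = sigma_sets G0 (fine_events K)"
    using sub by (auto simp: S_def)
  have fv: "fine_vec (K * L) \<in> measurable S (PiM {1..K * L - 1} (\<lambda>_. lborel))" if "0 < L" for L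
  proof (rule measurableI)
    fix A assume "A \<in> sets (PiM {1..K * L - 1} (\<lambda>_. lborel :: real measure))"
    then have "fine_vec (K * L) -` A \<inter> G0 \<in> fine_events K" using that by (auto simp: fine_events_def)
    then show "fine_vec (K * L) -` A \<inter> space S \<in> sets S" unfolding S by (rule sigma_sets.Basic)
  qed (auto simp: fine_vec_def space_PiM)
  have grid: "(\<lambda>g. g (real j / real (K * L))) \<in> borel_measurable S" if "0 < L" "0 < j" for j L
  proof (cases "j < K * L")
    case True
    then have j: "j \<in> {1..K * L - 1}" using that by auto
    have "(\<lambda>g. fine_vec (K * L) g j) \<in> measurable S lborel"
      by (rule measurable_compose[OF fv[OF that(1)] measurable_component_singleton[OF j]])
    then show ?thesis using j by (simp add: fine_vec_def)
  next
    case False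
    \<comment> \<open>Grid points at or beyond 1 are not among the coordinates of
      \<open>fine_vec\<close>, but every map has the value 1 there.\<close>
    then have "1 \<le> real j / real (K * L)" using assms that
      by (metis le_divide_eq_1_pos mult_pos_pos not_le of_nat_0_less_iff of_nat_le_iff)
    then have "(\<lambda>g. g (real j / real (K * L))) \<in> borel_measurable S \<longleftrightarrow> (\<lambda>g. 1 :: real) \<in> borel_measurable S"
      by (intro measurable_cong) (auto simp: S G0_def)
    then show ?thesis by simp
  qed
  have ev: "(\<lambda>g. g t) \<in> borel_measurable S" if "0 \<le> t" for t
  proof (rule borel_measurable_LIMSEQ_real)
    fix g assume "g \<in> space S"
    then show "(\<lambda>n. g (grid_above (K * Suc n) t)) \<longlonglongrightarrow> g t" using S assms by (intro G0_grid_above_tendsto) auto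
  next
    fix n
    have "grid_above (K * Suc n) t = real (nat (\<lfloor>real (K * Suc n) * t\<rfloor> + 1)) / real (K * Suc n)"
      using that unfolding grid_above_def by (subst of_nat_nat) auto
    moreover have "0 < nat (\<lfloor>real (K * Suc n) * t\<rfloor> + 1)"
    proof -
      have "0 \<le> \<lfloor>real (K * Suc n) * t\<rfloor>" using that by simp
      then show ?thesis by linarith
    qed
    ultimately show "(\<lambda>g. g (grid_above (K * Suc n) t)) \<in> borel_measurable S"
      using grid[OF zero_less_Suc] by presburger
  qed
  have "{{g\<in>G0. g t \<in> A} | t A. t \<in> {0..1} \<and> A \<in> sets borel} \<subseteq> sets S"
  proof clarify
    fix t :: real and A :: "real set" assume "t \<in> {0..1}" "A \<in> sets borel"
    then have "(\<lambda>g. g t) -` A \<inter> space S \<in> sets S" using ev[of t] by (intro measurable_sets) auto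
    moreover have "(\<lambda>g. g t) -` A \<inter> space S = {g\<in>G0. g t \<in> A}" by (auto simp: S)
    ultimately show "{g\<in>G0. g t \<in> A} \<in> sets S" by simp
  qed
  from sets.sigma_sets_subset[OF this] show "sets Q \<subseteq> sigma_sets G0 (fine_events K)"
    by (simp only: sets_Q G0_sets_def S)
qed

end

section \<open>Weighted invariance of the law under the grid shift\<close>

locale shifted_process = dirichlet_process + grid_shift
begin

lemma inbox_measurable [measurable]: "Measurable.pred Q (\<lambda>g. inbox (\<lambda>i. grid_vals K g i - s * v i))"
  by (rule measurable_inbox) measurable

lemma inbox_measurable' [measurable]: "Measurable.pred Q (\<lambda>g. inbox (grid_vals K g))"
  by (rule measurable_inbox) measurable

lemma weight_measurable [measurable]: "(\<lambda>g. fill_weight \<beta> K (grid_vals K g)) \<in> borel_measurable Q"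
  by (rule measurable_fill_weight) measurable

lemma field_measurable [measurable]: "(\<lambda>g. field g t) \<in> borel_measurable Q"
  unfolding field_def by measurable

lemma shift_measurable_pair [measurable]: "(\<lambda>(s, g). shift s g) \<in> measurable (borel \<Otimes>\<^sub>M Q) Q"
proof (rule measurable_into_Q)
  fix w :: "real \<times> (real \<Rightarrow> real)" assume "w \<in> space (borel \<Otimes>\<^sub>M Q)"
  then show "(case w of (s, g) \<Rightarrow> shift s g) \<in> G0" by (auto simp: space_pair_measure shift_in_G0)
next
  fix t
  have "(\<lambda>w. (case w of (s, g) \<Rightarrow> shift s g) t)
      = (\<lambda>w. if inbox (grid_vals K (snd w)) \<and> 0 \<le> fst w \<and> fst w \<le> 1 then snd w t + fst w * field (snd w) t else snd w t)"
    by (auto simp: fun_eq_iff shift_def)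
  also have "\<dots> \<in> borel_measurable (borel \<Otimes>\<^sub>M Q)" by measurable
  finally show "(\<lambda>w. (case w of (s, g) \<Rightarrow> shift s g) t) \<in> borel_measurable (borel \<Otimes>\<^sub>M Q)" .
qed

lemma shift_measurable [measurable]: "shift s \<in> measurable Q Q"
  using measurable_compose[OF measurable_Pair1'[of s borel Q] shift_measurable_pair] by simp

lemma fine_vec_coarse:
  assumes "0 < L" "i \<le> K" "g \<in> G0"
  shows "ext_pts (K * L - 1) (fine_vec (K * L) g) (i * L) = grid_vals K g i"
proof -
  have N: "Suc (K * L - 1) = K * L" using K assms by simp
  consider "i = 0" | "i = K" | "0 < i" "i < K" using assms by linarith
  then show ?thesis
  proof cases
    case 1
    then show ?thesis by (simp add: ext_pts_def grid_vals_def)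
  next
    case 2
    then show ?thesis using N K assms grid_vals_ends[OF assms(3) K] by (simp add: ext_pts_def)
  next
    case 3
    then have "i * L < K * L" "0 < i * L" using assms by auto
    then have "i * L \<in> {1..K * L - 1}" by (simp only: atLeastAtMost_iff) linarith
    moreover have "real (i * L) / real (K * L) = real i / real K" using assms by simp
    ultimately show ?thesis using N 3 \<open>i * L < K * L\<close> assms by (simp add: ext_pts_def fine_vec_def grid_vals_def del: of_nat_mult)
  qed
qed

text \<open>The link between paths and coordinates: seen through a refined grid,
  \<open>shift s\<close> is exactly the map \<open>T\<close> of
  \<open>grid_substitution\<close>.\<close>

lemma fine_vec_shift:
  assumes "0 < L" "g \<in> G0" "inbox (grid_vals K g)" "0 \<le> s" "s \<le> 1"
  defines "z \<equiv> fine_vec (K * L) g"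
  shows "fine_vec (K * L) (shift s g) = (\<lambda>j\<in>{1..K * L - 1}. z j
    + s * interp v (\<lambda>i. ext_pts (K * L - 1) z (i * L)) (j div L) (z j))"
proof
  fix j
  show "fine_vec (K * L) (shift s g) j = (\<lambda>j\<in>{1..K * L - 1}. z j
    + s * interp v (\<lambda>i. ext_pts (K * L - 1) z (i * L)) (j div L) (z j)) j"
  proof (cases "j \<in> {1..K * L - 1}")
    case False
    then show ?thesis by (auto simp: fine_vec_def)
  next
    case True
    then have jlt: "j < K * L" by auto
    have k: "j div L < K" using jlt by (simp add: less_mult_imp_div_less)
    have "nat \<lfloor>real K * (real j / real (K * L))\<rfloor> = j div L"
      using K assms(1) by (simp add: floor_divide_of_nat_eq)
    moreover have "real j / real (K * L) < 1" using jlt by (simp add: divide_less_eq_1 del: of_nat_mult) linarith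
    ultimately have f: "field g (real j / real (K * L)) = interp v (grid_vals K g) (j div L) (g (real j / real (K * L)))"
      unfolding field_def by simp
    have "interp v (\<lambda>i. ext_pts (K * L - 1) z (i * L)) (j div L) y = interp v (grid_vals K g) (j div L) y" for y
      using fine_vec_coarse[OF assms(1) _ assms(2), of "j div L"] fine_vec_coarse[OF assms(1) _ assms(2), of "Suc (j div L)"] k
      unfolding interp_def z_def by simp
    moreover have "shift s g r = g r + s * field g r" for r using assms by (simp add: shift_def)
    ultimately show ?thesis using True f by (simp add: fine_vec_def z_def)
  qed
qed

text \<open>For events of a refined grid this is the substitution in the Dirichlet density. Both
  sides integrate \<open>f\<close> against measures that agree on such events, and these form an
  intersection-stable generator. As before, the right side weighs the end point and tests whether
  the starting point was in the box.\<close>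

proposition nn_integral_shift:
  assumes s: "0 \<le> s" "s \<le> 1" and f [measurable]: "f \<in> borel_measurable Q"
  shows "(\<integral>\<^sup>+ g. (if inbox (grid_vals K g) then ennreal (fill_weight \<beta> K (grid_vals K g)) * f (shift s g) else 0) \<partial>Q)
    = (\<integral>\<^sup>+ g. (if inbox (\<lambda>i. grid_vals K g i - s * v i) then ennreal (fill_weight \<beta> K (grid_vals K g)) * f g else 0) \<partial>Q)"
proof -
  define W where "W g = (if inbox (grid_vals K g) then ennreal (fill_weight \<beta> K (grid_vals K g)) else 0)" for g
  define W' where "W' g = (if inbox (\<lambda>i. grid_vals K g i - s * v i) then ennreal (fill_weight \<beta> K (grid_vals K g)) else 0)" for g
  have W [measurable]: "W \<in> borel_measurable Q" unfolding W_def by measurable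
  have W' [measurable]: "W' \<in> borel_measurable Q" unfolding W'_def by measurable
  define M1 where "M1 = distr (density Q W) Q (shift s)"
  define M2 where "M2 = density Q W'"
  have i1: "(\<integral>\<^sup>+ g. h g \<partial>M1) = (\<integral>\<^sup>+ g. W g * h (shift s g) \<partial>Q)" if "h \<in> borel_measurable Q" for h
  proof -
    note [measurable] = that
    have "(\<integral>\<^sup>+ g. h g \<partial>M1) = (\<integral>\<^sup>+ g. h (shift s g) \<partial>density Q W)"
      unfolding M1_def by (rule nn_integral_distr) measurable
    also have "\<dots> = (\<integral>\<^sup>+ g. W g * h (shift s g) \<partial>Q)" by (rule nn_integral_density) measurable
    finally show ?thesis .
  qed
  have i2: "(\<integral>\<^sup>+ g. h g \<partial>M2) = (\<integral>\<^sup>+ g. W' g * h g \<partial>Q)" if "h \<in> borel_measurable Q" for h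
    unfolding M2_def using that by (intro nn_integral_density) auto
  have sets: "sets M1 = sets Q" "sets M2 = sets Q" by (auto simp: M1_def M2_def)
  have fine: "emeasure M1 E = emeasure M2 E" if E: "E \<in> fine_events K" for E
  proof -
    obtain L A where EA: "E = fine_vec (K * L) -` A \<inter> G0" and L: "0 < L"
      and A [measurable]: "A \<in> sets (PiM {1..K * L - 1} (\<lambda>_. lborel))"
      using E by (auto simp: fine_events_def)
    have EQ [measurable]: "E \<in> sets Q" using E fine_events_subset by auto
    define N where "N = K * L - 1"
    have N: "Suc N = K * L" using K L by (simp add: N_def)
    define F :: "(nat \<Rightarrow> real) \<Rightarrow> ennreal" where "F = indicator A"
    have F [measurable]: "F \<in> borel_measurable (PiM {1..N} (\<lambda>_. lborel))" unfolding F_def N_def by measurable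
    define cz where "cz z i = ext_pts N z (i * L)" for z i
    define \<rho> where "\<rho> = dirichlet_density \<beta> N (\<lambda>j. real j / real (K * L))"
    define T where "T z = (\<lambda>j\<in>{1..N}. z j + s * interp v (cz z) (j div L) (z j))" for z
    define H where "H z = (if inbox (cz z) then ennreal (fill_weight \<beta> K (cz z)) * F (T z) else 0)" for z
    define H' where "H' z = (if inbox (\<lambda>i. cz z i - s * v i) then ennreal (fill_weight \<beta> K (cz z)) * F z else 0)" for z
    have cell: "j div L < K" if "j \<le> N" for j
      using that N L by (intro less_mult_imp_div_less) auto
    have cz_meas: "(\<lambda>z. cz z i) \<in> borel_measurable (PiM {1..N} (\<lambda>_. lborel))" if "i \<le> K" for i
      unfolding cz_def using that N by (intro measurable_ext_pts) simp
    have [measurable]: "(\<lambda>z. fill_weight \<beta> K (cz z)) \<in> borel_measurable (PiM {1..N} (\<lambda>_. lborel))"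
      by (intro measurable_fill_weight cz_meas)
    have [measurable]: "Measurable.pred (PiM {1..N} (\<lambda>_. lborel)) (\<lambda>z. inbox (cz z))"
      by (intro measurable_inbox cz_meas)
    have [measurable]: "Measurable.pred (PiM {1..N} (\<lambda>_. lborel)) (\<lambda>z. inbox (\<lambda>i. cz z i - s * v i))"
      by (intro measurable_inbox borel_measurable_diff cz_meas) auto
    have T [measurable]: "T \<in> measurable (PiM {1..N} (\<lambda>_. lborel)) (PiM {1..N} (\<lambda>_. lborel))"
      unfolding T_def
    proof (rule measurable_restrict)
      fix j assume j: "j \<in> {1..N}"
      have [measurable]: "(\<lambda>z. z j) \<in> borel_measurable (PiM {1..N} (\<lambda>_. lborel))"
        using measurable_component_singleton[OF j, of "\<lambda>_. lborel"] by simp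
      have [measurable]: "(\<lambda>z. interp v (cz z) (j div L) (z j)) \<in> borel_measurable (PiM {1..N} (\<lambda>_. lborel))"
        using cell[of j] j by (intro measurable_interp cz_meas) (auto simp del: One_nat_def)
      show "(\<lambda>z. z j + s * interp v (cz z) (j div L) (z j)) \<in> measurable (PiM {1..N} (\<lambda>_. lborel)) lborel"
        by measurable
    qed
    have H: "H \<in> borel_measurable (PiM {1..N} (\<lambda>_. lborel))" unfolding H_def by measurable
    have H': "H' \<in> borel_measurable (PiM {1..N} (\<lambda>_. lborel))" unfolding H'_def by measurable
    have czX: "cz (fine_vec (K * L) g) i = grid_vals K g i" if "g \<in> G0" "i \<le> K" for g i
      using fine_vec_coarse[OF L that(2,1)] by (simp add: cz_def N_def)
    have czB: "inbox (\<lambda>i. cz (fine_vec (K * L) g) i - r * v i) \<longleftrightarrow> inbox (\<lambda>i. grid_vals K g i - r * v i)"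
      if "g \<in> G0" for g r
      unfolding inbox_def by (intro ball_cong refl) (use czX[OF that] in auto)
    have czw: "fill_weight \<beta> K (cz (fine_vec (K * L) g)) = fill_weight \<beta> K (grid_vals K g)" if "g \<in> G0" for g
      unfolding fill_weight_def by (intro prod.cong) (use czX[OF that] in auto)
    have "emeasure M1 E = (\<integral>\<^sup>+ g. indicator E g \<partial>M1)" by (simp add: sets)
    also have "\<dots> = (\<integral>\<^sup>+ g. W g * indicator E (shift s g) \<partial>Q)" by (rule i1) measurable
    also have "\<dots> = (\<integral>\<^sup>+ g. H (fine_vec (K * L) g) \<partial>Q)"
    proof (rule nn_integral_cong)
      fix g assume "g \<in> space Q"
      then have g: "g \<in> G0" by simp
      show "W g * indicator E (shift s g) = H (fine_vec (K * L) g)"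
      proof (cases "inbox (grid_vals K g)")
        case True
        have "T (fine_vec (K * L) g) = fine_vec (K * L) (shift s g)"
          unfolding fine_vec_shift[OF L g True s] T_def cz_def N_def ..
        then show ?thesis
          using True czB[OF g, of 0] czw[OF g] shift_in_G0[OF g, of s]
          by (simp add: W_def H_def EA F_def indicator_def)
      next
        case False
        then show ?thesis using czB[OF g, of 0] by (simp add: W_def H_def)
      qed
    qed
    also have "\<dots> = (\<integral>\<^sup>+ z. ennreal (\<rho> z) * H z \<partial>PiM {1..N} (\<lambda>_. lborel))"
      unfolding \<rho>_def N_def using K L H by (intro nn_integral_fine_vec) (auto simp: N_def)
    also have "\<dots> = (\<integral>\<^sup>+ z. (if inbox (cz z) then ennreal (fill_weight \<beta> K (cz z) * \<rho> z) * F (T z) else 0)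
        \<partial>PiM {1..N} (\<lambda>_. lborel))"
      by (intro nn_integral_cong) (simp add: H_def ennreal_mult'[OF fill_weight_nonneg] ennreal_mult''[OF fill_weight_nonneg] mult_ac)
    also have "\<dots> = (\<integral>\<^sup>+ z. (if inbox (\<lambda>i. cz z i - s * v i) then ennreal (fill_weight \<beta> K (cz z) * \<rho> z) * F z else 0)
        \<partial>PiM {1..N} (\<lambda>_. lborel))"
      using grid_substitution[OF s L N F, of \<beta>] unfolding T_def cz_def \<rho>_def .
    also have "\<dots> = (\<integral>\<^sup>+ z. ennreal (\<rho> z) * H' z \<partial>PiM {1..N} (\<lambda>_. lborel))"
      by (intro nn_integral_cong) (simp add: H'_def ennreal_mult'[OF fill_weight_nonneg] ennreal_mult''[OF fill_weight_nonneg] mult_ac)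
    also have "\<dots> = (\<integral>\<^sup>+ g. H' (fine_vec (K * L) g) \<partial>Q)"
      unfolding \<rho>_def N_def using K L H' by (intro nn_integral_fine_vec[symmetric]) (auto simp: N_def)
    also have "\<dots> = (\<integral>\<^sup>+ g. W' g * indicator E g \<partial>Q)"
    proof (rule nn_integral_cong)
      fix g assume "g \<in> space Q"
      then have g: "g \<in> G0" by simp
      show "H' (fine_vec (K * L) g) = W' g * indicator E g"
        using czB[OF g, of s] czw[OF g] g by (simp add: W'_def H'_def EA F_def indicator_def)
    qed
    also have "\<dots> = (\<integral>\<^sup>+ g. indicator E g \<partial>M2)" by (rule i2[symmetric]) measurable
    also have "\<dots> = emeasure M2 E" by (simp add: sets)
    finally show ?thesis .
  qed
  have G0_ev: "G0 \<in> fine_events K"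
  proof -
    have "fine_vec (K * 1) -` space (PiM {1..K * 1 - 1} (\<lambda>_. lborel)) \<inter> G0 = G0"
      using measurable_space[OF fine_vec_measurable] by auto
    then show ?thesis unfolding fine_events_def by (smt (verit) mem_Collect_eq sets.top zero_less_one)
  qed
  \<comment> \<open>Uniqueness of the extension from the generator needs finite mass; the lower
    bound \<open>c\<close> on the increments makes the weight bounded on the box.\<close>
  have fin: "emeasure M1 G0 \<noteq> \<infinity>"
  proof -
    let ?C = "(max 1 (c powr (1 - \<beta> / real K))) ^ K"
    have bd: "W g \<le> ennreal ?C" if g: "g \<in> G0" for g
    proof (cases "inbox (grid_vals K g)")
      case True
      have "fill_weight \<beta> K (grid_vals K g) \<le> ?C"
      proof (rule fill_weight_bound[OF \<beta>_pos])
        fix i assume i: "i < K"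
        show "c \<le> grid_vals K g (Suc i) - grid_vals K g i"
          using gap_shift[OF grid_vals_ends[OF g K] True i, of 0] by simp
        show "grid_vals K g (Suc i) - grid_vals K g i \<le> 1"
          using G0_range[OF g] by (auto simp: grid_vals_def intro: order_trans[of _ "g _"]) (smt (verit))
      qed
      then show ?thesis using True by (simp add: W_def ennreal_leI)
    qed (simp add: W_def)
    have "emeasure M1 G0 = (\<integral>\<^sup>+ g. indicator G0 g \<partial>M1)"
      using sets sets.top[of Q] by simp
    also have "\<dots> = (\<integral>\<^sup>+ g. W g * indicator G0 (shift s g) \<partial>Q)" using sets.top[of Q] by (intro i1) auto
    also have "\<dots> \<le> (\<integral>\<^sup>+ g. ennreal ?C \<partial>Q)"
      by (intro nn_integral_mono) (auto simp: indicator_def bd)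
    also have "\<dots> = ennreal ?C" using emeasure_space_1 by simp
    finally show ?thesis by (metis ennreal_less_top infinity_ennreal_def leD)
  qed
  have "fine_events K \<subseteq> Pow G0" by (auto simp: fine_events_def)
  then have "M1 = M2"
    using Int_stable_fine_events[OF K] fine G0_ev fin sets sets_Q_fine_events[OF K]
    by (intro measure_eqI_generator_eq[where \<Omega> = G0 and E = "fine_events K" and A = "\<lambda>_. G0"]) auto
  then have "(\<integral>\<^sup>+ g. W g * f (shift s g) \<partial>Q) = (\<integral>\<^sup>+ g. W' g * f g \<partial>Q)"
    using i1[OF f] i2[OF f] by simp
  moreover have "W g * f (shift s g) = (if inbox (grid_vals K g) then ennreal (fill_weight \<beta> K (grid_vals K g)) * f (shift s g) else 0)" for g
    by (simp add: W_def)
  moreover have "W' g * f g = (if inbox (\<lambda>i. grid_vals K g i - s * v i) then ennreal (fill_weight \<beta> K (grid_vals K g)) * f g else 0)" for g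
    by (simp add: W'_def)
  ultimately show ?thesis by simp
qed

end

section \<open>Calculus of cylinder functions along segments\<close>

abbreviation unit_lebesgue :: "real measure"
  where "unit_lebesgue \<equiv> restrict_space lborel {0..1}"

interpretation unit_lebesgue: prob_space unit_lebesgue
  by standard (simp add: space_restrict_space emeasure_restrict_space)

lemma measurable_unit_lebesgue: "f \<in> borel_measurable borel \<Longrightarrow> f \<in> borel_measurable unit_lebesgue"
  by (simp add: measurable_restrict_space1)

lemma unit_lebesgue_integral:
  fixes f :: "real \<Rightarrow> real"
  assumes f: "f \<in> borel_measurable borel" and B: "\<And>r. r \<in> {0..1} \<Longrightarrow> \<bar>f r\<bar> \<le> B"
  shows "integrable unit_lebesgue f" "(\<integral>r. f r \<partial>unit_lebesgue) = integral {0..1} f"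
proof -
  show i: "integrable unit_lebesgue f"
    by (rule unit_lebesgue.integrable_const_bound[where B = B])
      (use B in \<open>auto simp: space_restrict_space intro!: AE_I2 measurable_unit_lebesgue[OF f]\<close>)
  then have s: "set_integrable lborel {0..1} f"
    by (simp add: integrable_restrict_space set_integrable_def)
  have "(\<integral>r. f r \<partial>unit_lebesgue) = (LINT r:{0..1}|lborel. f r)"
    by (simp add: integral_restrict_space set_lebesgue_integral_def)
  also have "\<dots> = integral {0..1} f" by (rule set_borel_integral_eq_integral(2)[OF s])
  finally show "(\<integral>r. f r \<partial>unit_lebesgue) = integral {0..1} f" .
qed

text \<open>\<open>C1_01\<close> constrains its functions on [0,1] only, and elsewhere they may fail
  to be measurable. Clamping the argument gives a Borel function with the same values on [0,1],
  where all maps in \<open>G0\<close> take their values.\<close>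

lemma continuous_unit_extension:
  fixes \<phi> :: "real \<Rightarrow> real"
  assumes "continuous_on {0..1} \<phi>"
  obtains \<psi> B where "\<psi> \<in> borel_measurable borel" "\<And>y. y \<in> {0..1} \<Longrightarrow> \<psi> y = \<phi> y"
    "\<And>y. y \<in> {0..1} \<Longrightarrow> \<bar>\<phi> y\<bar> \<le> B"
proof -
  have "continuous_on UNIV (\<lambda>y. \<phi> (max 0 (min 1 y)))"
    by (rule continuous_on_compose2[OF assms]) (auto intro!: continuous_intros)
  then have 1: "(\<lambda>y. \<phi> (max 0 (min 1 y))) \<in> borel_measurable borel" by (rule borel_measurable_continuous_onI)
  have "bounded (\<phi> ` {0..1})" using assms by (intro compact_imp_bounded compact_continuous_image) auto
  then obtain B where "\<forall>y\<in>\<phi> ` {0..1}. \<bar>y\<bar> \<le> B" unfolding bounded_iff real_norm_def by blast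
  then have "\<bar>\<phi> y\<bar> \<le> B" if "y \<in> {0..1}" for y using that by blast
  then show thesis by (intro that[OF 1]) auto
qed

text \<open>Dominated convergence along sequences: since \<phi>' is bounded on [0,1] and
  \<open>V\<close> by 1, the mean value theorem bounds all difference quotients by one constant.
  Derivatives are taken within [0,1], so they are one-sided at its ends.\<close>

lemma has_derivative_integral_along_path:
  fixes \<phi> \<phi>' g V :: "real \<Rightarrow> real"
  assumes \<phi>: "\<And>y. y \<in> {0..1} \<Longrightarrow> (\<phi> has_real_derivative \<phi>' y) (at y within {0..1})"
    and \<phi>': "continuous_on {0..1} \<phi>'"
    and g: "g \<in> borel_measurable borel" and V: "V \<in> borel_measurable borel" "\<And>r. \<bar>V r\<bar> \<le> 1"
    and in01: "\<And>s r. s \<in> {0..1} \<Longrightarrow> g r + s * V r \<in> {0..1}"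
    and s: "s \<in> {0..1}"
  shows "((\<lambda>s. integral {0..1} (\<lambda>r. \<phi> (g r + s * V r))) has_real_derivative
    (\<integral>r. \<phi>' (g r + s * V r) * V r \<partial>unit_lebesgue)) (at s within {0..1})"
proof -
  have "continuous_on {0..1} \<phi>"
    using \<phi> by (meson DERIV_continuous continuous_on_eq_continuous_within)
  then obtain \<psi> B where \<psi>: "\<psi> \<in> borel_measurable borel" "\<And>y. y \<in> {0..1} \<Longrightarrow> \<psi> y = \<phi> y"
    "\<And>y. y \<in> {0..1} \<Longrightarrow> \<bar>\<phi> y\<bar> \<le> B" by (rule continuous_unit_extension) blast
  obtain \<psi>' B' where \<psi>': "\<psi>' \<in> borel_measurable borel" "\<And>y. y \<in> {0..1} \<Longrightarrow> \<psi>' y = \<phi>' y"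
    "\<And>y. y \<in> {0..1} \<Longrightarrow> \<bar>\<phi>' y\<bar> \<le> B'" by (rule continuous_unit_extension[OF \<phi>']) blast
  note [measurable] = g V(1) \<psi>(1) \<psi>'(1)
  have lip: "\<bar>\<phi> y - \<phi> x\<bar> \<le> B' * \<bar>y - x\<bar>" if "x \<in> {0..1}" "y \<in> {0..1}" for x y
    using field_differentiable_bound[of "{0..1}" \<phi> \<phi>' B' y x] \<phi> \<psi>'(3) that by (auto simp: real_norm_def)
  have B'0: "0 \<le> B'" using \<psi>'(3)[of 0] by auto
  have meas: "(\<lambda>r. \<phi> (g r + t * V r)) \<in> borel_measurable borel" if "t \<in> {0..1}" for t
  proof -
    have "(\<lambda>r. \<phi> (g r + t * V r)) = (\<lambda>r. \<psi> (g r + t * V r))" using in01[OF that] \<psi>(2) by auto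
    then show ?thesis by simp
  qed
  have meas': "(\<lambda>r. \<phi>' (g r + s * V r) * V r) \<in> borel_measurable borel"
  proof -
    have "(\<lambda>r. \<phi>' (g r + s * V r) * V r) = (\<lambda>r. \<psi>' (g r + s * V r) * V r)" using in01[OF s] \<psi>'(2) by auto
    then show ?thesis by simp
  qed
  have int: "integrable unit_lebesgue (\<lambda>r. \<phi> (g r + t * V r))"
    "(\<integral>r. \<phi> (g r + t * V r) \<partial>unit_lebesgue) = integral {0..1} (\<lambda>r. \<phi> (g r + t * V r))"
    if "t \<in> {0..1}" for t
    using unit_lebesgue_integral[OF meas[OF that], of B] \<psi>(3)[OF in01[OF that]] by auto
  have pt: "((\<lambda>t. \<phi> (g r + t * V r)) has_real_derivative \<phi>' (g r + s * V r) * V r) (at s within {0..1})" for r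
  proof -
    have "(\<lambda>t. g r + t * V r) ` {0..1} \<subseteq> {0..1}" using in01 by auto
    then have "(\<phi> has_real_derivative \<phi>' (g r + s * V r)) (at (g r + s * V r) within (\<lambda>t. g r + t * V r) ` {0..1})"
      by (rule DERIV_subset[OF \<phi>[OF in01[OF s]]])
    moreover have "((\<lambda>t. g r + t * V r) has_real_derivative V r) (at s within {0..1})"
      by (auto intro!: derivative_eq_intros)
    ultimately show ?thesis using DERIV_image_chain by (fastforce simp: o_def)
  qed
  show ?thesis
    unfolding has_field_derivative_iff tendsto_at_iff_sequentially
  proof (intro allI impI)
    fix X :: "nat \<Rightarrow> real" assume X: "\<forall>i. X i \<in> {0..1} - {s}" "X \<longlonglongrightarrow> s"
    have "(\<lambda>n. \<integral>r. (\<phi> (g r + X n * V r) - \<phi> (g r + s * V r)) / (X n - s) \<partial>unit_lebesgue)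
        \<longlonglongrightarrow> (\<integral>r. \<phi>' (g r + s * V r) * V r \<partial>unit_lebesgue)"
    proof (rule integral_dominated_convergence[where w = "\<lambda>_. B'"])
      show "AE r in unit_lebesgue. (\<lambda>n. (\<phi> (g r + X n * V r) - \<phi> (g r + s * V r)) / (X n - s))
          \<longlonglongrightarrow> \<phi>' (g r + s * V r) * V r"
        using pt X unfolding has_field_derivative_iff tendsto_at_iff_sequentially by (auto simp: o_def)
      show "AE r in unit_lebesgue. norm ((\<phi> (g r + X n * V r) - \<phi> (g r + s * V r)) / (X n - s)) \<le> B'" for n
      proof (rule AE_I2)
        fix r
        have "\<bar>\<phi> (g r + X n * V r) - \<phi> (g r + s * V r)\<bar> \<le> B' * \<bar>(g r + X n * V r) - (g r + s * V r)\<bar>"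
          using X s by (intro lip in01) auto
        also have "\<dots> = B' * (\<bar>X n - s\<bar> * \<bar>V r\<bar>)" by (simp add: abs_mult[symmetric] algebra_simps)
        also have "\<dots> \<le> B' * (\<bar>X n - s\<bar> * 1)" using B'0 V(2) by (intro mult_left_mono) auto
        finally show "norm ((\<phi> (g r + X n * V r) - \<phi> (g r + s * V r)) / (X n - s)) \<le> B'"
          using X by (auto simp: abs_divide divide_le_eq)
      qed
      show "(\<lambda>r. \<phi>' (g r + s * V r) * V r) \<in> borel_measurable unit_lebesgue"
        by (rule measurable_unit_lebesgue[OF meas'])
      show "(\<lambda>r. (\<phi> (g r + X n * V r) - \<phi> (g r + s * V r)) / (X n - s)) \<in> borel_measurable unit_lebesgue" for n
        using X s by (intro borel_measurable_divide borel_measurable_diff measurable_unit_lebesgue meas) auto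
    qed simp
    moreover have "(\<integral>r. (\<phi> (g r + X n * V r) - \<phi> (g r + s * V r)) / (X n - s) \<partial>unit_lebesgue)
        = (integral {0..1} (\<lambda>r. \<phi> (g r + X n * V r)) - integral {0..1} (\<lambda>r. \<phi> (g r + s * V r))) / (X n - s)" for n
      using X s int[of "X n"] int[OF s] by simp
    ultimately show "((\<lambda>y. (integral {0..1} (\<lambda>r. \<phi> (g r + y * V r)) - integral {0..1} (\<lambda>r. \<phi> (g r + s * V r))) / (y - s)) \<circ> X)
        \<longlonglongrightarrow> (\<integral>r. \<phi>' (g r + s * V r) * V r \<partial>unit_lebesgue)"
      by (simp only: o_def)
  qed
qed

text \<open>The remainder in the expansion of \<open>U\<close> at \<open>Z s\<close> is a small
  multiple of the norm of the increment of \<open>Z\<close>. The constant \<open>C\<close>, strictly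
  above the sum of the absolute values of \<open>Z' i\<close>, eventually bounds that norm divided
  by the time increment, so the remainder disappears from the difference quotient.\<close>

lemma C1_Rm_chain:
  assumes U: "C1_Rm m U DU" and Z: "\<And>t. Z t \<in> Rm m"
    and dZ: "\<And>i. i < m \<Longrightarrow> ((\<lambda>t. Z t i) has_real_derivative Z' i) (at s within S)"
  shows "((\<lambda>t. U (Z t)) has_real_derivative (\<Sum>i<m. DU (Z s) i * Z' i)) (at s within S)"
proof -
  define h where "h t i = Z t i - Z s i" for t i
  define nrm where "nrm t = sqrt (\<Sum>i<m. (h t i)\<^sup>2)" for t
  define R where "R t = U (Z t) - U (Z s) - (\<Sum>i<m. DU (Z s) i * h t i)" for t
  define C where "C = (\<Sum>i<m. \<bar>Z' i\<bar>) + 1"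
  have C: "0 < C" by (simp add: C_def add_nonneg_pos sum_nonneg)
  have dq: "((\<lambda>t. h t i / (t - s)) \<longlongrightarrow> Z' i) (at s within S)" if "i < m" for i
    using dZ[OF that] by (simp add: has_field_derivative_iff h_def)
  have h0: "((\<lambda>t. h t i) \<longlongrightarrow> 0) (at s within S)" if "i < m" for i
    using DERIV_continuous[OF dZ[OF that]] unfolding continuous_within h_def by (rule LIM_zero)
  have nrm0: "(nrm \<longlongrightarrow> 0) (at s within S)"
  proof -
    have "((\<lambda>t. \<Sum>i<m. (h t i)\<^sup>2) \<longlongrightarrow> (\<Sum>i<m. 0\<^sup>2)) (at s within S)"
      by (intro tendsto_sum tendsto_power h0) auto
    from tendsto_real_sqrt[OF this] show ?thesis by (simp add: nrm_def[abs_def])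
  qed
  have nrm_le: "nrm t \<le> (\<Sum>i<m. \<bar>h t i\<bar>)" for t
    unfolding nrm_def using L2_set_le_sum_abs[of "h t" "{..<m}"] by (simp add: L2_set_def)
  have hR: "h t \<in> Rm m" for t using Z[of t] Z[of s] by (auto simp: Rm_def h_def)
  have R0: "((\<lambda>t. R t / (t - s)) \<longlongrightarrow> 0) (at s within S)"
  proof (rule tendstoI)
    fix \<epsilon> :: real assume "0 < \<epsilon>"
    then have e: "0 < \<epsilon> / C" using C by simp
    then obtain d where d: "d > 0" "\<And>k. k \<in> Rm m \<Longrightarrow> sqrt (\<Sum>i<m. (k i)\<^sup>2) < d \<Longrightarrow>
        \<bar>U (\<lambda>i. Z s i + k i) - U (Z s) - (\<Sum>i<m. DU (Z s) i * k i)\<bar> \<le> \<epsilon> / C * sqrt (\<Sum>i<m. (k i)\<^sup>2)"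
      using U Z[of s] unfolding C1_Rm_def by meson
    have "((\<lambda>t. \<Sum>i<m. \<bar>h t i / (t - s)\<bar>) \<longlongrightarrow> (\<Sum>i<m. \<bar>Z' i\<bar>)) (at s within S)"
      by (intro tendsto_sum tendsto_rabs dq) auto
    then have ev1: "\<forall>\<^sub>F t in at s within S. (\<Sum>i<m. \<bar>h t i / (t - s)\<bar>) < C"
      by (rule order_tendstoD) (simp add: C_def)
    have ev2: "\<forall>\<^sub>F t in at s within S. nrm t < d"
      using order_tendstoD(2)[OF nrm0 d(1)] .
    have ev3: "\<forall>\<^sub>F t in at s within S. t \<noteq> s" by (simp add: eventually_at_filter)
    from ev1 ev2 ev3 show "\<forall>\<^sub>F t in at s within S. dist (R t / (t - s)) 0 < \<epsilon>"
    proof eventually_elim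
      case (elim t)
      have "(\<lambda>i. Z s i + h t i) = Z t" by (auto simp: h_def)
      then have "\<bar>R t\<bar> \<le> \<epsilon> / C * nrm t"
        using d(2)[OF hR, of t] elim(2) by (simp add: R_def nrm_def)
      also have "\<dots> \<le> \<epsilon> / C * (\<Sum>i<m. \<bar>h t i\<bar>)" using nrm_le e by (intro mult_left_mono) auto
      finally have "\<bar>R t\<bar> / \<bar>t - s\<bar> \<le> \<epsilon> / C * (\<Sum>i<m. \<bar>h t i\<bar>) / \<bar>t - s\<bar>"
        by (intro divide_right_mono) auto
      also have "\<dots> = \<epsilon> / C * (\<Sum>i<m. \<bar>h t i / (t - s)\<bar>)"
        by (simp add: abs_divide sum_divide_distrib[symmetric])
      also have "\<dots> < \<epsilon> / C * C" using elim(1) e by (intro mult_strict_left_mono) auto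
      finally show ?case using C by (simp add: abs_divide)
    qed
  qed
  have "((\<lambda>t. R t / (t - s) + (\<Sum>i<m. DU (Z s) i * (h t i / (t - s)))) \<longlongrightarrow> 0 + (\<Sum>i<m. DU (Z s) i * Z' i)) (at s within S)"
    by (intro tendsto_add R0 tendsto_sum tendsto_mult tendsto_const dq) auto
  moreover have "R t / (t - s) + (\<Sum>i<m. DU (Z s) i * (h t i / (t - s))) = (U (Z t) - U (Z s)) / (t - s)" for t
    by (simp add: R_def diff_divide_distrib sum_divide_distrib)
  ultimately show ?thesis by (simp add: has_field_derivative_iff)
qed

section \<open>Measurability of cylinder functions and their gradients\<close>

lemma Rm_borel: "Rm m \<in> sets borel"
proof -
  have "Measurable.pred borel (\<lambda>x :: nat \<Rightarrow> real. \<forall>i\<in>{m..}. x i = 0)"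
  proof (rule pred_intros_countable_bounded(3)[where X = "{m..}"])
    fix i assume "i \<in> {m..}"
    have [measurable]: "(\<lambda>x :: nat \<Rightarrow> real. x i) \<in> borel_measurable borel"
      by (intro borel_measurable_continuous_onI) simp
    show "Measurable.pred borel (\<lambda>x :: nat \<Rightarrow> real. x i = 0)" by measurable
  qed
  then have "{x \<in> space borel. \<forall>i\<in>{m..}. x i = 0} \<in> sets (borel :: (nat \<Rightarrow> real) measure)" by (rule predE)
  then show ?thesis by (simp add: Rm_def Ball_def)
qed

text \<open>Links the product topology, which defines the Borel sets of sequences, with the
  Euclidean norm used in \<open>C1_Rm\<close>: that norm involves finitely many coordinates, each of
  them continuous.\<close>

lemma eventually_near_Rm:
  fixes x :: "nat \<Rightarrow> real"
  assumes "0 < d"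
  shows "\<forall>\<^sub>F y in at x within S. sqrt (\<Sum>i<m. (y i - x i)\<^sup>2) < (d :: real)"
proof -
  have c: "((\<lambda>y :: nat \<Rightarrow> real. y i) \<longlongrightarrow> x i) (at x within S)" for i
    using continuous_on_product_coordinates[of i] unfolding continuous_on_def
    by (blast intro: tendsto_within_subset)
  have "((\<lambda>y. sqrt (\<Sum>i<m. (y i - x i)\<^sup>2)) \<longlongrightarrow> sqrt (\<Sum>i<m. (x i - x i)\<^sup>2)) (at x within S)"
    by (intro tendsto_intros c)
  then show ?thesis using assms by (intro order_tendstoD(2)[where y = 0]) auto
qed

lemma C1_Rm_continuous:
  assumes "C1_Rm m U DU"
  shows "continuous_on (Rm m) U"
  unfolding continuous_on_def
proof
  fix x assume x: "x \<in> Rm m"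
  have ev: "\<forall>\<^sub>F y in at x within Rm m. y \<in> Rm m" by (simp add: eventually_at_filter)
  have c: "((\<lambda>y :: nat \<Rightarrow> real. y i) \<longlongrightarrow> x i) (at x within Rm m)" for i
    using continuous_on_product_coordinates[of i] unfolding continuous_on_def
    by (blast intro: tendsto_within_subset)
  obtain d where d: "d > 0" "\<And>k. k \<in> Rm m \<Longrightarrow> sqrt (\<Sum>i<m. (k i)\<^sup>2) < d \<Longrightarrow>
      \<bar>U (\<lambda>i. x i + k i) - U x - (\<Sum>i<m. DU x i * k i)\<bar> \<le> 1 * sqrt (\<Sum>i<m. (k i)\<^sup>2)"
    using assms x unfolding C1_Rm_def by (meson zero_less_one)
  have "((\<lambda>y. U y - U x) \<longlongrightarrow> 0) (at x within Rm m)"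
  proof (rule Lim_null_comparison)
    show "\<forall>\<^sub>F y in at x within Rm m. norm (U y - U x)
        \<le> \<bar>\<Sum>i<m. DU x i * (y i - x i)\<bar> + sqrt (\<Sum>i<m. (y i - x i)\<^sup>2)"
      using eventually_near_Rm[OF d(1), where x = x and m = m and S = "Rm m"] ev
    proof eventually_elim
      case (elim y)
      then have "(\<lambda>i. y i - x i) \<in> Rm m" using x by (auto simp: Rm_def)
      from d(2)[OF this] elim(1) show ?case by simp
    qed
    have "((\<lambda>y. \<bar>\<Sum>i<m. DU x i * (y i - x i)\<bar> + sqrt (\<Sum>i<m. (y i - x i)\<^sup>2))
        \<longlongrightarrow> \<bar>\<Sum>i<m. DU x i * (x i - x i)\<bar> + sqrt (\<Sum>i<m. (x i - x i)\<^sup>2)) (at x within Rm m)"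
      by (intro tendsto_intros c)
    then show "((\<lambda>y. \<bar>\<Sum>i<m. DU x i * (y i - x i)\<bar> + sqrt (\<Sum>i<m. (y i - x i)\<^sup>2)) \<longlongrightarrow> 0) (at x within Rm m)"
      by simp
  qed
  then show "(U \<longlongrightarrow> U x) (at x within Rm m)" by (rule LIM_zero_cancel)
qed

lemma C1_Rm_continuous_gradient:
  assumes "C1_Rm m U DU" "i < m"
  shows "continuous_on (Rm m) (\<lambda>x. DU x i)"
  unfolding continuous_on_def
proof (intro ballI tendstoI)
  fix x and e :: real assume x: "x \<in> Rm m" and "0 < e"
  then obtain d where d: "d > 0" "\<And>y. y \<in> Rm m \<Longrightarrow> sqrt (\<Sum>i<m. (y i - x i)\<^sup>2) < d \<Longrightarrow> \<bar>DU y i - DU x i\<bar> < e"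
    using assms unfolding C1_Rm_def by meson
  have ev: "\<forall>\<^sub>F y in at x within Rm m. y \<in> Rm m" by (simp add: eventually_at_filter)
  show "\<forall>\<^sub>F y in at x within Rm m. dist (DU y i) (DU x i) < e"
    using eventually_near_Rm[OF d(1), where x = x and m = m and S = "Rm m"] ev
    by eventually_elim (use d(2) in \<open>auto simp: dist_real_def\<close>)
qed

context dirichlet_process
begin

lemma compose_eval_measurable:
  assumes "continuous_on {0..1} \<phi>"
  shows "(\<lambda>(g, r). \<phi> (g r) :: real) \<in> borel_measurable (Q \<Otimes>\<^sub>M lborel)"
proof -
  obtain \<psi> B where [measurable]: "\<psi> \<in> borel_measurable borel" and \<psi>: "\<And>y. y \<in> {0..1} \<Longrightarrow> \<psi> y = \<phi> y"
    by (rule continuous_unit_extension[OF assms]) blast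
  have "(\<lambda>(g, r). \<psi> (g r)) \<in> borel_measurable (Q \<Otimes>\<^sub>M lborel)"
    using measurable_compose[OF joint_eval_measurable \<open>\<psi> \<in> borel_measurable borel\<close>] by (simp add: case_prod_beta')
  moreover have "(\<lambda>(g, r). \<psi> (g r)) \<in> borel_measurable (Q \<Otimes>\<^sub>M lborel)
      \<longleftrightarrow> (\<lambda>(g, r). \<phi> (g r)) \<in> borel_measurable (Q \<Otimes>\<^sub>M lborel)"
    by (rule measurable_cong) (auto simp: space_pair_measure \<psi> G0_range)
  ultimately show ?thesis by simp
qed

lemma Z1_vec_measurable:
  assumes "C1_01 m \<alpha> \<alpha>'"
  shows "(\<lambda>g. Z1_vec m \<alpha> g) \<in> borel_measurable Q"
proof (rule measurable_coordinatewise_then_product)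
  fix i
  show "(\<lambda>g. Z1_vec m \<alpha> g i) \<in> borel_measurable Q"
  proof (cases "i < m")
    case True
    have c: "continuous_on {0..1} (\<alpha> i)"
      using assms True unfolding C1_01_def by (meson DERIV_continuous continuous_on_eq_continuous_within)
    obtain \<psi> B where \<psi>: "\<psi> \<in> borel_measurable borel" "\<And>y. y \<in> {0..1} \<Longrightarrow> \<psi> y = \<alpha> i y"
      "\<And>y. y \<in> {0..1} \<Longrightarrow> \<bar>\<alpha> i y\<bar> \<le> B" by (rule continuous_unit_extension[OF c]) blast
    have eq: "Z1_vec m \<alpha> g i = (\<integral>r. indicator {0..1} r *\<^sub>R \<alpha> i (g r) \<partial>lborel)" if g: "g \<in> G0" for g
    proof -
      have "(\<lambda>r. \<alpha> i (g r)) = (\<lambda>r. \<psi> (g r))" using \<psi>(2) G0_range[OF g] by auto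
      then have "(\<lambda>r. \<alpha> i (g r)) \<in> borel_measurable borel"
        using measurable_compose[OF G0_borel[OF g] \<psi>(1)] by simp
      from unit_lebesgue_integral(2)[OF this, of B] show ?thesis
        using True \<psi>(3) G0_range[OF g] by (simp add: Z1_vec_def integral_restrict_space)
    qed
    have "(\<lambda>(g, r). indicator {0..1} r *\<^sub>R \<alpha> i (g r)) \<in> borel_measurable (Q \<Otimes>\<^sub>M lborel)"
      using compose_eval_measurable[OF c] by (simp add: case_prod_beta')
    then have "(\<lambda>g. \<integral>r. indicator {0..1} r *\<^sub>R \<alpha> i (g r) \<partial>lborel) \<in> borel_measurable Q"
      by (rule lborel.borel_measurable_lebesgue_integral)
    also have "?this \<longleftrightarrow> ?thesis" using eq by (intro measurable_cong) auto
    finally show ?thesis .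
  next
    case False
    then show ?thesis by (simp add: Z1_vec_def)
  qed
qed

text \<open>\<open>U\<close> and its partial derivatives are controlled on \<open>Rm m\<close> only.
  Multiplying by the indicator of this Borel set gives a Borel function of all sequences, with the
  same values at the vectors \<open>Z1_vec m \<alpha> g\<close>.\<close>

lemma Rm_function_measurable:
  fixes f :: "(nat \<Rightarrow> real) \<Rightarrow> real"
  assumes "continuous_on (Rm m) f" "C1_01 m \<alpha> \<alpha>'"
  shows "(\<lambda>g. f (Z1_vec m \<alpha> g)) \<in> borel_measurable Q"
proof -
  have "(\<lambda>x. indicator (Rm m) x *\<^sub>R f x) \<in> borel_measurable borel"
    by (rule borel_measurable_continuous_on_indicator[OF Rm_borel assms(1)])
  from measurable_compose[OF Z1_vec_measurable[OF assms(2)] this] show ?thesis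
    by (simp add: Rm_def Z1_vec_def)
qed

lemma Z1_fun_measurable:
  assumes "C1_Rm m U DU" "C1_01 m \<alpha> \<alpha>'"
  shows "Z1_fun m U \<alpha> \<in> borel_measurable Q"
  unfolding Z1_fun_def[abs_def] by (rule Rm_function_measurable[OF C1_Rm_continuous[OF assms(1)] assms(2)])

lemma Z1_grad_measurable:
  assumes "C1_Rm m U DU" "C1_01 m \<alpha> \<alpha>'"
  shows "(\<lambda>(g, r). Z1_grad m DU \<alpha> \<alpha>' g r) \<in> borel_measurable (Q \<Otimes>\<^sub>M lborel)"
  unfolding Z1_grad_def case_prod_beta'
proof (rule borel_measurable_sum)
  fix i assume "i \<in> {..<m}"
  then have i: "i < m" by simp
  have "(\<lambda>p. \<alpha>' i (fst p (snd p))) \<in> borel_measurable (Q \<Otimes>\<^sub>M lborel)"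
    using compose_eval_measurable[of "\<alpha>' i"] assms(2) i by (simp add: C1_01_def case_prod_beta')
  moreover have "(\<lambda>p. DU (Z1_vec m \<alpha> (fst p)) i) \<in> borel_measurable (Q \<Otimes>\<^sub>M (lborel :: real measure))"
    by (rule measurable_compose[OF measurable_fst Rm_function_measurable[OF C1_Rm_continuous_gradient[OF assms(1) i] assms(2)]])
  ultimately show "(\<lambda>p. DU (Z1_vec m \<alpha> (fst p)) i * \<alpha>' i (fst p (snd p))) \<in> borel_measurable (Q \<Otimes>\<^sub>M lborel)"
    by simp
qed

end

context shifted_process
begin

text \<open>The velocity is the difference of two elements of \<open>G0\<close>, the moved map at
  time 1 and the map itself, whose values lie in [0,1].\<close>

lemma field_borel:
  assumes "g \<in> G0" "inbox (grid_vals K g)"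
  shows "field g \<in> borel_measurable borel" "\<bar>field g r\<bar> \<le> 1"
proof -
  have eq: "field g = (\<lambda>r. shift 1 g r - g r)" using assms by (auto simp: shift_def)
  show "field g \<in> borel_measurable borel"
    unfolding eq using G0_borel[OF assms(1)] G0_borel[OF shift_in_G0[OF assms(1)]] by simp
  show "\<bar>field g r\<bar> \<le> 1"
    unfolding eq using G0_range[OF assms(1), of r] G0_range[OF shift_in_G0[OF assms(1)], of 1 r] by auto
qed

text \<open>The directional derivative along the segment: the gradient at the moved map paired with
  the velocity \<open>field g\<close>, which does not depend on \<open>s\<close> because the path is
  straight.\<close>

lemma Z1_derivative_along_shift:
  assumes U: "C1_Rm m U DU" and \<alpha>: "C1_01 m \<alpha> \<alpha>'" and g: "g \<in> G0" "inbox (grid_vals K g)" and s: "s \<in> {0..1}"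
  shows "((\<lambda>s. Z1_fun m U \<alpha> (shift s g)) has_real_derivative
    (\<integral>r. Z1_grad m DU \<alpha> \<alpha>' (shift s g) r * field g r \<partial>unit_lebesgue)) (at s within {0..1})"
proof -
  have sh: "shift t g = (\<lambda>r. g r + t * field g r)" if "t \<in> {0..1}" for t using g that by (auto simp: shift_def)
  have in01: "g r + t * field g r \<in> {0..1}" if "t \<in> {0..1}" for t r
    using G0_range[OF shift_in_G0[OF g(1)], of t r] sh[OF that] by auto
  define Z where "Z t i = (if i < m then integral {0..1} (\<lambda>r. \<alpha> i (g r + t * field g r)) else 0)" for t i
  define Z' where "Z' i = (\<integral>r. \<alpha>' i (g r + s * field g r) * field g r \<partial>unit_lebesgue)" for i
  have "((\<lambda>t. U (Z t)) has_real_derivative (\<Sum>i<m. DU (Z s) i * Z' i)) (at s within {0..1})"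
  proof (rule C1_Rm_chain[OF U])
    fix i assume i: "i < m"
    have "((\<lambda>t. integral {0..1} (\<lambda>r. \<alpha> i (g r + t * field g r))) has_real_derivative Z' i) (at s within {0..1})"
      unfolding Z'_def
      by (rule has_derivative_integral_along_path[OF _ _ G0_borel[OF g(1)] field_borel[OF g] in01 s])
        (use \<alpha> i in \<open>auto simp: C1_01_def\<close>)
    then show "((\<lambda>t. Z t i) has_real_derivative Z' i) (at s within {0..1})" using i by (simp add: Z_def)
  qed (simp add: Rm_def Z_def)
  moreover have "U (Z t) = Z1_fun m U \<alpha> (shift t g)" if "t \<in> {0..1}" for t
    unfolding Z1_fun_def Z1_vec_def Z_def[abs_def] sh[OF that] ..
  moreover have "(\<Sum>i<m. DU (Z s) i * Z' i) = (\<integral>r. Z1_grad m DU \<alpha> \<alpha>' (shift s g) r * field g r \<partial>unit_lebesgue)"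
  proof -
    have zs: "Z1_vec m \<alpha> (shift s g) = Z s" unfolding Z1_vec_def Z_def sh[OF s] ..
    have int: "integrable unit_lebesgue (\<lambda>r. DU (Z s) i * (\<alpha>' i (g r + s * field g r) * field g r))" if i: "i < m" for i
    proof -
      have "continuous_on {0..1} (\<alpha>' i)" using \<alpha> i by (auto simp: C1_01_def)
      then obtain \<psi> B where \<psi>: "\<psi> \<in> borel_measurable borel" "\<And>y. y \<in> {0..1} \<Longrightarrow> \<psi> y = \<alpha>' i y"
        "\<And>y. y \<in> {0..1} \<Longrightarrow> \<bar>\<alpha>' i y\<bar> \<le> B" by (rule continuous_unit_extension) blast
      note [measurable] = \<psi>(1) G0_borel[OF g(1)] field_borel(1)[OF g]
      have "(\<lambda>r. \<alpha>' i (g r + s * field g r) * field g r) = (\<lambda>r. \<psi> (g r + s * field g r) * field g r)"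
        using \<psi>(2) in01[OF s] by auto
      then have m: "(\<lambda>r. \<alpha>' i (g r + s * field g r) * field g r) \<in> borel_measurable borel" by simp
      have "\<bar>\<alpha>' i (g r + s * field g r) * field g r\<bar> \<le> B * 1" for r
        unfolding abs_mult using \<psi>(3)[OF in01[OF s]] field_borel(2)[OF g, of r]
        by (intro mult_mono) (auto intro: order_trans[OF abs_ge_zero])
      from unit_lebesgue_integral(1)[OF m this] show ?thesis by simp
    qed
    show ?thesis
      unfolding Z1_grad_def zs sum_distrib_right
      by (subst Bochner_Integration.integral_sum)
        (use int in \<open>auto simp: Z'_def sh[OF s] mult.assoc\<close>)
  qed
  ultimately have "((\<lambda>t. U (Z t)) has_real_derivative
      (\<integral>r. Z1_grad m DU \<alpha> \<alpha>' (shift s g) r * field g r \<partial>unit_lebesgue)) (at s within {0..1})"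
    and eq: "\<And>t. t \<in> {0..1} \<Longrightarrow> Z1_fun m U \<alpha> (shift t g) = U (Z t)"
    by simp_all
  then show ?thesis
    unfolding has_field_derivative_def by (intro has_derivative_transform[OF s eq])
qed

end

section \<open>The energy estimate\<close>

text \<open>The fundamental theorem of calculus yields a gauge integral. If the integral of the
  absolute value is finite, it coincides with the Lebesgue integral; otherwise the bound is
  trivial.\<close>

lemma has_integral_abs_le_nn_integral:
  fixes f :: "real \<Rightarrow> real"
  assumes "(f has_integral I) {0..1}" "f \<in> borel_measurable unit_lebesgue"
  shows "ennreal \<bar>I\<bar> \<le> (\<integral>\<^sup>+ s. ennreal \<bar>f s\<bar> \<partial>unit_lebesgue)"
proof (cases "(\<integral>\<^sup>+ s. ennreal \<bar>f s\<bar> \<partial>unit_lebesgue) < \<infinity>")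
  case True
  then have i: "integrable unit_lebesgue f" using assms(2) by (intro integrableI_bounded) auto
  then have s: "set_integrable lborel {0..1} f"
    by (simp add: integrable_restrict_space set_integrable_def)
  have "(\<integral>r. f r \<partial>unit_lebesgue) = (LINT r:{0..1}|lborel. f r)"
    by (simp add: integral_restrict_space set_lebesgue_integral_def)
  also have "\<dots> = integral {0..1} f" by (rule set_borel_integral_eq_integral(2)[OF s])
  also have "\<dots> = I" using assms(1) by (rule integral_unique)
  finally show ?thesis using integral_norm_bound_ennreal[OF i] by simp
next
  case False
  then show ?thesis by (simp add: not_less top_unique)
qed

lemma L2dist_square:
  assumes "g \<in> G0" "h \<in> G0"
  shows "integrable unit_lebesgue (\<lambda>r. (g r - h r)\<^sup>2)" "(L2dist g h)\<^sup>2 = (\<integral>r. (g r - h r)\<^sup>2 \<partial>unit_lebesgue)"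
    "L2dist g h = sqrt (\<integral>r. (g r - h r)\<^sup>2 \<partial>unit_lebesgue)"
proof -
  note [measurable] = G0_borel[OF assms(1)] G0_borel[OF assms(2)]
  have m: "(\<lambda>r. (g r - h r)\<^sup>2) \<in> borel_measurable borel" by measurable
  have "\<bar>(g r - h r)\<^sup>2\<bar> \<le> 1" for r
    using G0_range[OF assms(1), of r] G0_range[OF assms(2), of r] by (simp add: abs_square_le_1)
  note i = unit_lebesgue_integral[OF m this]
  show "integrable unit_lebesgue (\<lambda>r. (g r - h r)\<^sup>2)" using i(1) .
  show "L2dist g h = sqrt (\<integral>r. (g r - h r)\<^sup>2 \<partial>unit_lebesgue)" by (simp only: L2dist_def i(2))
  then show "(L2dist g h)\<^sup>2 = (\<integral>r. (g r - h r)\<^sup>2 \<partial>unit_lebesgue)" by simp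
qed

lemma L2dist_nonneg:
  assumes "g \<in> G0" "h \<in> G0"
  shows "0 \<le> L2dist g h"
  unfolding L2dist_square(3)[OF assms] by (intro real_sqrt_ge_zero integral_nonneg) simp

lemma L2dist_le_1:
  assumes "g \<in> G0" "h \<in> G0"
  shows "L2dist g h \<le> 1"
proof -
  have "(\<integral>r. (g r - h r)\<^sup>2 \<partial>unit_lebesgue) \<le> (\<integral>r. 1 \<partial>unit_lebesgue)"
  proof (rule integral_mono)
    fix r
    show "(g r - h r)\<^sup>2 \<le> 1"
      using G0_range[OF assms(1), of r] G0_range[OF assms(2), of r] by (simp add: abs_square_le_1)
  qed (use L2dist_square(1)[OF assms] in auto)
  then show ?thesis using unit_lebesgue.prob_space by (simp add: L2dist_square(3)[OF assms])
qed

lemma measurable_pair_unit_lebesgue: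
  assumes "f \<in> borel_measurable (M \<Otimes>\<^sub>M lborel)"
  shows "f \<in> borel_measurable (M \<Otimes>\<^sub>M unit_lebesgue)"
proof -
  have "(\<lambda>p. (fst p, snd p)) \<in> measurable (M \<Otimes>\<^sub>M unit_lebesgue) (M \<Otimes>\<^sub>M lborel)"
    by (intro measurable_Pair measurable_fst measurable_compose[OF measurable_snd] measurable_restrict_space1) simp
  from measurable_compose[OF this assms] show ?thesis by simp
qed

section \<open>Domination of the moved law by Q, and the energy along a segment\<close>

context shifted_process
begin

definition weight :: "(real \<Rightarrow> real) \<Rightarrow> ennreal"
  where "weight g = (if inbox (grid_vals K g) then ennreal (fill_weight \<beta> K (grid_vals K g)) else 0)"

definition weight_bound :: ennreal
  where "weight_bound = ennreal ((max 1 (c powr (1 - \<beta> / real K))) ^ K)"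

lemma measurable_weight [measurable]: "weight \<in> borel_measurable Q"
  unfolding weight_def[abs_def] by measurable

text \<open>Here \<open>g\<close> plays the role of a map already moved for time \<open>s\<close>:
  its grid values translated back lie in the box, so \<open>gap_shift\<close> bounds its own
  increments from below.\<close>

lemma fill_weight_le:
  assumes g: "g \<in> G0" and B: "inbox (\<lambda>i. grid_vals K g i - s * v i)" and s: "0 \<le> s" "s \<le> 1"
  shows "ennreal (fill_weight \<beta> K (grid_vals K g)) \<le> weight_bound"
  unfolding weight_bound_def
proof (intro ennreal_leI fill_weight_bound[OF \<beta>_pos])
  fix i assume i: "i < K"
  show "c \<le> grid_vals K g (Suc i) - grid_vals K g i"
    using gap_shift[OF _ _ B i s] grid_vals_ends[OF g K] v by simp
  show "grid_vals K g (Suc i) - grid_vals K g i \<le> 1"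
    using G0_range[OF g, of "real (Suc i) / real K"] G0_range[OF g, of "real i / real K"]
      G0_range(2)[OF g, of "1 / real K"] by (simp add: grid_vals_def)
qed

text \<open>Exact invariance is weakened to domination: for every \<open>s\<close>, the image of the
  weighted law under \<open>shift s\<close> is at most \<open>weight_bound\<close> times Q. The
  constant does not depend on \<open>s\<close>, so convergence in mean under Q passes to the moved
  maps.\<close>

lemma nn_integral_shift_le:
  assumes s: "0 \<le> s" "s \<le> 1" and f [measurable]: "f \<in> borel_measurable Q"
  shows "(\<integral>\<^sup>+ g. weight g * f (shift s g) \<partial>Q) \<le> weight_bound * (\<integral>\<^sup>+ g. f g \<partial>Q)"
proof -
  have "(\<integral>\<^sup>+ g. weight g * f (shift s g) \<partial>Q)
      = (\<integral>\<^sup>+ g. (if inbox (grid_vals K g) then ennreal (fill_weight \<beta> K (grid_vals K g)) * f (shift s g) else 0) \<partial>Q)"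
    by (intro nn_integral_cong) (simp add: weight_def)
  also have "\<dots> = (\<integral>\<^sup>+ g. (if inbox (\<lambda>i. grid_vals K g i - s * v i) then ennreal (fill_weight \<beta> K (grid_vals K g)) * f g else 0) \<partial>Q)"
    by (rule nn_integral_shift[OF s f])
  also have "\<dots> \<le> (\<integral>\<^sup>+ g. weight_bound * f g \<partial>Q)"
    using fill_weight_le[OF _ _ s] by (intro nn_integral_mono) (auto intro!: mult_right_mono)
  also have "\<dots> = weight_bound * (\<integral>\<^sup>+ g. f g \<partial>Q)" by (rule nn_integral_cmult) measurable
  finally show ?thesis .
qed

lemma shift_0: "shift 0 g = g"
  by (simp add: shift_def)

lemma nn_integral_weight_le:
  assumes [measurable]: "f \<in> borel_measurable Q"
  shows "(\<integral>\<^sup>+ g. weight g * f g \<partial>Q) \<le> weight_bound * (\<integral>\<^sup>+ g. f g \<partial>Q)"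
  using nn_integral_shift_le[of 0 f] by (simp add: shift_0)

text \<open>The bound at a fixed time is uniform in time, so exchanging the integrals and averaging
  over the segment costs nothing.\<close>

lemma nn_integral_shift_path_le:
  assumes f [measurable]: "f \<in> borel_measurable Q"
  shows "(\<integral>\<^sup>+ g. weight g * (\<integral>\<^sup>+ s. f (shift s g) \<partial>unit_lebesgue) \<partial>Q) \<le> weight_bound * (\<integral>\<^sup>+ g. f g \<partial>Q)"
proof -
  interpret P: pair_sigma_finite Q unit_lebesgue by standard
  have sh: "(\<lambda>p. shift (snd p) (fst p)) \<in> measurable (Q \<Otimes>\<^sub>M unit_lebesgue) Q"
  proof -
    have "(\<lambda>p. (snd p, fst p)) \<in> measurable (Q \<Otimes>\<^sub>M unit_lebesgue) (borel \<Otimes>\<^sub>M Q)"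
      by (intro measurable_Pair measurable_fst measurable_compose[OF measurable_snd] measurable_restrict_space1) simp
    from measurable_compose[OF this shift_measurable_pair] show ?thesis by simp
  qed
  have m: "(\<lambda>(g, s). weight g * f (shift s g)) \<in> borel_measurable (Q \<Otimes>\<^sub>M unit_lebesgue)"
    unfolding case_prod_beta'
    by (intro borel_measurable_times_ennreal measurable_compose[OF measurable_fst measurable_weight] measurable_compose[OF sh f])
  have "(\<integral>\<^sup>+ g. weight g * (\<integral>\<^sup>+ s. f (shift s g) \<partial>unit_lebesgue) \<partial>Q)
      = (\<integral>\<^sup>+ g. (\<integral>\<^sup>+ s. weight g * f (shift s g) \<partial>unit_lebesgue) \<partial>Q)"
  proof (intro nn_integral_cong nn_integral_cmult[symmetric])
    fix g assume "g \<in> space Q"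
    from measurable_compose[OF measurable_Pair1'[OF this] measurable_compose[OF sh f]]
    show "(\<lambda>s. f (shift s g)) \<in> borel_measurable unit_lebesgue" by simp
  qed
  also have "\<dots> = (\<integral>\<^sup>+ s. (\<integral>\<^sup>+ g. weight g * f (shift s g) \<partial>Q) \<partial>unit_lebesgue)"
    by (rule P.Fubini'[OF m, symmetric])
  also have "\<dots> \<le> (\<integral>\<^sup>+ s. weight_bound * (\<integral>\<^sup>+ g. f g \<partial>Q) \<partial>unit_lebesgue)"
    by (intro nn_integral_mono nn_integral_shift_le) (auto simp: space_restrict_space)
  also have "\<dots> = weight_bound * (\<integral>\<^sup>+ g. f g \<partial>Q)"
    using unit_lebesgue.emeasure_space_1 by simp
  finally show ?thesis .
qed

text \<open>Young's inequality with parameter \<theta> replaces Cauchy-Schwarz. It keeps the bound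
  linear in the energy \<open>N\<close>, so that the energy can be split and integrated against Q,
  and it avoids dividing by the distance, which may be 0. For energy at most 1 the bound is half the
  sum of \<theta> and the distance, which is the distance itself as \<theta> decreases to
  it.\<close>

lemma Z1_increment_bound:
  assumes U: "C1_Rm m U DU" and \<alpha>: "C1_01 m \<alpha> \<alpha>'" and g: "g \<in> G0" "inbox (grid_vals K g)"
    and \<theta>: "0 < \<theta>" "L2dist (shift 1 g) g \<le> \<theta>"
  defines "N \<equiv> \<lambda>h. \<integral>\<^sup>+ r. ennreal ((Z1_grad m DU \<alpha> \<alpha>' h r)\<^sup>2) \<partial>unit_lebesgue"
  shows "ennreal \<bar>Z1_fun m U \<alpha> (shift 1 g) - Z1_fun m U \<alpha> g\<bar>
    \<le> ennreal (\<theta> / 2) * (\<integral>\<^sup>+ s. N (shift s g) \<partial>unit_lebesgue) + ennreal (L2dist (shift 1 g) g / 2)"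
proof -
  define D where "D s r = Z1_grad m DU \<alpha> \<alpha>' (shift s g) r" for s r
  define f' where "f' s = (\<integral>r. D s r * field g r \<partial>unit_lebesgue)" for s
  define l where "l = L2dist (shift 1 g) g"
  have l: "0 \<le> l" unfolding l_def by (intro L2dist_nonneg shift_in_G0 g)
  have sg: "g \<in> space Q" using g by simp
  have "(\<lambda>p. (shift (fst p) g, snd p)) \<in> measurable (unit_lebesgue \<Otimes>\<^sub>M unit_lebesgue) (Q \<Otimes>\<^sub>M unit_lebesgue)"
  proof (intro measurable_Pair measurable_snd)
    have "(\<lambda>s. shift s g) \<in> measurable unit_lebesgue Q"
      using measurable_compose[OF measurable_Pair2'[OF sg] shift_measurable_pair]
      by (intro measurable_restrict_space1) (simp cong: measurable_cong_sets)
    then show "(\<lambda>p. shift (fst p) g) \<in> measurable (unit_lebesgue \<Otimes>\<^sub>M unit_lebesgue) Q"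
      by (rule measurable_compose[OF measurable_fst])
  qed
  from measurable_compose[OF this measurable_pair_unit_lebesgue[OF Z1_grad_measurable[OF U \<alpha>]]]
  have D2: "(\<lambda>(s, r). D s r) \<in> borel_measurable (unit_lebesgue \<Otimes>\<^sub>M unit_lebesgue)"
    by (simp add: D_def case_prod_beta')
  have V: "field g \<in> borel_measurable unit_lebesgue" by (intro measurable_unit_lebesgue field_borel g)
  have D1: "D s \<in> borel_measurable unit_lebesgue" if "s \<in> {0..1}" for s
    using measurable_compose[OF measurable_Pair1'[of s unit_lebesgue unit_lebesgue] D2] that
    by (simp add: space_restrict_space)
  have "(\<lambda>(s, r). D s r * field g r) \<in> borel_measurable (unit_lebesgue \<Otimes>\<^sub>M unit_lebesgue)"
    unfolding case_prod_beta'
    by (rule borel_measurable_times[OF D2[unfolded case_prod_beta'] measurable_compose[OF measurable_snd V]])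
  then have f'm: "f' \<in> borel_measurable unit_lebesgue"
    unfolding f'_def by (rule unit_lebesgue.borel_measurable_lebesgue_integral)
  \<comment> \<open>In gauge form the fundamental theorem needs the derivative at every point, but
    no prior integrability of it.\<close>
  have "(f' has_integral Z1_fun m U \<alpha> (shift 1 g) - Z1_fun m U \<alpha> (shift 0 g)) {0..1}"
    using Z1_derivative_along_shift[OF U \<alpha> g]
    by (intro fundamental_theorem_of_calculus)
      (auto simp: f'_def D_def has_real_derivative_iff_has_vector_derivative[symmetric])
  from has_integral_abs_le_nn_integral[OF this f'm]
  have "ennreal \<bar>Z1_fun m U \<alpha> (shift 1 g) - Z1_fun m U \<alpha> g\<bar> \<le> (\<integral>\<^sup>+ s. ennreal \<bar>f' s\<bar> \<partial>unit_lebesgue)"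
    by (simp add: shift_0)
  also have "\<dots> \<le> (\<integral>\<^sup>+ s. ennreal (\<theta> / 2) * N (shift s g) + ennreal (l / 2) \<partial>unit_lebesgue)"
  proof (rule nn_integral_mono)
    fix s assume "s \<in> space unit_lebesgue"
    then have s: "s \<in> {0..1}" by (simp add: space_restrict_space)
    \<comment> \<open>If the product is not integrable, its integral has the default value 0 and the
      bound is trivial.\<close>
    have "ennreal \<bar>f' s\<bar> \<le> (\<integral>\<^sup>+ r. ennreal \<bar>D s r * field g r\<bar> \<partial>unit_lebesgue)"
    proof (cases "integrable unit_lebesgue (\<lambda>r. D s r * field g r)")
      case True
      then show ?thesis using integral_norm_bound_ennreal[OF True] by (simp add: f'_def)
    qed (simp add: f'_def not_integrable_integral_eq)
    also have "\<dots> \<le> (\<integral>\<^sup>+ r. ennreal (\<theta> / 2) * ennreal ((D s r)\<^sup>2) + ennreal ((field g r)\<^sup>2 / (2 * \<theta>)) \<partial>unit_lebesgue)"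
    proof (rule nn_integral_mono)
      fix r
      have "0 \<le> (\<theta> * \<bar>D s r\<bar> - \<bar>field g r\<bar>)\<^sup>2" by simp
      then have "2 * \<theta> * \<bar>D s r * field g r\<bar> \<le> \<theta>\<^sup>2 * (D s r)\<^sup>2 + (field g r)\<^sup>2"
        by (simp add: power2_diff power_mult_distrib abs_mult mult_ac)
      then have "\<bar>D s r * field g r\<bar> \<le> (\<theta>\<^sup>2 * (D s r)\<^sup>2 + (field g r)\<^sup>2) / (2 * \<theta>)"
        using \<theta>(1) by (simp add: pos_le_divide_eq mult_ac)
      also have "\<dots> = \<theta> / 2 * (D s r)\<^sup>2 + (field g r)\<^sup>2 / (2 * \<theta>)"
        using \<theta>(1) by (simp add: field_simps power2_eq_square)
      finally show "ennreal \<bar>D s r * field g r\<bar> \<le> ennreal (\<theta> / 2) * ennreal ((D s r)\<^sup>2) + ennreal ((field g r)\<^sup>2 / (2 * \<theta>))"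
        using \<theta>(1) by (simp add: ennreal_mult[symmetric] ennreal_plus[symmetric] ennreal_leI del: ennreal_plus)
    qed
    also have "\<dots> = (\<integral>\<^sup>+ r. ennreal (\<theta> / 2) * ennreal ((D s r)\<^sup>2) \<partial>unit_lebesgue)
        + (\<integral>\<^sup>+ r. ennreal ((field g r)\<^sup>2 / (2 * \<theta>)) \<partial>unit_lebesgue)"
      using D1[OF s] V by (intro nn_integral_add) auto
    also have "(\<integral>\<^sup>+ r. ennreal (\<theta> / 2) * ennreal ((D s r)\<^sup>2) \<partial>unit_lebesgue) = ennreal (\<theta> / 2) * N (shift s g)"
      using D1[OF s] unfolding N_def D_def by (intro nn_integral_cmult) auto
    also have "(\<integral>\<^sup>+ r. ennreal ((field g r)\<^sup>2 / (2 * \<theta>)) \<partial>unit_lebesgue) = ennreal (l\<^sup>2 / (2 * \<theta>))"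
    proof -
      have eq: "field g = (\<lambda>r. shift 1 g r - g r)" using g by (auto simp: shift_def)
      have "(\<integral>\<^sup>+ r. ennreal ((field g r)\<^sup>2 / (2 * \<theta>)) \<partial>unit_lebesgue)
          = ennreal (\<integral>r. (field g r)\<^sup>2 / (2 * \<theta>) \<partial>unit_lebesgue)"
        using L2dist_square(1)[OF shift_in_G0[OF g(1)] g(1), of 1] \<theta>(1) unfolding eq
        by (intro nn_integral_eq_integral) auto
      also have "(\<integral>r. (field g r)\<^sup>2 / (2 * \<theta>) \<partial>unit_lebesgue) = l\<^sup>2 / (2 * \<theta>)"
        using L2dist_square(2)[OF shift_in_G0[OF g(1)] g(1), of 1] unfolding eq l_def by simp
      finally show ?thesis .
    qed
    also have "ennreal (l\<^sup>2 / (2 * \<theta>)) \<le> ennreal (l / 2)"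
    proof (rule ennreal_leI)
      have "l * l \<le> l * \<theta>" using l \<theta>(2) by (intro mult_left_mono) (auto simp: l_def)
      then show "l\<^sup>2 / (2 * \<theta>) \<le> l / 2" using \<theta>(1) by (simp add: field_simps power2_eq_square)
    qed
    finally show "ennreal \<bar>f' s\<bar> \<le> ennreal (\<theta> / 2) * N (shift s g) + ennreal (l / 2)"
      by (simp add: add_left_mono)
  qed
  also have "\<dots> = ennreal (\<theta> / 2) * (\<integral>\<^sup>+ s. N (shift s g) \<partial>unit_lebesgue) + ennreal (l / 2)"
  proof -
    have "(\<lambda>s. N (shift s g)) \<in> borel_measurable unit_lebesgue"
      unfolding N_def D_def[symmetric]
      by (rule unit_lebesgue.borel_measurable_nn_integral)
        (use D2 in \<open>simp add: case_prod_beta'\<close>)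
    then show ?thesis
      using unit_lebesgue.emeasure_space_1 by (simp add: nn_integral_add nn_integral_cmult)
  qed
  finally show ?thesis unfolding l_def .
qed

text \<open>From (a + b)^2 \<le> (1 + \<epsilon>) a^2 + (1 + 1/\<epsilon>) b^2 with a the limit
  gradient and b the gradient error. Subtraction in \<open>ennreal\<close> stops at 0, so the left
  side collects only the energy above 1 + \<epsilon>, and it is controlled by the error of the
  gradients.\<close>

lemma excess_energy_bound:
  assumes U: "C1_Rm m U DU" and \<alpha>: "C1_01 m \<alpha> \<alpha>'" and \<epsilon>: "0 < \<epsilon>"
    and F: "(\<lambda>(g, s). F g s) \<in> borel_measurable (Q \<Otimes>\<^sub>M lborel)"
    and \<Gamma>: "AE g in Q. Gamma_uu F g \<le> 1"
  shows "(\<integral>\<^sup>+ g. ((\<integral>\<^sup>+ r. ennreal ((Z1_grad m DU \<alpha> \<alpha>' g r)\<^sup>2) \<partial>unit_lebesgue) - ennreal (1 + \<epsilon>)) \<partial>Q)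
    \<le> ennreal (1 + 1 / \<epsilon>) * (\<integral>\<^sup>+ g. (\<integral>\<^sup>+ s\<in>{0..1}. ennreal ((Z1_grad m DU \<alpha> \<alpha>' g s - F g s)\<^sup>2) \<partial>lborel) \<partial>Q)"
proof -
  define D where "D = Z1_grad m DU \<alpha> \<alpha>'"
  have D: "(\<lambda>(g, r). D g r) \<in> borel_measurable (Q \<Otimes>\<^sub>M unit_lebesgue)"
    unfolding D_def by (rule measurable_pair_unit_lebesgue[OF Z1_grad_measurable[OF U \<alpha>]])
  have F': "(\<lambda>(g, r). F g r) \<in> borel_measurable (Q \<Otimes>\<^sub>M unit_lebesgue)"
    by (rule measurable_pair_unit_lebesgue[OF F])
  have res: "(\<integral>\<^sup>+ s\<in>{0..1}. f s \<partial>lborel) = (\<integral>\<^sup>+ s. f s \<partial>unit_lebesgue)" for f :: "real \<Rightarrow> ennreal"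
    by (simp add: nn_integral_restrict_space)
  have "(\<integral>\<^sup>+ g. ((\<integral>\<^sup>+ r. ennreal ((D g r)\<^sup>2) \<partial>unit_lebesgue) - ennreal (1 + \<epsilon>)) \<partial>Q)
      \<le> (\<integral>\<^sup>+ g. ennreal (1 + 1 / \<epsilon>) * (\<integral>\<^sup>+ r. ennreal ((D g r - F g r)\<^sup>2) \<partial>unit_lebesgue) \<partial>Q)"
  proof (rule nn_integral_mono_AE)
    show "AE g in Q. (\<integral>\<^sup>+ r. ennreal ((D g r)\<^sup>2) \<partial>unit_lebesgue) - ennreal (1 + \<epsilon>)
        \<le> ennreal (1 + 1 / \<epsilon>) * (\<integral>\<^sup>+ r. ennreal ((D g r - F g r)\<^sup>2) \<partial>unit_lebesgue)"
      using \<Gamma> AE_space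
    proof eventually_elim
      case (elim g)
      have Dg: "D g \<in> borel_measurable unit_lebesgue"
        using measurable_compose[OF measurable_Pair1'[OF elim(2)] D] by simp
      have Fg: "F g \<in> borel_measurable unit_lebesgue"
        using measurable_compose[OF measurable_Pair1'[OF elim(2)] F'] by simp
      note [measurable] = Dg Fg
      have "(\<integral>\<^sup>+ r. ennreal ((D g r)\<^sup>2) \<partial>unit_lebesgue)
          \<le> (\<integral>\<^sup>+ r. ennreal (1 + \<epsilon>) * ennreal ((F g r)\<^sup>2) + ennreal (1 + 1 / \<epsilon>) * ennreal ((D g r - F g r)\<^sup>2) \<partial>unit_lebesgue)"
      proof (rule nn_integral_mono)
        fix r
        let ?a = "F g r" and ?b = "D g r - F g r"
        have "0 \<le> (\<epsilon> * ?a - ?b)\<^sup>2 / \<epsilon>" using \<epsilon> by simp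
        also have "(\<epsilon> * ?a - ?b)\<^sup>2 / \<epsilon> = (1 + \<epsilon>) * ?a\<^sup>2 + (1 + 1 / \<epsilon>) * ?b\<^sup>2 - (?a + ?b)\<^sup>2"
          using \<epsilon> by (simp add: field_simps power2_eq_square)
        finally have "(D g r)\<^sup>2 \<le> (1 + \<epsilon>) * ?a\<^sup>2 + (1 + 1 / \<epsilon>) * ?b\<^sup>2" by simp
        then show "ennreal ((D g r)\<^sup>2) \<le> ennreal (1 + \<epsilon>) * ennreal (?a\<^sup>2) + ennreal (1 + 1 / \<epsilon>) * ennreal (?b\<^sup>2)"
          using \<epsilon> by (simp add: ennreal_mult[symmetric] ennreal_plus[symmetric] ennreal_leI del: ennreal_plus)
      qed
      also have "\<dots> = ennreal (1 + \<epsilon>) * (\<integral>\<^sup>+ r. ennreal ((F g r)\<^sup>2) \<partial>unit_lebesgue)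
          + ennreal (1 + 1 / \<epsilon>) * (\<integral>\<^sup>+ r. ennreal ((D g r - F g r)\<^sup>2) \<partial>unit_lebesgue)"
        by (simp add: nn_integral_add nn_integral_cmult)
      also have "\<dots> \<le> ennreal (1 + \<epsilon>) * 1 + ennreal (1 + 1 / \<epsilon>) * (\<integral>\<^sup>+ r. ennreal ((D g r - F g r)\<^sup>2) \<partial>unit_lebesgue)"
        using elim(1) unfolding Gamma_uu_def res by (intro add_mono mult_left_mono) auto
      finally show ?case by (simp add: ennreal_minus_le_iff)
    qed
  qed
  also have "\<dots> = ennreal (1 + 1 / \<epsilon>) * (\<integral>\<^sup>+ g. (\<integral>\<^sup>+ r. ennreal ((D g r - F g r)\<^sup>2) \<partial>unit_lebesgue) \<partial>Q)"
  proof (rule nn_integral_cmult)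
    show "(\<lambda>g. \<integral>\<^sup>+ r. ennreal ((D g r - F g r)\<^sup>2) \<partial>unit_lebesgue) \<in> borel_measurable Q"
      by (rule unit_lebesgue.borel_measurable_nn_integral)
        (use D F' in \<open>simp add: case_prod_beta'\<close>)
  qed
  finally show ?thesis unfolding D_def res .
qed

end

section \<open>From almost every segment to all pairs\<close>

text \<open>Trades a first power for a square at the price of \<epsilon>, so that the L2 errors of
  the approximants can enter an estimate made for each single map.\<close>

lemma abs_le_square_div:
  fixes x \<epsilon> :: real
  assumes "0 < \<epsilon>"
  shows "\<bar>x\<bar> \<le> \<epsilon> + x\<^sup>2 / \<epsilon>"
proof (cases "\<bar>x\<bar> \<le> \<epsilon>")
  case True
  then show ?thesis using assms by (simp add: add_increasing2)
next
  case False
  then have "\<epsilon> * \<bar>x\<bar> \<le> \<bar>x\<bar> * \<bar>x\<bar>" by (intro mult_right_mono) auto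
  then have "\<bar>x\<bar> \<le> x\<^sup>2 / \<epsilon>" using assms by (simp add: pos_le_divide_eq power2_eq_square mult.commute)
  then show ?thesis using assms by simp
qed

context shifted_process
begin

lemma L2dist_shift_measurable [measurable]: "(\<lambda>g. L2dist (shift 1 g) g) \<in> borel_measurable Q"
proof -
  have "(\<lambda>p. (shift 1 (fst p), snd p)) \<in> measurable (Q \<Otimes>\<^sub>M lborel) (Q \<Otimes>\<^sub>M lborel)"
    by (intro measurable_Pair measurable_snd measurable_compose[OF measurable_fst shift_measurable])
  from measurable_compose[OF this joint_eval_measurable]
  have 1: "(\<lambda>p. shift 1 (fst p) (snd p)) \<in> borel_measurable (Q \<Otimes>\<^sub>M unit_lebesgue)"
    by (intro measurable_pair_unit_lebesgue) (simp add: case_prod_beta')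
  have 2: "(\<lambda>p. fst p (snd p)) \<in> borel_measurable (Q \<Otimes>\<^sub>M unit_lebesgue)"
    using measurable_pair_unit_lebesgue[OF joint_eval_measurable] by (simp add: case_prod_beta')
  have "(\<lambda>(g, r). (shift 1 g r - g r)\<^sup>2) \<in> borel_measurable (Q \<Otimes>\<^sub>M unit_lebesgue)"
    unfolding case_prod_beta' by (intro borel_measurable_power borel_measurable_diff 1 2)
  then have "(\<lambda>g. \<integral>r. (shift 1 g r - g r)\<^sup>2 \<partial>unit_lebesgue) \<in> borel_measurable Q"
    by (rule unit_lebesgue.borel_measurable_lebesgue_integral)
  then have "(\<lambda>g. sqrt (\<integral>r. (shift 1 g r - g r)\<^sup>2 \<partial>unit_lebesgue)) \<in> borel_measurable Q" by simp
  also have "?this \<longleftrightarrow> ?thesis"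
    by (intro measurable_cong) (simp add: L2dist_square(3) shift_in_G0)
  finally show ?thesis .
qed

text \<open>\<open>Z1_increment_bound\<close> is applied with \<theta> = l + \<epsilon>, where l is
  the distance. In the allowance 4\<epsilon>, two parts cover the increment of the approximant
  \<open>w\<close>, and one part each the replacement of \<open>w\<close> by \<open>u\<close> at the
  two end points. A negative left side becomes 0 in \<open>ennreal\<close>, so only the excess over
  the allowance is estimated.\<close>

lemma increment_bound:
  assumes U: "C1_Rm m U DU" and \<alpha>: "C1_01 m \<alpha> \<alpha>'" and g: "g \<in> G0" "inbox (grid_vals K g)"
    and \<epsilon>: "0 < \<epsilon>" "\<epsilon> \<le> 1"
  defines "w \<equiv> Z1_fun m U \<alpha>"
    and "e \<equiv> \<lambda>h. (\<integral>\<^sup>+ r. ennreal ((Z1_grad m DU \<alpha> \<alpha>' h r)\<^sup>2) \<partial>unit_lebesgue) - ennreal (1 + \<epsilon>)"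
  shows "ennreal (\<bar>u (shift 1 g) - u g\<bar> - (L2dist (shift 1 g) g + 4 * \<epsilon>))
    \<le> ennreal (1 / \<epsilon>) * ennreal ((w (shift 1 g) - u (shift 1 g))\<^sup>2) + ennreal (1 / \<epsilon>) * ennreal ((w g - u g)\<^sup>2)
      + (\<integral>\<^sup>+ s. e (shift s g) \<partial>unit_lebesgue)"
proof -
  define N where "N h = (\<integral>\<^sup>+ r. ennreal ((Z1_grad m DU \<alpha> \<alpha>' h r)\<^sup>2) \<partial>unit_lebesgue)" for h
  define l where "l = L2dist (shift 1 g) g"
  define E where "E = (\<integral>\<^sup>+ s. e (shift s g) \<partial>unit_lebesgue)"
  have l: "0 \<le> l" "l \<le> 1" unfolding l_def using shift_in_G0[OF g(1)] g(1) by (auto intro: L2dist_nonneg L2dist_le_1)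
  show ?thesis
  proof (cases "E = \<top>")
    case True
    then show ?thesis by (simp add: E_def)
  next
    case False
    then obtain E' where E': "E = ennreal E'" "0 \<le> E'" by (cases E) auto
    have "ennreal \<bar>w (shift 1 g) - w g\<bar> \<le> ennreal ((l + \<epsilon>) / 2) * (\<integral>\<^sup>+ s. N (shift s g) \<partial>unit_lebesgue) + ennreal (l / 2)"
      using Z1_increment_bound[OF U \<alpha> g, of "l + \<epsilon>"] l \<epsilon> by (simp add: w_def N_def l_def)
    also have "(\<integral>\<^sup>+ s. N (shift s g) \<partial>unit_lebesgue) \<le> (\<integral>\<^sup>+ s. ennreal (1 + \<epsilon>) + e (shift s g) \<partial>unit_lebesgue)"
    proof (rule nn_integral_mono)
      fix s
      show "N (shift s g) \<le> ennreal (1 + \<epsilon>) + e (shift s g)"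
        unfolding e_def N_def[symmetric] by (metis ennreal_minus_le_iff order_refl)
    qed
    also have "\<dots> = ennreal (1 + \<epsilon>) + E"
    proof -
      have "(\<lambda>s. e (shift s g)) \<in> borel_measurable unit_lebesgue"
      proof -
        have "(\<lambda>h. e h) \<in> borel_measurable Q"
          unfolding e_def
          by (intro borel_measurable_minus_ennreal borel_measurable_const unit_lebesgue.borel_measurable_nn_integral)
            (use measurable_pair_unit_lebesgue[OF Z1_grad_measurable[OF U \<alpha>]] in \<open>simp add: case_prod_beta'\<close>)
        moreover have "(\<lambda>s. shift s g) \<in> measurable unit_lebesgue Q"
          using measurable_compose[OF measurable_Pair2'[of g Q borel] shift_measurable_pair] g
          by (intro measurable_restrict_space1) (simp cong: measurable_cong_sets)
        ultimately show ?thesis by (rule measurable_compose[rotated])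
      qed
      then show ?thesis using unit_lebesgue.emeasure_space_1 by (simp add: nn_integral_add E_def)
    qed
    finally have "ennreal \<bar>w (shift 1 g) - w g\<bar> \<le> ennreal ((l + \<epsilon>) / 2) * (ennreal (1 + \<epsilon>) + E) + ennreal (l / 2)"
      by (simp add: add_mono mult_left_mono)
    also have "\<dots> = ennreal ((l + \<epsilon>) / 2 * (1 + \<epsilon> + E') + l / 2)"
      using E' l \<epsilon> by (simp add: ennreal_mult[symmetric] ennreal_plus[symmetric] del: ennreal_plus)
    finally have "\<bar>w (shift 1 g) - w g\<bar> \<le> (l + \<epsilon>) / 2 * (1 + \<epsilon> + E') + l / 2"
      by (rule iffD1[OF ennreal_le_iff, rotated]) (use E' l \<epsilon> in auto)
    \<comment> \<open>Both \<open>l\<close> and \<epsilon> are at most 1, so each quadratic term is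
      at most \<epsilon>/2 and the coefficient of \<open>E'\<close> is at most 1.\<close>
    also have "\<dots> \<le> l + 2 * \<epsilon> + E'"
    proof -
      have "(l + \<epsilon>) / 2 * E' \<le> 1 * E'" using l \<epsilon> E' by (intro mult_right_mono) auto
      moreover have "l * \<epsilon> \<le> 1 * \<epsilon>" using l \<epsilon> by (intro mult_right_mono) auto
      moreover have "\<epsilon> * \<epsilon> \<le> 1 * \<epsilon>" using \<epsilon> by (intro mult_right_mono) auto
      moreover have "(l + \<epsilon>) / 2 * (1 + \<epsilon> + E') + l / 2 = l + \<epsilon> / 2 + l * \<epsilon> / 2 + \<epsilon> * \<epsilon> / 2 + (l + \<epsilon>) / 2 * E'"
        by (simp add: field_simps)
      ultimately show ?thesis using \<epsilon> by linarith
    qed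
    finally have w: "\<bar>w (shift 1 g) - w g\<bar> \<le> l + 2 * \<epsilon> + E'" .
    have "\<bar>u (shift 1 g) - u g\<bar> - (l + 4 * \<epsilon>) \<le> 1 / \<epsilon> * (w (shift 1 g) - u (shift 1 g))\<^sup>2 + 1 / \<epsilon> * (w g - u g)\<^sup>2 + E'"
      using w abs_le_square_div[OF \<epsilon>(1), of "w (shift 1 g) - u (shift 1 g)"] abs_le_square_div[OF \<epsilon>(1), of "w g - u g"]
      by (simp add: divide_inverse mult.commute)
    then show ?thesis
      using \<epsilon> E' unfolding l_def[symmetric] E_def[symmetric]
      by (simp add: ennreal_mult[symmetric] ennreal_plus[symmetric] ennreal_leI del: ennreal_plus)
  qed
qed

text \<open>The excess \<open>f\<close> does not depend on \<open>n\<close>, while the bound for its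
  weighted integral tends to 0: the L2 errors at the two end points and the excess energy averaged
  along the segment are all dominated by unmoved integrals. Hence \<open>f\<close> vanishes almost
  everywhere on the box, where the weight is positive.\<close>

proposition AE_increment_le:
  assumes u: "dom_E_grad Q u F" and \<Gamma>: "AE g in Q. Gamma_uu F g \<le> 1" and \<epsilon>: "0 < \<epsilon>" "\<epsilon> \<le> 1"
  shows "AE g in Q. inbox (grid_vals K g) \<longrightarrow> \<bar>u (shift 1 g) - u g\<bar> \<le> L2dist (shift 1 g) g + 4 * \<epsilon>"
proof -
  have um [measurable]: "u \<in> borel_measurable Q" and F: "(\<lambda>(g, s). F g s) \<in> borel_measurable (Q \<Otimes>\<^sub>M lborel)"
    using u by (auto simp: dom_E_grad_def)
  obtain seq where seq: "\<And>n. seq n \<in> Z1_graph"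
    and A0: "(\<lambda>n. \<integral>\<^sup>+ g. ennreal ((fst (seq n) g - u g)\<^sup>2) \<partial>Q) \<longlonglongrightarrow> 0"
    and B0: "(\<lambda>n. \<integral>\<^sup>+ g. (\<integral>\<^sup>+ s\<in>{0..1}. ennreal ((snd (seq n) g s - F g s)\<^sup>2) \<partial>lborel) \<partial>Q) \<longlonglongrightarrow> 0"
    using u unfolding dom_E_grad_def by blast
  define A where "A n = (\<integral>\<^sup>+ g. ennreal ((fst (seq n) g - u g)\<^sup>2) \<partial>Q)" for n
  define B where "B n = (\<integral>\<^sup>+ g. (\<integral>\<^sup>+ s\<in>{0..1}. ennreal ((snd (seq n) g s - F g s)\<^sup>2) \<partial>lborel) \<partial>Q)" for n
  define f where "f g = ennreal (\<bar>u (shift 1 g) - u g\<bar> - (L2dist (shift 1 g) g + 4 * \<epsilon>))" for g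
  have fm [measurable]: "f \<in> borel_measurable Q" unfolding f_def by measurable
  define k where "k = ennreal (1 / \<epsilon>)"
  have bound: "(\<integral>\<^sup>+ g. weight g * f g \<partial>Q)
      \<le> k * (weight_bound * A n) + k * (weight_bound * A n) + weight_bound * (ennreal (1 + 1 / \<epsilon>) * B n)" for n
  proof -
    obtain m U DU \<alpha> \<alpha>' where s: "seq n = (Z1_fun m U \<alpha>, Z1_grad m DU \<alpha> \<alpha>')" and U: "C1_Rm m U DU" and \<alpha>: "C1_01 m \<alpha> \<alpha>'"
      using seq[of n] unfolding Z1_graph_def by auto
    define w where "w = Z1_fun m U \<alpha>"
    define e where "e h = (\<integral>\<^sup>+ r. ennreal ((Z1_grad m DU \<alpha> \<alpha>' h r)\<^sup>2) \<partial>unit_lebesgue) - ennreal (1 + \<epsilon>)" for h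
    have wm [measurable]: "w \<in> borel_measurable Q" unfolding w_def by (rule Z1_fun_measurable[OF U \<alpha>])
    have em [measurable]: "e \<in> borel_measurable Q"
      unfolding e_def
      by (intro borel_measurable_minus_ennreal borel_measurable_const unit_lebesgue.borel_measurable_nn_integral)
        (use measurable_pair_unit_lebesgue[OF Z1_grad_measurable[OF U \<alpha>]] in \<open>simp add: case_prod_beta'\<close>)
    define a where "a g = ennreal ((w g - u g)\<^sup>2)" for g
    have am [measurable]: "a \<in> borel_measurable Q" unfolding a_def by measurable
    define P where "P g = (\<integral>\<^sup>+ s. e (shift s g) \<partial>unit_lebesgue)" for g
    have Pm [measurable]: "P \<in> borel_measurable Q"
      unfolding P_def
    proof (rule unit_lebesgue.borel_measurable_nn_integral)
      have "(\<lambda>p. (snd p, fst p)) \<in> measurable (Q \<Otimes>\<^sub>M unit_lebesgue) (borel \<Otimes>\<^sub>M Q)"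
        by (intro measurable_Pair measurable_fst measurable_compose[OF measurable_snd] measurable_restrict_space1) simp
      from measurable_compose[OF measurable_compose[OF this shift_measurable_pair] em]
      show "(\<lambda>(g, s). e (shift s g)) \<in> borel_measurable (Q \<Otimes>\<^sub>M unit_lebesgue)" by (simp add: case_prod_beta')
    qed
    have "(\<integral>\<^sup>+ g. weight g * f g \<partial>Q) \<le> (\<integral>\<^sup>+ g. k * (weight g * a (shift 1 g)) + k * (weight g * a g) + weight g * P g \<partial>Q)"
    proof (rule nn_integral_mono)
      fix g assume "g \<in> space Q"
      show "weight g * f g \<le> k * (weight g * a (shift 1 g)) + k * (weight g * a g) + weight g * P g"
      proof (cases "inbox (grid_vals K g)")
        case True
        have "f g \<le> k * a (shift 1 g) + k * a g + P g"
          using increment_bound[OF U \<alpha> _ True \<epsilon>, of u] \<open>g \<in> space Q\<close> unfolding f_def k_def a_def P_def e_def w_def by simp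
        then have "weight g * f g \<le> weight g * (k * a (shift 1 g) + k * a g + P g)" by (rule mult_left_mono) simp
        then show ?thesis by (simp add: distrib_left mult.left_commute)
      qed (simp add: weight_def)
    qed
    also have "\<dots> = k * (\<integral>\<^sup>+ g. weight g * a (shift 1 g) \<partial>Q) + k * (\<integral>\<^sup>+ g. weight g * a g \<partial>Q) + (\<integral>\<^sup>+ g. weight g * P g \<partial>Q)"
      by (simp add: nn_integral_add nn_integral_cmult)
    also have "\<dots> \<le> k * (weight_bound * A n) + k * (weight_bound * A n) + weight_bound * (ennreal (1 + 1 / \<epsilon>) * B n)"
    proof (intro add_mono mult_left_mono)
      have An: "A n = (\<integral>\<^sup>+ g. a g \<partial>Q)" by (simp add: A_def a_def s w_def)
      show "(\<integral>\<^sup>+ g. weight g * a (shift 1 g) \<partial>Q) \<le> weight_bound * A n"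
        unfolding An by (intro nn_integral_shift_le) auto
      show "(\<integral>\<^sup>+ g. weight g * a g \<partial>Q) \<le> weight_bound * A n"
        unfolding An by (intro nn_integral_weight_le) auto
      have "(\<integral>\<^sup>+ g. weight g * P g \<partial>Q) \<le> weight_bound * (\<integral>\<^sup>+ g. e g \<partial>Q)"
        unfolding P_def by (rule nn_integral_shift_path_le[OF em])
      also have "\<dots> \<le> weight_bound * (ennreal (1 + 1 / \<epsilon>) * B n)"
        using excess_energy_bound[OF U \<alpha> \<epsilon>(1) F \<Gamma>] by (intro mult_left_mono) (auto simp: e_def B_def s)
      finally show "(\<integral>\<^sup>+ g. weight g * P g \<partial>Q) \<le> weight_bound * (ennreal (1 + 1 / \<epsilon>) * B n)" .
    qed simp_all
    finally show ?thesis .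
  qed
  have "(\<lambda>n. k * (weight_bound * A n) + k * (weight_bound * A n) + weight_bound * (ennreal (1 + 1 / \<epsilon>) * B n))
      \<longlonglongrightarrow> k * (weight_bound * 0) + k * (weight_bound * 0) + weight_bound * (ennreal (1 + 1 / \<epsilon>) * 0)"
    using A0 B0 unfolding A_def[symmetric] B_def[symmetric]
    by (intro tendsto_add ennreal_tendsto_cmult) (auto simp: k_def weight_bound_def)
  from LIMSEQ_le_const[OF this] bound have "(\<integral>\<^sup>+ g. weight g * f g \<partial>Q) \<le> 0" by auto
  then have "AE g in Q. weight g * f g = 0" by (simp add: nn_integral_0_iff_AE)
  then show ?thesis
    using AE_space
  proof eventually_elim
    case (elim g)
    show ?case
    proof
      assume B: "inbox (grid_vals K g)"
      have "0 < fill_weight \<beta> K (grid_vals K g)"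
        unfolding fill_weight_def
      proof (rule prod_pos)
        fix i assume "i \<in> {..<K}"
        then have "c \<le> grid_vals K g (Suc i) - grid_vals K g i"
          using gap_shift[OF grid_vals_ends[OF _ K] B, of i 0] elim(2) by simp
        then show "0 < (grid_vals K g (Suc i) - grid_vals K g i) powr (1 - \<beta> / real K)" using c by simp
      qed
      then have "f g = 0" using elim(1) B by (simp add: weight_def)
      then show "\<bar>u (shift 1 g) - u g\<bar> \<le> L2dist (shift 1 g) g + 4 * \<epsilon>" by (simp add: f_def ennreal_eq_0_iff)
    qed
  qed
qed

text \<open>The density of the grid values is positive on the box, since all increments there are at
  least \<open>c\<close>, and the box has Lebesgue measure (2\<delta>)^(K-1), which is 1 for K =
  1.\<close>

lemma not_AE_outside_box:
  assumes "0 < \<delta>"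
  shows "\<not> (AE g in Q. \<not> inbox (grid_vals K g))"
proof
  assume "AE g in Q. \<not> inbox (grid_vals K g)"
  interpret product_sigma_finite "\<lambda>_ :: nat. lborel :: real measure" by standard
  let ?M = "PiM {1..K - 1} (\<lambda>_ :: nat. lborel :: real measure)"
  define box where "box = (\<Pi>\<^sub>E i\<in>{1..K - 1}. {a i - \<delta> <..< a i + \<delta>})"
  have box [measurable]: "box \<in> sets ?M" unfolding box_def by (intro sets_PiM_I_finite) auto
  define \<rho> where "\<rho> = dirichlet_density \<beta> (K - 1) (\<lambda>j. real j / real K)"
  have [measurable]: "\<rho> \<in> borel_measurable ?M" unfolding \<rho>_def by measurable
  have idx: "{1..K - 1} = {1..<K}" by auto
  have in_box: "fine_vec K g \<in> box \<longleftrightarrow> inbox (grid_vals K g)" for g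
    unfolding box_def inbox_def fine_vec_def idx
    by (auto simp: PiE_iff grid_vals_def abs_less_iff)
  have "(\<integral>\<^sup>+ g. indicator box (fine_vec K g) \<partial>Q) = (\<integral>\<^sup>+ g. 0 \<partial>Q)"
    using \<open>AE g in Q. \<not> inbox (grid_vals K g)\<close>
    by (intro nn_integral_cong_AE, eventually_elim) (simp add: in_box indicator_def)
  then have "(\<integral>\<^sup>+ z. ennreal (\<rho> z) * indicator box z \<partial>?M) = 0"
    using nn_integral_fine_vec[OF K borel_measurable_indicator[OF box]] unfolding \<rho>_def by simp
  moreover have "(\<lambda>z. ennreal (\<rho> z) * indicator box z) \<in> borel_measurable ?M" by measurable
  ultimately have ae: "AE z in ?M. ennreal (\<rho> z) * indicator box z = (0 :: ennreal)"
    using nn_integral_0_iff_AE by blast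
  have pos: "0 < \<rho> z" if z: "z \<in> box" for z
  proof -
    define x where "x = ext_pts (K - 1) z"
    have "inbox x"
      using z unfolding inbox_def x_def box_def ext_pts_def PiE_iff idx by (auto simp: abs_less_iff Ball_def)
    moreover have "x 0 = 0" "x K = 1" using K by (auto simp: x_def ext_pts_def)
    ultimately have g: "x i < x (Suc i)" if "i < K" for i
      using gap_shift[of x i 0] that c by auto
    have "0 < Gamma \<beta> / (\<Prod>i\<le>K - 1. Gamma (\<beta> * (real (Suc i) / real K - real i / real K)))
        * (\<Prod>i\<le>K - 1. (x (Suc i) - x i) powr (\<beta> * (real (Suc i) / real K - real i / real K) - 1))"
    proof (intro mult_pos_pos divide_pos_pos prod_pos ballI)
      fix i assume "i \<in> {..K - 1}"
      show "0 < Gamma (\<beta> * (real (Suc i) / real K - real i / real K))"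
        using \<beta>_pos K by (intro Gamma_real_pos) (simp add: diff_divide_distrib[symmetric])
      show "0 < (x (Suc i) - x i) powr (\<beta> * (real (Suc i) / real K - real i / real K) - 1)"
        using g[of i] \<open>i \<in> {..K - 1}\<close> K by (cases K) auto
    qed (use \<beta>_pos Gamma_real_pos in auto)
    moreover have "\<forall>i\<le>K - 1. x i < x (Suc i)" using g K by auto
    ultimately show ?thesis unfolding \<rho>_def dirichlet_density_def Let_def x_def by simp
  qed
  have "AE z in ?M. z \<notin> box"
    using ae
  proof eventually_elim
    case (elim z)
    show ?case
    proof
      assume z: "z \<in> box"
      then have "\<rho> z \<le> 0" using elim by (simp add: ennreal_eq_0_iff)
      then show False using pos[OF z] by simp
    qed
  qed
  then have "emeasure ?M box = 0"
    using box sets.sets_into_space[OF box] by (subst (asm) AE_iff_measurable[OF box]) auto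
  moreover have "emeasure ?M box = (\<Prod>i\<in>{1..K - 1}. ennreal (2 * \<delta>))"
    unfolding box_def using assms by (subst emeasure_PiM) auto
  ultimately show False using assms by (simp add: prod_ennreal)
qed

end

text \<open>Within a cell each map lies between its neighbouring grid values, so the two differ by
  at most \<eta> plus the increment of \<open>h\<close> over the cell. Cells have length 1/K and the
  increments of \<open>h\<close> add up to 1: monotonicity gives the uniform error 1/K that a
  modulus of continuity would otherwise have to provide.\<close>

lemma L1dist_le:
  assumes g: "g \<in> G0" and h: "h \<in> G0" and K: "0 < K"
    and close: "\<And>i. i \<le> K \<Longrightarrow> \<bar>grid_vals K g i - grid_vals K h i\<bar> \<le> \<eta>"
  shows "(\<integral>r. \<bar>g r - h r\<bar> \<partial>unit_lebesgue) \<le> 1 / real K + \<eta>" "integrable unit_lebesgue (\<lambda>r. \<bar>g r - h r\<bar>)"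
proof -
  have \<eta>: "0 \<le> \<eta>" using close[of 0] by auto
  note [measurable] = G0_borel[OF g] G0_borel[OF h]
  have m: "(\<lambda>r. \<bar>g r - h r\<bar>) \<in> borel_measurable borel" by measurable
  have "\<bar>\<bar>g r - h r\<bar>\<bar> \<le> 1" for r using G0_range[OF g, of r] G0_range[OF h, of r] by auto
  from unit_lebesgue_integral(1)[OF m this] show int: "integrable unit_lebesgue (\<lambda>r. \<bar>g r - h r\<bar>)" .
  define J where "J i = {real i / real K ..< real (Suc i) / real K}" for i
  define \<Delta> where "\<Delta> i = grid_vals K h (Suc i) - grid_vals K h i" for i
  define S where "S r = (\<Sum>i<K. \<Delta> i * indicator (J i) r) + \<eta>" for r
  have \<Delta>0: "0 \<le> \<Delta> i" for i
    using grid_vals_cell[OF h K, of i "real i / real K"] K by (auto simp: \<Delta>_def field_simps)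
  have J01: "J i \<subseteq> {0..1}" if "i < K" for i
  proof -
    have "real (Suc i) / real K \<le> 1" using that by simp
    moreover have "0 \<le> real i / real K" by simp
    ultimately show ?thesis unfolding J_def atLeastLessThan_subseteq_atLeastAtMost_iff by linarith
  qed
  have bS: "has_bochner_integral unit_lebesgue S ((\<Sum>i<K. \<Delta> i * measure unit_lebesgue (J i)) + \<eta>)"
    unfolding S_def
  proof (intro has_bochner_integral_add has_bochner_integral_sum has_bochner_integral_mult_right has_bochner_integral_real_indicator)
    fix i assume "i \<in> {..<K}"
    then show "J i \<in> sets unit_lebesgue" using J01[of i] by (auto simp: sets_restrict_space_iff J_def)
    show "emeasure unit_lebesgue (J i) < \<infinity>"
      by (rule le_less_trans[OF unit_lebesgue.emeasure_le_1]) simp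
  next
    show "has_bochner_integral unit_lebesgue (\<lambda>_. \<eta>) \<eta>"
      using unit_lebesgue.prob_space by (simp add: has_bochner_integral_iff)
  qed
  then have intS: "integrable unit_lebesgue S" by (simp add: has_bochner_integral_iff)
  have "(\<integral>r. \<bar>g r - h r\<bar> \<partial>unit_lebesgue) \<le> (\<integral>r. S r \<partial>unit_lebesgue)"
  proof (rule integral_mono[OF int intS])
    fix r assume "r \<in> space unit_lebesgue"
    then have r: "0 \<le> r" "r \<le> 1" by (auto simp: space_restrict_space)
    show "\<bar>g r - h r\<bar> \<le> S r"
    \<comment> \<open>The half-open cells miss the right end point, where both maps equal 1.\<close>
    proof (cases "r = 1")
      case True
      then have "g r = 1" "h r = 1" using g h by (auto simp: G0_def)
      then show ?thesis using \<eta> \<Delta>0 by (auto simp: S_def intro!: add_nonneg_nonneg sum_nonneg)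
    next
      case False
      then have "r < 1" using r by simp
      define i where "i = nat \<lfloor>real K * r\<rfloor>"
      have i: "i < K" "real i / real K \<le> r" "r < real (Suc i) / real K"
        using grid_cell[OF K r(1) \<open>r < 1\<close>] by (auto simp: i_def)
      have "\<bar>g r - h r\<bar> \<le> \<Delta> i + \<eta>"
        using grid_vals_cell[OF g K i(2,3)] grid_vals_cell[OF h K i(2,3)] close[of i] close[of "Suc i"] i(1)
        unfolding \<Delta>_def by auto
      also have "\<Delta> i = (\<Sum>j\<in>{i}. \<Delta> j * indicator (J j) r)" using i by (simp add: J_def)
      also have "\<dots> \<le> (\<Sum>j<K. \<Delta> j * indicator (J j) r)"
        using i(1) \<Delta>0 by (intro sum_mono2) (auto simp: indicator_def)
      finally show ?thesis by (simp add: S_def)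
    qed
  qed
  also have "(\<integral>r. S r \<partial>unit_lebesgue) = (\<Sum>i<K. \<Delta> i * measure unit_lebesgue (J i)) + \<eta>"
    using bS by (simp add: has_bochner_integral_iff)
  also have "(\<Sum>i<K. \<Delta> i * measure unit_lebesgue (J i)) = (\<Sum>i<K. \<Delta> i * (1 / real K))"
  proof (rule sum.cong[OF refl])
    fix i assume "i \<in> {..<K}"
    then have "measure unit_lebesgue (J i) = measure lborel (J i)"
      using J01[of i] by (intro measure_restrict_space) auto
    also have "\<dots> = 1 / real K"
      using K by (simp add: J_def measure_def diff_divide_distrib[symmetric] divide_right_mono)
    finally show "\<Delta> i * measure unit_lebesgue (J i) = \<Delta> i * (1 / real K)" by simp
  qed
  also have "\<dots> = (\<Sum>i<K. \<Delta> i) * (1 / real K)" by (simp only: sum_distrib_right)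
  also have "(\<Sum>i<K. \<Delta> i) = 1"
    unfolding \<Delta>_def by (subst sum_lessThan_telescope) (simp add: grid_vals_ends[OF h K])
  finally show "(\<integral>r. \<bar>g r - h r\<bar> \<partial>unit_lebesgue) \<le> 1 / real K + \<eta>" by simp
qed

lemma L2dist_square_le_L1:
  assumes g: "g \<in> G0" and h: "h \<in> G0" and i: "integrable unit_lebesgue (\<lambda>r. \<bar>g r - h r\<bar>)"
  shows "(L2dist g h)\<^sup>2 \<le> (\<integral>r. \<bar>g r - h r\<bar> \<partial>unit_lebesgue)"
  unfolding L2dist_square(2)[OF g h]
proof (rule integral_mono[OF L2dist_square(1)[OF g h] i])
  fix r
  have "\<bar>g r - h r\<bar> * \<bar>g r - h r\<bar> \<le> \<bar>g r - h r\<bar> * 1"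
    using G0_range[OF g, of r] G0_range[OF h, of r] by (intro mult_left_mono) auto
  then show "(g r - h r)\<^sup>2 \<le> \<bar>g r - h r\<bar>" by (simp add: power2_eq_square abs_mult[symmetric])
qed

text \<open>Factor x^2 - y^2 = (x - y)(x + y) with x = f - g and y = h - k. Since |x + y| is at most
  2, the squared distance changes by at most twice the L1 errors made in passing from
  \<open>f\<close> to \<open>h\<close> and from \<open>g\<close> to \<open>k\<close>.\<close>

lemma L2dist_square_perturb:
  assumes G: "f \<in> G0" "g \<in> G0" "h \<in> G0" "k \<in> G0"
    and i: "integrable unit_lebesgue (\<lambda>r. \<bar>f r - h r\<bar>)" "integrable unit_lebesgue (\<lambda>r. \<bar>g r - k r\<bar>)"
  shows "(L2dist f g)\<^sup>2 \<le> (L2dist k h)\<^sup>2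
    + 2 * ((\<integral>r. \<bar>f r - h r\<bar> \<partial>unit_lebesgue) + (\<integral>r. \<bar>g r - k r\<bar> \<partial>unit_lebesgue))"
proof -
  have "(L2dist f g)\<^sup>2 = (\<integral>r. (f r - g r)\<^sup>2 \<partial>unit_lebesgue)" by (rule L2dist_square(2)[OF G(1,2)])
  also have "\<dots> \<le> (\<integral>r. (k r - h r)\<^sup>2 + 2 * (\<bar>f r - h r\<bar> + \<bar>g r - k r\<bar>) \<partial>unit_lebesgue)"
  proof (rule integral_mono)
    show "integrable unit_lebesgue (\<lambda>r. (f r - g r)\<^sup>2)" by (rule L2dist_square(1)[OF G(1,2)])
    show "integrable unit_lebesgue (\<lambda>r. (k r - h r)\<^sup>2 + 2 * (\<bar>f r - h r\<bar> + \<bar>g r - k r\<bar>))"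
      using L2dist_square(1)[OF G(4,3)] i by simp
    fix r
    define x y where "x = f r - g r" "y = h r - k r"
    have b: "\<bar>x\<bar> \<le> 1" "\<bar>y\<bar> \<le> 1"
      using G0_range[OF G(1), of r] G0_range[OF G(2), of r] G0_range[OF G(3), of r] G0_range[OF G(4), of r]
      by (auto simp: x_y_def)
    have "x\<^sup>2 - y\<^sup>2 \<le> \<bar>x - y\<bar> * \<bar>x + y\<bar>"
      by (simp add: abs_mult[symmetric] power2_eq_square algebra_simps)
    also have "\<dots> \<le> \<bar>x - y\<bar> * 2" using b by (intro mult_left_mono) auto
    also have "\<bar>x - y\<bar> \<le> \<bar>f r - h r\<bar> + \<bar>g r - k r\<bar>" by (simp add: x_y_def)
    finally show "(f r - g r)\<^sup>2 \<le> (k r - h r)\<^sup>2 + 2 * (\<bar>f r - h r\<bar> + \<bar>g r - k r\<bar>)"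
      by (simp add: x_y_def power2_commute[of "k r"])
  qed
  also have "\<dots> = (L2dist k h)\<^sup>2
    + 2 * ((\<integral>r. \<bar>f r - h r\<bar> \<partial>unit_lebesgue) + (\<integral>r. \<bar>g r - k r\<bar> \<partial>unit_lebesgue))"
    using L2dist_square[OF G(4,3)] i by simp
  finally show ?thesis .
qed

text \<open>An interior grid point is the left end of its cell, where the relative position is 0 and
  the interpolation returns \<open>v i\<close>; at indices 0 and \<open>K\<close> both the
  displacement and the change of the value are 0.\<close>

lemma grid_vals_shift:
  assumes "grid_shift K v a \<delta> c" "g \<in> G0" "grid_shift.inbox K a \<delta> (grid_vals K g)" "i \<le> K"
  shows "grid_vals K (grid_shift.shift K v a \<delta> 1 g) i = grid_vals K g i + v i"
proof -
  interpret grid_shift K v a \<delta> c by fact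
  consider "i = 0" | "i = K" | "0 < i" "i < K" using assms(4) by linarith
  then show ?thesis
  proof cases
    case 1
    then show ?thesis using v by (simp add: grid_vals_def)
  next
    case 2
    then show ?thesis
      using v grid_vals_ends(2)[OF assms(2) K] grid_vals_ends(2)[OF shift_in_G0[OF assms(2)] K] by simp
  next
    case 3
    have n: "nat \<lfloor>real K * (real i / real K)\<rfloor> = i" using K by simp
    have "field g (real i / real K) = interp v (grid_vals K g) i (g (real i / real K))"
      using 3 unfolding field_def n by simp
    also have "\<dots> = v i" using 3 by (simp add: interp_def grid_vals_def)
    finally show ?thesis using 3 assms(3) by (simp add: grid_vals_def shift_def)
  qed
qed

text \<open>Given maps may be constant on long stretches, where the grid values leave no room for a
  box. Both are therefore mixed with a small proportion \<eta> of the uniform grid, which forces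
  gaps of at least \<eta>/K. Of the slack 7e, one e is lost to continuity at each end, 4e to the
  almost everywhere estimate, and one e to the comparison of distances.\<close>

lemma (in dirichlet_process) increment_le:
  assumes cont: "continuous_G0 u" and u: "dom_E_grad Q u F" and \<Gamma>: "AE g in Q. Gamma_uu F g \<le> 1"
    and G: "g0 \<in> G0" "h0 \<in> G0" and e: "0 < e" "e \<le> 1"
  shows "\<bar>u g0 - u h0\<bar> \<le> L2dist g0 h0 + 7 * e"
proof -
  obtain d1 where d1: "d1 > 0" "\<And>h. h \<in> G0 \<Longrightarrow> L2dist g0 h < d1 \<Longrightarrow> \<bar>u h - u g0\<bar> < e"
    using cont G e unfolding continuous_G0_def by meson
  obtain d2 where d2: "d2 > 0" "\<And>h. h \<in> G0 \<Longrightarrow> L2dist h0 h < d2 \<Longrightarrow> \<bar>u h - u h0\<bar> < e"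
    using cont G e unfolding continuous_G0_def by meson
  \<comment> \<open>Each end will carry an L1 error of at most 3/K, which must push the squared L2
    distance below \<open>d1\<close> squared and \<open>d2\<close> squared; the 12 is 2 (3 + 3) from
    \<open>L2dist_square_perturb\<close>.\<close>
  obtain K :: nat where Kbig: "12 / e\<^sup>2 + 3 / d1\<^sup>2 + 3 / d2\<^sup>2 + 1 < real K" using reals_Archimedean2 by blast
  have nn: "0 < 12 / e\<^sup>2" "0 < 3 / d1\<^sup>2" "0 < 3 / d2\<^sup>2" using e d1(1) d2(1) by auto
  then have K1: "1 < real K" "12 / e\<^sup>2 < real K" "3 / d1\<^sup>2 < real K" "3 / d2\<^sup>2 < real K" using Kbig by linarith+
  then have K: "0 < K" by simp
  have Ke: "12 / real K < e\<^sup>2" "3 / real K < d1\<^sup>2" "3 / real K < d2\<^sup>2"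
    using K1 e d1(1) d2(1) by (auto simp: field_simps)
  define \<eta> where "\<eta> = 1 / real K"
  \<comment> \<open>A quarter of the minimal gap \<eta>/K: inside the box two neighbouring values
    deviate by at most \<delta> each, so gaps of 2\<delta> remain.\<close>
  define \<delta> where "\<delta> = 1 / (4 * (real K)\<^sup>2)"
  have \<eta>: "0 < \<eta>" "\<eta> < 1" using K1(1) by (auto simp: \<eta>_def)
  have \<delta>: "0 < \<delta>" "4 * \<delta> = \<eta> / real K" using K by (auto simp: \<delta>_def \<eta>_def power2_eq_square)
  have \<delta>\<eta>: "\<delta> \<le> \<eta>"
  proof -
    have "\<eta> / real K \<le> \<eta>" using \<eta> K1(1) by (simp add: divide_le_eq)
    then show ?thesis using \<delta> by linarith
  qed
  define ap where "ap g i = (1 - \<eta>) * grid_vals K g i + \<eta> * (real i / real K)" for g i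
  have ap_ends: "ap g 0 = 0" "ap g K = 1" if "g \<in> G0" for g
    using grid_vals_ends[OF that K] K by (auto simp: ap_def)
  have ap_gap: "4 * \<delta> \<le> ap g (Suc i) - ap g i" if "g \<in> G0" for g i
  proof -
    have "grid_vals K g i \<le> grid_vals K g (Suc i)"
      using grid_vals_cell[OF that K, of i "real i / real K"] K by (simp add: divide_strict_right_mono)
    then have "(1 - \<eta>) * grid_vals K g i \<le> (1 - \<eta>) * grid_vals K g (Suc i)" using \<eta> by (intro mult_left_mono) auto
    moreover have "\<eta> * (real (Suc i) / real K) = \<eta> * (real i / real K) + 4 * \<delta>"
      unfolding \<delta>(2) by (simp add: add_divide_distrib distrib_left)
    ultimately show ?thesis unfolding ap_def by linarith
  qed
  have ap_close: "\<bar>ap g i - grid_vals K g i\<bar> \<le> \<eta>" if "g \<in> G0" "i \<le> K" for g i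
  proof -
    have "ap g i - grid_vals K g i = \<eta> * (real i / real K - grid_vals K g i)" by (simp add: ap_def algebra_simps)
    moreover have "\<bar>real i / real K - grid_vals K g i\<bar> \<le> 1"
    proof -
      have "0 \<le> real i / real K" "real i / real K \<le> 1" using that K by auto
      moreover have "0 \<le> grid_vals K g i" "grid_vals K g i \<le> 1" using G0_range[OF that(1)] by (auto simp: grid_vals_def)
      ultimately show ?thesis unfolding abs_le_iff by linarith
    qed
    ultimately have "\<bar>ap g i - grid_vals K g i\<bar> \<le> \<eta> * 1"
      using \<eta> by (simp only: abs_mult) (intro mult_mono; auto)
    then show ?thesis by simp
  qed
  define a where "a = ap g0"
  \<comment> \<open>One displacement for the whole box: it carries the box around the mixed values
    of \<open>g0\<close> to the box of the same size around those of \<open>h0\<close>.\<close>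
  define v where "v i = ap h0 i - ap g0 i" for i
  have near: "\<bar>x i - a i\<bar> \<le> \<delta>" if "x 0 = 0" "x K = 1" "\<forall>i\<in>{1..<K}. \<bar>x i - a i\<bar> < \<delta>" and i: "i \<le> K" for x i
  proof -
    consider "i = 0" | "i = K" | "i \<in> {1..<K}" using i by fastforce
    then show ?thesis using that(1-3) ap_ends[OF G(1)] \<delta> by cases (auto simp: a_def less_imp_le)
  qed
  interpret shifted_process \<beta> Q K v a \<delta> "2 * \<delta>"
  proof unfold_locales
    show "0 < K" "0 < 2 * \<delta>" by (use K \<delta> in auto)
    show "v 0 = 0" "v K = 0" using ap_ends[OF G(1)] ap_ends[OF G(2)] by (auto simp: v_def)
    fix x :: "nat \<Rightarrow> real" and i
    assume x: "x 0 = 0" "x K = 1" "\<forall>i\<in>{1..<K}. \<bar>x i - a i\<bar> < \<delta>" and i: "i < K"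
    show "2 * \<delta> \<le> x (Suc i) - x i \<and> 2 * \<delta> \<le> (x (Suc i) + v (Suc i)) - (x i + v i)"
      using near[OF x, of i] near[OF x, of "Suc i"] i ap_gap[OF G(1), of i] ap_gap[OF G(2), of i]
      unfolding v_def a_def by (auto simp: abs_le_iff)
  qed
  obtain g where g: "g \<in> G0" "inbox (grid_vals K g)" and inc: "\<bar>u (shift 1 g) - u g\<bar> \<le> L2dist (shift 1 g) g + 4 * e"
  proof (rule ccontr)
    assume no: "\<not> thesis"
    have "AE g in Q. \<not> inbox (grid_vals K g)"
      using AE_increment_le[OF u \<Gamma> e] AE_space by eventually_elim (use no that in auto)
    then show False using not_AE_outside_box[OF \<delta>(1)] by simp
  qed
  define f where "f = shift 1 g"
  have f: "f \<in> G0" unfolding f_def by (rule shift_in_G0[OF g(1)])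
  have ng: "\<bar>grid_vals K g i - a i\<bar> \<le> \<delta>" if "i \<le> K" for i
    using near[OF grid_vals_ends[OF g(1) K] _ that] g(2) by (simp add: inbox_def)
  have nf: "\<bar>grid_vals K f i - ap h0 i\<bar> \<le> \<delta>" if "i \<le> K" for i
    using ng[OF that] grid_vals_shift[OF grid_shift_axioms g that] by (simp add: f_def v_def a_def)
  \<comment> \<open>\<eta> from the mixing plus \<delta> from the box is at most 2\<eta>; together
    with the 1/K of \<open>L1dist_le\<close> this makes 3/K.\<close>
  have cg: "\<bar>grid_vals K g i - grid_vals K g0 i\<bar> \<le> 2 * \<eta>" if "i \<le> K" for i
    using ng[OF that] ap_close[OF G(1) that] \<delta>\<eta> by (simp add: a_def)
  have cf: "\<bar>grid_vals K f i - grid_vals K h0 i\<bar> \<le> 2 * \<eta>" if "i \<le> K" for i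
    using nf[OF that] ap_close[OF G(2) that] \<delta>\<eta> by simp
  have L1: "(\<integral>r. \<bar>g r - g0 r\<bar> \<partial>unit_lebesgue) \<le> 3 / real K" "(\<integral>r. \<bar>f r - h0 r\<bar> \<partial>unit_lebesgue) \<le> 3 / real K"
    using L1dist_le(1)[OF g(1) G(1) K cg] L1dist_le(1)[OF f G(2) K cf] by (auto simp: \<eta>_def)
  note int = L1dist_le(2)[OF g(1) G(1) K cg] L1dist_le(2)[OF f G(2) K cf]
  have sym: "L2dist x y = L2dist y x" for x y by (simp add: L2dist_def power2_commute)
  have "(L2dist g0 g)\<^sup>2 < d1\<^sup>2"
    using L2dist_square_le_L1[OF g(1) G(1) int(1)] L1(1) Ke(2) by (simp add: sym[of g0])
  then have 1: "\<bar>u g - u g0\<bar> < e"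
    using d1 g(1) by (intro d1(2)) (auto intro: power2_less_imp_less)
  have "(L2dist h0 f)\<^sup>2 < d2\<^sup>2"
    using L2dist_square_le_L1[OF f G(2) int(2)] L1(2) Ke(3) by (simp add: sym[of h0])
  then have 2: "\<bar>u f - u h0\<bar> < e"
    using d2 f by (intro d2(2)) (auto intro: power2_less_imp_less)
  have "(L2dist f g)\<^sup>2 \<le> (L2dist g0 h0)\<^sup>2 + 12 / real K"
    using L2dist_square_perturb[OF f g(1) G(2,1) int(2,1)] L1 by simp
  also have "\<dots> \<le> (L2dist g0 h0)\<^sup>2 + 2 * L2dist g0 h0 * e + e\<^sup>2"
    using Ke(1) mult_nonneg_nonneg[OF L2dist_nonneg[OF G], of e] e by linarith
  also have "\<dots> = (L2dist g0 h0 + e)\<^sup>2" by (simp add: power2_sum)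
  finally have 3: "L2dist f g \<le> L2dist g0 h0 + e"
    by (rule power2_le_imp_le) (use L2dist_nonneg[OF G] e in auto)
  show ?thesis using 1 2 3 inc unfolding f_def[symmetric] by linarith
qed

theorem theorem7p11:
  fixes \<beta> :: real and Q :: "(real \<Rightarrow> real) measure"
    and u :: "(real \<Rightarrow> real) \<Rightarrow> real" and F :: "(real \<Rightarrow> real) \<Rightarrow> real \<Rightarrow> real"
  assumes "\<beta> > 0"
    and "is_Q_beta \<beta> Q"
    and "continuous_G0 u"
    and "dom_E_grad Q u F"
    and "AE g in Q. Gamma_uu F g \<le> 1"
  shows "\<forall>g\<in>G0. \<forall>h\<in>G0. \<bar>u g - u h\<bar> \<le> L2dist g h"
proof (intro ballI)
  interpret dirichlet_process \<beta> Q using assms(1,2) by unfold_locales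
  fix g h assume G: "g \<in> G0" "h \<in> G0"
  show "\<bar>u g - u h\<bar> \<le> L2dist g h"
  proof (rule field_le_epsilon)
    fix e :: real assume "0 < e"
    \<comment> \<open>The minimum with 1 meets the requirement in \<open>increment_le\<close> that
      the error be at most 1.\<close>
    then have "\<bar>u g - u h\<bar> \<le> L2dist g h + 7 * min 1 (e / 7)"
      using assms(3-5) G by (intro increment_le) auto
    then show "\<bar>u g - u h\<bar> \<le> L2dist g h + e" by linarith
  qed
qed

end
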